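(* Let $d\ge 1$, let $G_0\subset\mathbb{R}^d$ be a bounded open interval if $d=1$, or a bounded $C^{1,1}$ open set if $d\geq 2$. Let $R_1,\dots,R_N$ be similitudes of $\mathbb{R}^d$ with coefficients $r_1,\dots,r_N>0$ satisfying $\sum_{j=1}^N r_j^d<1<\sum_{j=1}^N r_j^{d-1}$, let $$G=\bigg(\bigcup_{n=1}^\infty\ \bigcup_{(j_1,\dots,j_n)\in\{1,\dots,N\}^n}R_{j_1}\circ\cdots\circ R_{j_n}(G_0)\bigg)\cup G_0,$$ and assume that the sets $R_1G,\dots,R_NG,G_0$ are pairwise disjoint. Let $\mathfrak{b}\in(d-1,d)$ be the unique number with $\sum_{j=1}^N r_j^{\mathfrak{b}}=1$, and let $\alpha\in(d-\mathfrak{b},2)$. If $\{\ln\frac{1}{r_j}\}_{j=1}^N$ is non-arithmetic, then $$\tilde{Q}^{(\alpha)}_{G}(t)=|G|-C_{1}t^{\frac{d-\mathfrak{b}}{\alpha}}+o\big(t^{\frac{d-\mathfrak{b}}{\alpha}}\big)\quad\text{as } t\to 0,$$ where $$C_{1}=\frac{\int_{-\infty}^{\infty}\left(|G_{0}|-\tilde{Q}_{G_{0}}^{(\alpha)}(e^{-z})\right)e^{\frac{(d-\mathfrak{b})z}{\alpha}}dz}{\sum_{j=1}^{N}r_{j}^{\mathfrak{b}}\ln(1/r_{j}^{\alpha})}=\frac{\int_{0}^{\infty}\left(|G_{0}|-\tilde{Q}_{G_0}^{(\alpha)}(t)\right)t^{-1-\frac{d-\mathfrak{b}}{\alpha}}dt}{\sum_{j=1}^{N}r_{j}^{\mathfrak{b}}\ln(1/r_{j}^{\alpha})}.$$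 If $\{\ln\frac{1}{r_j}\}_{j=1}^N$ is arithmetic with span $\rho$, then $$\tilde{Q}^{(\alpha)}_{G}(t)=|G|-f(-\ln t)\,t^{\frac{d-\mathfrak{b}}{\alpha}}+o\big(t^{\frac{d-\mathfrak{b}}{\alpha}}\big)\quad\text{as } t\to0,$$ where $$f(z)=\frac{\alpha\rho}{\sum_{j=1}^{N}r_{j}^{\mathfrak{b}}\ln(1/r_{j}^{\alpha})}\sum_{n=-\infty}^{\infty}\left(|G_{0}|-\tilde{Q}_{G_{0}}^{(\alpha)}\big(e^{-(z-\alpha n\rho)}\big)\right)e^{\frac{d-\mathfrak{b}}{\alpha}(z-\alpha n \rho)}.$$
   Context: A map $R:\mathbb{R}^d\to\mathbb{R}^d$ is a similitude with coefficient $r>0$ if $|Rx-Ry|=r|x-y|$ for all $x,y\in\mathbb{R}^d$. $|A|$ denotes the $d$-dimensional Lebesgue measure of a set $A$. The set $G$ satisfies $G=(\bigcup_{j=1}^N R_jG)\cup G_0$ and has finite volume. A finite set of real numbers $\{\gamma_1,\dots,\gamma_N\}$ is arithmetic if $\gamma_i/\gamma_j\in\mathbb{Q}$ for all $i,j$; the maximal number $\gamma$ such that $\gamma_i/\gamma\in\mathbb{Z}$ for all $i$ is called its span. If the set is not arithmetic it is called non-arithmetic. Let $W=\{W_t\}_{t\ge0}$ be Brownian motion in $\mathbb{R}^d$, with $\mathbb{P}_x$ the law under which it starts at $x$, and let $S^{(\alpha/2)}=\{S^{(\alpha/2)}_t\}_{t\ge0}$ be an $(\alpha/2)$-stable subordinator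 (started at $0$), independent of $W$, with $\mathbb{E}[e^{-\lambda S_t^{(\alpha/2)}}]=e^{-t\lambda^{\alpha/2}}$ for $\lambda>0$, $\alpha\in(0,2)$. For an open set $D\subset\mathbb{R}^d$ put $\tau_D^{(2)}=\inf\{t>0: W_t\notin D\}$. The spectral heat content of $D$ for the subordinate killed Brownian motion is $$\tilde{Q}_{D}^{(\alpha)}(t)=\int_{D}\mathbb{P}_{x}\big(\tau_{D}^{(2)} > S_{t}^{(\alpha/2)}\big)dx.$$ *)

theory Defs
  imports "HOL-Probability.Probability" "HOL-Library.Landau_Symbols"
begin

definition similitude :: "('a::euclidean_space \<Rightarrow> 'a) \<Rightarrow> real \<Rightarrow> bool" where
  "similitude R r \<longleftrightarrow> r > 0 \<and> (\<forall>x y. norm (R x - R y) = r * norm (x - y))"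

text \<open>
  The local coordinate system at a boundary point \<open>z\<close> is given by its last axis, the unit
  vector \<open>\<nu>\<close>. The space of the remaining \<open>d - 1\<close> coordinates is the hyperplane
  \<open>H\<close> orthogonal to \<open>\<nu>\<close>; \<open>\<phi>\<close> and its gradient \<open>g\<close> only matter on \<open>H\<close>.
  The radius \<open>\<delta>\<close> and the constant \<open>\<Lambda>\<close> do not depend on \<open>z\<close>.
\<close>

definition C11_open :: "'a::euclidean_space set \<Rightarrow> bool" where
  "C11_open D \<longleftrightarrow> open D \<and>
     (\<exists>\<delta>>0. \<exists>\<Lambda>>0. \<forall>z\<in>frontier D. \<exists>\<nu> \<phi> g.
        let H = {x. x \<bullet> \<nu> = 0} in
          norm \<nu> = 1 \<and> \<phi> 0 = 0 \<and> g 0 = 0 \<and>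
          (\<forall>x\<in>H. g x \<in> H \<and> (\<phi> has_derivative (\<lambda>h. g x \<bullet> h)) (at x within H)
                 \<and> norm (g x) \<le> \<Lambda>) \<and>
          (\<forall>x\<in>H. \<forall>y\<in>H. norm (g x - g y) \<le> \<Lambda> * norm (x - y)) \<and>
          D \<inter> ball z \<delta> =
            {y \<in> ball z \<delta>. \<phi> ((y - z) - ((y - z) \<bullet> \<nu>) *\<^sub>R \<nu>) < (y - z) \<bullet> \<nu>})"

definition word_map :: "(nat \<Rightarrow> 'a \<Rightarrow> 'a) \<Rightarrow> nat list \<Rightarrow> 'a \<Rightarrow> 'a" where
  "word_map R js = foldr (\<lambda>j f. R j \<circ> f) js id"

definition self_similar_set :: "(nat \<Rightarrow> 'a \<Rightarrow> 'a) \<Rightarrow> nat \<Rightarrow> 'a set \<Rightarrow> 'a set" where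
  "self_similar_set R N G0 =
     (\<Union>n\<in>{1..}. \<Union>js\<in>{js. length js = n \<and> set js \<subseteq> {1..N}}. word_map R js ` G0) \<union> G0"

definition arithmetic :: "real set \<Rightarrow> bool" where
  "arithmetic A \<longleftrightarrow> (\<forall>x\<in>A. \<forall>y\<in>A. x / y \<in> \<rat>)"

text \<open>The value \<open>\<gamma> = 0\<close> is excluded because \<open>x / 0 = 0\<close> would make it admissible.\<close>

definition arithmetic_span :: "real set \<Rightarrow> real" where
  "arithmetic_span A = (GREATEST \<gamma>. \<gamma> \<noteq> 0 \<and> (\<forall>x\<in>A. x / \<gamma> \<in> \<int>))"

text \<open>
  Processes are indexed by the reals, but only times \<open>t \<ge> 0\<close> matter.
\<close>

definition indep_increments ::
  "'w measure \<Rightarrow> (real \<Rightarrow> 'w \<Rightarrow> 'a::euclidean_space) \<Rightarrow> bool" where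
  "indep_increments M X \<longleftrightarrow>
     (\<forall>(t::nat \<Rightarrow> real) n. 0 \<le> t 0 \<and> incseq t \<longrightarrow>
        prob_space.indep_vars M (\<lambda>_. borel) (\<lambda>i \<omega>. X (t (Suc i)) \<omega> - X (t i) \<omega>) {..<n})"

text \<open>
  Standard Brownian motion started at the origin (covariance \<open>t\<close> times the identity at time
  \<open>t\<close>). Continuity is required of every path, not just of almost every one, so that exit times
  are measurable although \<open>M\<close> need not be complete.
\<close>

definition brownian_motion ::
  "'w measure \<Rightarrow> (real \<Rightarrow> 'w \<Rightarrow> 'a::euclidean_space) \<Rightarrow> bool" where
  "brownian_motion M W \<longleftrightarrow>
     prob_space M \<and>
     (\<forall>t\<ge>0. W t \<in> borel_measurable M) \<and>
     (AE \<omega> in M. W 0 \<omega> = 0) \<and>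
     indep_increments M W \<and>
     (\<forall>s t. 0 \<le> s \<and> s < t \<longrightarrow>
        distributed M lborel (\<lambda>\<omega>. W t \<omega> - W s \<omega>)
          (\<lambda>y. ennreal (exp (- (norm y)\<^sup>2 / (2 * (t - s)))
                          / (2 * pi * (t - s)) powr (real DIM('a) / 2)))) \<and>
     (\<forall>\<omega>\<in>space M. continuous_on {0..} (\<lambda>t. W t \<omega>))"

definition stable_subordinator ::
  "'w measure \<Rightarrow> real \<Rightarrow> (real \<Rightarrow> 'w \<Rightarrow> real) \<Rightarrow> bool" where
  "stable_subordinator M \<beta> S \<longleftrightarrow>
     prob_space M \<and>
     (\<forall>t\<ge>0. S t \<in> borel_measurable M) \<and>
     (AE \<omega> in M. S 0 \<omega> = 0) \<and>
     indep_increments M S \<and>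
     (\<forall>s t. 0 \<le> s \<and> s \<le> t \<longrightarrow>
        distr M borel (\<lambda>\<omega>. S t \<omega> - S s \<omega>) = distr M borel (S (t - s))) \<and>
     (AE \<omega> in M. mono_on {0..} (\<lambda>t. S t \<omega>)
                 \<and> (\<forall>t\<ge>0. continuous (at_right t) (\<lambda>t. S t \<omega>))) \<and>
     (\<forall>t\<ge>0. \<forall>l>0. prob_space.expectation M (\<lambda>\<omega>. exp (- l * S t \<omega>)) = exp (- t * l powr \<beta>))"

definition process_algebra ::
  "'w measure \<Rightarrow> (real \<Rightarrow> 'w \<Rightarrow> 'b::topological_space) \<Rightarrow> 'w measure" where
  "process_algebra M X =
     vimage_algebra (space M) (\<lambda>\<omega>. \<lambda>t\<in>{0..}. X t \<omega>) (Pi\<^sub>M {0..} (\<lambda>_. borel))"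

definition indep_processes ::
  "'w measure \<Rightarrow> (real \<Rightarrow> 'w \<Rightarrow> 'b::topological_space) \<Rightarrow> (real \<Rightarrow> 'w \<Rightarrow> 'c::topological_space) \<Rightarrow> bool" where
  "indep_processes M X Y \<longleftrightarrow>
     prob_space.indep_set M (sets (process_algebra M X)) (sets (process_algebra M Y))"

text \<open>The exit time is \<open>\<infinity>\<close> for a path that never leaves \<open>D\<close>.\<close>

definition exit_time :: "'a set \<Rightarrow> (real \<Rightarrow> 'a) \<Rightarrow> ereal" where
  "exit_time D w = Inf (ereal ` {t. t > 0 \<and> w t \<notin> D})"

text \<open>
  With \<open>W\<close> a Brownian motion started at the origin, the law of \<open>W\<close> started at \<open>x\<close> is
  the law of \<open>x + W\<close> under \<open>M\<close>.
\<close>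

definition spectral_heat_content ::
  "'w measure \<Rightarrow> (real \<Rightarrow> 'w \<Rightarrow> 'a::euclidean_space) \<Rightarrow> (real \<Rightarrow> 'w \<Rightarrow> real)
     \<Rightarrow> 'a set \<Rightarrow> real \<Rightarrow> real" where
  "spectral_heat_content M W S D t =
     (LINT x:D|lebesgue.
        measure M {\<omega> \<in> space M. exit_time D (\<lambda>s. x + W s \<omega>) > ereal (S t \<omega>)})"

end

theory Submission imports Defs begin

text \<open>
  Write \<open>u\<close> and \<open>g\<close> for the heat lost from \<open>G\<close> and from \<open>G0\<close> up to time \<open>t\<close>. Paths are
  continuous, so heat losses of disjoint open sets add up, and by Brownian and stable scaling
  \<open>u t = (\<Sum>j. r j ^ d * u (t / r j powr \<alpha>)) + g t\<close>. With \<open>t = exp (- z)\<close> and the factor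
  \<open>exp ((d - b) * z / \<alpha>)\<close> this is a renewal equation \<open>h z = (\<Sum>j. p j * h (z - a j)) + \<psi> z\<close> whose
  weights \<open>p j = r j powr b\<close> sum to 1. The forcing \<open>\<psi>\<close> decays exponentially: a boundary layer of width
  \<open>e\<close> has volume \<open>O(e)\<close>, and a path starting at distance \<open>\<delta>\<close> from the boundary exits before \<open>S t\<close> with
  probability \<open>O(min 1 (t * \<delta> powr - \<alpha>))\<close>.

  The renewal theorem needs no renewal measure. Along a sequence realizing the limit superior of \<open>h\<close>,
  the values at all translates by the semigroup generated by the \<open>a j\<close> are extremal as well, and this
  semigroup is eventually dense, respectively eventually the whole lattice. So \<open>h\<close> is nearly constant on
  a window, whose weighted average is a primitive of \<open>\<psi>\<close>; this identifies the limit superior, and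
  likewise the limit inferior.
\<close>

section \<open>The renewal equation\<close>

text \<open>Two exponents have to leave room for each other. The bound \<open>O(e)\<close> on
  boundary layers makes the power \<open>- q\<close> of the distance to the complement integrable
  for \<open>q < 1\<close>, and the exit estimate then gives
  \<open>g t = O(t powr (q / \<alpha>))\<close> for such \<open>q \<le> \<alpha>\<close>. So
  \<open>\<psi>\<close> decays as soon as \<open>q > d - b\<close>, and a suitable \<open>q\<close>
  exists exactly because \<open>d - b\<close> is below both 1 and \<open>\<alpha>\<close>. The
  function \<open>h\<close> is not known to be continuous, while extremality is obtained only at
  translates by semigroup elements. To pass from these to a whole window, monotonicity of the heat
  loss in time takes the place of uniform continuity. The window is what integrating the equation
  over a half line leaves, because the weights sum to 1. In the lattice case the periodic candidate
  is subtracted before the extremal argument, so that the limit to be identified is 0. On the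
  probabilistic side, a stable subordinator has infinite mean, so the exit estimate has to be
  truncated at 1 and read off the Laplace transform. Scaling replaces \<open>W\<close> by another
  Brownian motion on the same space; the survival probabilities agree because dyadic grids determine
  them.\<close>

inductive_set add_semigroup :: "'i set \<Rightarrow> ('i \<Rightarrow> real) \<Rightarrow> real set" for I a where
  zero: "0 \<in> add_semigroup I a"
| add: "s \<in> add_semigroup I a \<Longrightarrow> i \<in> I \<Longrightarrow> s + a i \<in> add_semigroup I a"

lemma add_semigroup_plus:
  assumes "s \<in> add_semigroup I a" "t \<in> add_semigroup I a"
  shows "s + t \<in> add_semigroup I a"
  using assms(2)
proof induction
  case zero
  then show ?case using assms(1) by simp
next
  case (add t i)
  then show ?case using add_semigroup.add[of "s + t" I a i] by (simp add: add.assoc)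
qed

lemma add_semigroup_mult:
  assumes "s \<in> add_semigroup I a"
  shows "real n * s \<in> add_semigroup I a"
proof (induction n)
  case 0
  then show ?case by (simp add: add_semigroup.zero)
next
  case (Suc n)
  then show ?case using add_semigroup_plus[OF Suc assms] by (simp add: algebra_simps)
qed

lemma add_semigroup_gen: "i \<in> I \<Longrightarrow> a i \<in> add_semigroup I a"
  using add_semigroup.add[OF add_semigroup.zero] by fastforce

text \<open>Adding \<open>q - k\<close> copies of \<open>s\<close> and \<open>k\<close> copies of
  \<open>s + \<delta>\<close> gives \<open>q * s + k * \<delta>\<close>. Once
  \<open>q \<ge> s / \<delta>\<close>, these elements step through the whole gap between
  \<open>q * s\<close> and \<open>(q + 1) * s\<close> with mesh \<open>\<delta>\<close>. The window
  is half open so that in the lattice case it isolates a single lattice point.\<close>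

lemma add_semigroup_asymptotically_dense:
  assumes s: "s \<in> add_semigroup I a" "0 < s"
    and s': "s + \<delta> \<in> add_semigroup I a" "0 < \<delta>"
  obtains T where "0 \<le> T" "\<And>v. T \<le> v \<Longrightarrow> \<exists>\<sigma>\<in>add_semigroup I a. v \<le> \<sigma> \<and> \<sigma> < v + \<delta>"
proof
  define k0 where "k0 = nat \<lceil>s / \<delta>\<rceil>"
  show "0 \<le> real k0 * s" using s by simp
  fix v assume v: "real k0 * s \<le> v"
  define q where "q = nat \<lfloor>v / s\<rfloor>"
  have v0: "v \<ge> 0" using v s by (meson of_nat_0_le_iff order_trans mult_nonneg_nonneg less_imp_le)
  have q: "real q * s \<le> v" "v < (real q + 1) * s"
  proof -
    have "real q = of_int \<lfloor>v / s\<rfloor>" unfolding q_def using v0 s by simp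
    then have "real q \<le> v / s" "v / s < real q + 1" by linarith+
    then show "real q * s \<le> v" "v < (real q + 1) * s" using s by (auto simp: field_simps)
  qed
  have k0q: "k0 \<le> q"
  proof -
    have "real k0 \<le> v / s" using v s by (simp add: field_simps)
    then have "int k0 \<le> \<lfloor>v / s\<rfloor>" by (simp add: le_floor_iff)
    then show ?thesis unfolding q_def by linarith
  qed
  define w where "w = v - real q * s"
  have w: "0 \<le> w" "w < s" using q by (auto simp: w_def algebra_simps)
  define k where "k = nat \<lceil>w / \<delta>\<rceil>"
  have "k \<le> k0" unfolding k_def k0_def using w s'
    by (intro nat_mono ceiling_mono divide_right_mono) auto
  then have kq: "k \<le> q" using k0q by simp
  have "real k = of_int \<lceil>w / \<delta>\<rceil>" unfolding k_def using w s' by simp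
  then have "w / \<delta> \<le> real k" "real k < w / \<delta> + 1" by linarith+
  then have k: "w \<le> real k * \<delta>" "real k * \<delta> < w + \<delta>" using s' by (auto simp: field_simps)
  have "real (q - k) * s + real k * (s + \<delta>) \<in> add_semigroup I a"
    by (intro add_semigroup_plus add_semigroup_mult s s')
  moreover have "real (q - k) * s + real k * (s + \<delta>) = real q * s + real k * \<delta>"
    using kq by (simp add: of_nat_diff algebra_simps)
  ultimately show "\<exists>\<sigma>\<in>add_semigroup I a. v \<le> \<sigma> \<and> \<sigma> < v + \<delta>"
    using k by (intro bexI[of _ "real q * s + real k * \<delta>"]) (auto simp: w_def)
qed

section \<open>Limits superior and extremal translates\<close>

text \<open>\<open>L\<close> is the limit superior, built as the infimum of the eventual strict
  upper bounds so that it is a real number; boundedness of \<open>h\<close> makes that set nonempty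
  and bounded below. Applied to \<open>- h\<close> the lemma yields the limit inferior.\<close>

lemma limsup_sequence:
  fixes h :: "real \<Rightarrow> real"
  assumes "eventually (\<lambda>z. \<bar>h z\<bar> \<le> B) at_top"
  obtains L z where "filterlim z at_top sequentially" "(\<lambda>n. h (z n)) \<longlonglongrightarrow> L"
    "\<And>e. 0 < e \<Longrightarrow> eventually (\<lambda>x. h x < L + e) at_top"
proof -
  define U where "U = {M. eventually (\<lambda>x. h x < M) at_top}"
  have ne: "B + 1 \<in> U" unfolding U_def using assms by (auto elim!: eventually_mono)
  have bd: "-B - 1 \<le> M" if "M \<in> U" for M
  proof -
    have "eventually (\<lambda>x. h x < M \<and> \<bar>h x\<bar> \<le> B) at_top"
      using that assms unfolding U_def by (auto intro: eventually_conj)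
    then obtain x where "h x < M" "\<bar>h x\<bar> \<le> B"
      by (metis (mono_tags, lifting) eventually_happens trivial_limit_at_top_linorder)
    then show ?thesis by linarith
  qed
  define L where "L = Inf U"
  have up: "eventually (\<lambda>x. h x < L + e) at_top" if e: "0 < e" for e
  proof -
    obtain M where "M \<in> U" "M < L + e"
      using cInf_lessD[of U "Inf U + e"] ne e unfolding L_def by force
    then show ?thesis unfolding U_def by (auto elim!: eventually_mono)
  qed
  have low: "\<exists>x\<ge>N. L - e < h x" if "0 < e" for e N
  proof (rule ccontr)
    assume "\<not> ?thesis"
    then have "\<forall>x\<ge>N. h x < L - e/2" using that by (smt (verit) field_sum_of_halves)
    then have "L - e/2 \<in> U" unfolding U_def eventually_at_top_linorder by auto
    then have "L \<le> L - e/2" unfolding L_def using bd by (intro cInf_lower bdd_belowI[of _ "-B-1"]) auto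
    then show False using that by simp
  qed
  have "\<forall>n::nat. \<exists>x\<ge>real n. L - 1/(real n + 1) < h x" using low by simp
  then obtain z where z: "\<And>n::nat. z n \<ge> real n" "\<And>n. L - 1/(real n + 1) < h (z n)" by metis
  have zt: "filterlim z at_top sequentially"
    by (rule filterlim_at_top_mono[OF filterlim_real_sequentially]) (use z in auto)
  have "(\<lambda>n. h (z n)) \<longlonglongrightarrow> L"
  proof (rule order_tendstoI)
    fix x assume "x < L"
    have "((\<lambda>n. L - 1/(real n + 1)) \<longlongrightarrow> L - 0) sequentially"
      by (intro tendsto_intros) real_asymp
    then have "eventually (\<lambda>n. x < L - 1/(real n + 1)) sequentially"
      using \<open>x < L\<close> by (simp add: order_tendsto_iff)
    then show "eventually (\<lambda>n. x < h (z n)) sequentially"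
      by (rule eventually_mono) (use z in \<open>force intro: less_trans\<close>)
  next
    fix x assume "L < x"
    then have "eventually (\<lambda>y. h y < L + (x - L)) at_top" by (intro up) auto
    then show "eventually (\<lambda>n. h (z n) < x) sequentially"
      using filterlim_iff zt by fastforce
  qed
  then show ?thesis using that zt up by blast
qed

locale renewal_weights =
  fixes I :: "'i set" and p a :: "'i \<Rightarrow> real"
  assumes fin: "finite I" and p_pos: "\<And>i. i \<in> I \<Longrightarrow> 0 < p i" and a_pos: "\<And>i. i \<in> I \<Longrightarrow> 0 < a i"
    and p_sum: "sum p I = 1"
begin

text \<open>At a sequence realizing the limit superior, the averaging forces every term of the
  average to be asymptotically extremal as well.\<close>

lemma extremal_sequence:
  fixes h \<psi> :: "real \<Rightarrow> real"
  assumes eq: "\<And>z. h z = (\<Sum>i\<in>I. p i * h (z - a i)) + \<psi> z"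
    and \<psi>: "(\<psi> \<longlongrightarrow> 0) at_top"
    and up: "\<And>e. 0 < e \<Longrightarrow> eventually (\<lambda>x. h x < L + e) at_top"
    and z: "filterlim z at_top sequentially" and hz: "(\<lambda>n. h (z n)) \<longlonglongrightarrow> L"
    and s: "s \<in> add_semigroup I a"
  shows "(\<lambda>n. h (z n - s)) \<longlonglongrightarrow> L"
  using s
proof induction
  case zero
  then show ?case using hz by simp
next
  case (add s j)
  have lim: "filterlim (\<lambda>n. z n - x) at_top sequentially" for x
    using filterlim_tendsto_add_at_top[OF tendsto_const[of "-x"] z] by simp
  have ev: "eventually (\<lambda>n. h (z n - x) < L + e) sequentially" if "0 < e" for x e
    by (rule eventually_compose_filterlim[OF up[OF that] lim])
  have lower: "eventually (\<lambda>n. L - e < h (z n - (s + a j))) sequentially" if e: "0 < e" for e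
  proof -
    \<comment> \<open>An error \<open>e'\<close> is spent three times: on the value at
      \<open>s\<close>, on the other terms of the average, and on the forcing. The total is then
      absorbed by \<open>p j * e\<close>.\<close>
    define e' where "e' = p j * e / 3"
    have pj: "0 < p j" using p_pos add by auto
    have e': "0 < e'" using e pj by (simp add: e'_def)
    have 1: "eventually (\<lambda>n. \<forall>i\<in>I. h (z n - (s + a i)) < L + e') sequentially"
      using ev[OF e'] fin by (simp add: eventually_ball_finite)
    have 2: "eventually (\<lambda>n. L - e' < h (z n - s)) sequentially"
      using order_tendstoD(1)[OF add.IH, of "L - e'"] e' by simp
    have "((\<lambda>n. \<psi> (z n - s)) \<longlongrightarrow> 0) sequentially" using filterlim_compose[OF \<psi> lim] .
    then have 3: "eventually (\<lambda>n. \<psi> (z n - s) < e') sequentially"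
      using order_tendstoD(2) e' by blast
    show ?thesis using 1 2 3
    proof eventually_elim
      case (elim n)
      have "(\<Sum>i\<in>I. p i * h (z n - s - a i)) = p j * h (z n - s - a j) + (\<Sum>i\<in>I-{j}. p i * h (z n - s - a i))"
        by (rule sum.remove) (use fin add in auto)
      also have "(\<Sum>i\<in>I-{j}. p i * h (z n - s - a i)) \<le> (\<Sum>i\<in>I-{j}. p i * (L + e'))"
        using elim(1) p_pos by (intro sum_mono mult_left_mono) (auto simp: algebra_simps less_imp_le)
      also have "\<dots> = (1 - p j) * (L + e')"
        using sum.remove[OF fin \<open>j \<in> I\<close>, of p] p_sum by (simp flip: sum_distrib_right)
      finally have "L - e' < p j * h (z n - s - a j) + (1 - p j) * (L + e') + e'"
        using elim(2,3) eq[of "z n - s"] by linarith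
      then have "p j * L < p j * h (z n - s - a j) + 3 * e' - p j * e'" by (simp add: algebra_simps)
      also have "\<dots> \<le> p j * h (z n - s - a j) + p j * e"
        using pj e' by (simp add: e'_def)
      finally have "p j * L < p j * (h (z n - s - a j) + e)" by (simp add: algebra_simps)
      then have "L < h (z n - s - a j) + e" using pj by simp
      then show ?case by (simp add: algebra_simps)
    qed
  qed
  show ?case
  proof (rule order_tendstoI)
    fix x assume "x < L" then show "eventually (\<lambda>n. x < h (z n - (s + a j))) sequentially"
      using lower[of "L - x"] by simp
  next
    fix x assume "L < x" then show "eventually (\<lambda>n. h (z n - (s + a j)) < x) sequentially"
      using ev[of "x - L"] by simp
  qed
qed


text \<open>The mean step length. It is also the weight that \<open>window\<close> gives to a
  constant function, hence the denominator of the limit.\<close>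

definition semi_mean :: real where "semi_mean = (\<Sum>i\<in>I. p i * a i)"

lemma nonempty: "I \<noteq> {}" using p_sum by auto

lemma semi_mean_pos: "0 < semi_mean"
  unfolding semi_mean_def using fin nonempty p_pos a_pos by (intro sum_pos) auto

lemma steps_bounds:
  obtains A a0 where "0 < a0" "0 < A" "\<And>i. i \<in> I \<Longrightarrow> a0 \<le> a i" "\<And>i. i \<in> I \<Longrightarrow> a i \<le> A"
proof (rule that[of "Min (a ` I)" "Max (a ` I)"])
  show "0 < Min (a ` I)" using fin nonempty a_pos by auto
  show "0 < Max (a ` I)" using fin nonempty a_pos by (auto simp: Max_gr_iff)
qed (use fin in auto)

end

text \<open>In the application \<open>h z * exp (- c * z)\<close> is the heat loss at time
  \<open>exp (- z)\<close>: bounded by the volume, which is \<open>h_exp\<close>, and monotone in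
  time, which is \<open>h_antimono\<close>. The latter supplies both the measurability of
  \<open>h\<close> and a one-sided substitute for its continuity.\<close>

locale renewal_equation = renewal_weights +
  fixes h \<psi> :: "real \<Rightarrow> real" and c H C \<epsilon> :: real
  assumes eq: "\<And>z. h z = (\<Sum>i\<in>I. p i * h (z - a i)) + \<psi> z"
    and h_nonneg: "\<And>z. 0 \<le> h z" and h_exp: "\<And>z. h z \<le> H * exp (c * z)" and c_pos: "0 < c"
    and h_antimono: "\<And>y z. y \<le> z \<Longrightarrow> h z * exp (- c * z) \<le> h y * exp (- c * y)"
    and \<psi>_nonneg: "\<And>z. 0 \<le> \<psi> z" and \<psi>_exp: "\<And>z. \<psi> z \<le> C * exp (- \<epsilon> * z)" and eps_pos: "0 < \<epsilon>"
begin

lemma \<psi>_le_h: "\<psi> z \<le> h z"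
proof -
  have "0 \<le> (\<Sum>i\<in>I. p i * h (z - a i))"
    using p_pos h_nonneg by (intro sum_nonneg mult_nonneg_nonneg) (auto intro: less_imp_le)
  then show ?thesis using eq[of z] by linarith
qed

lemma H_nonneg: "0 \<le> H"
  using h_nonneg[of 0] h_exp[of 0] by simp

lemma C_nonneg: "0 \<le> C"
  using \<psi>_nonneg[of 0] \<psi>_exp[of 0] by simp

lemma \<psi>_tendsto: "(\<psi> \<longlongrightarrow> 0) at_top"
proof (rule tendsto_sandwich[of "\<lambda>_. 0" _ _ "\<lambda>z. C * exp (- \<epsilon> * z)"])
  show "((\<lambda>z. C * exp (- \<epsilon> * z)) \<longlongrightarrow> 0) at_top" using eps_pos by real_asymp
qed (use \<psi>_nonneg \<psi>_exp in auto)

text \<open>The barrier \<open>A - A' exp (- \<epsilon> z)\<close> is a supersolution of the renewal equation on the half line.\<close>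

lemma h_bounded: "\<exists>B. \<forall>z. h z \<le> B"
proof -
  obtain A a0 where a0: "0 < a0" "0 < A" "\<And>i. i \<in> I \<Longrightarrow> a0 \<le> a i" "\<And>i. i \<in> I \<Longrightarrow> a i \<le> A"
    by (rule steps_bounds) blast
  \<comment> \<open>Averaging over the shifts multiplies \<open>exp (- \<epsilon> * z)\<close> by
    \<open>1 + \<kappa>\<close>, and \<open>\<kappa> > 0\<close> because the steps are positive.
    With \<open>A' = C / \<kappa>\<close> the barrier has a surplus of exactly
    \<open>C * exp (- \<epsilon> * z)\<close>, the bound for \<open>\<psi>\<close>.\<close>
  define \<kappa> where "\<kappa> = (\<Sum>i\<in>I. p i * exp (\<epsilon> * a i)) - 1"
  have "0 < (\<Sum>i\<in>I. p i * (exp (\<epsilon> * a i) - 1))"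
    using fin nonempty p_pos a_pos eps_pos by (intro sum_pos) auto
  then have \<kappa>: "0 < \<kappa>" using p_sum by (simp add: \<kappa>_def right_diff_distrib sum_subtractf)
  define A' where "A' = C / \<kappa>"
  have A': "0 \<le> A'" using C_nonneg \<kappa> by (simp add: A'_def)
  \<comment> \<open>Shifts from \<open>z \<ge> 0\<close> do not go below \<open>- A\<close>, so the
    comparison starts on \<open>{- A..<0}\<close>; there \<open>D\<close> compensates the largest
    value of the subtracted exponential and leaves \<open>H\<close>.\<close>
  define D where "D = A' * exp (\<epsilon> * A) + H"
  define B where "B z = D - A' * exp (- \<epsilon> * z)" for z
  have step: "(\<Sum>i\<in>I. p i * B (z - a i)) + \<psi> z \<le> B z" for z
  proof -
    have "(\<Sum>i\<in>I. p i * B (z - a i)) = (\<Sum>i\<in>I. p i * D - A' * exp (- \<epsilon> * z) * (p i * exp (\<epsilon> * a i)))"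
      by (intro sum.cong) (auto simp: B_def algebra_simps mult_exp_exp)
    also have "\<dots> = D - A' * exp (- \<epsilon> * z) * (\<kappa> + 1)"
      by (simp add: sum_subtractf \<kappa>_def p_sum flip: sum_distrib_left sum_distrib_right)
    also have "\<dots> = B z - C * exp (- \<epsilon> * z)" using \<kappa> by (simp add: B_def A'_def field_simps)
    finally show ?thesis using \<psi>_exp[of z] by simp
  qed
  have base: "h z \<le> B z" if "-A \<le> z" "z < 0" for z
  proof -
    have "\<epsilon> * (- z) \<le> \<epsilon> * A" using that eps_pos by (intro mult_left_mono) auto
    then have "exp (- \<epsilon> * z) \<le> exp (\<epsilon> * A)" by simp
    then have "A' * exp (- \<epsilon> * z) \<le> A' * exp (\<epsilon> * A)" using A' by (rule mult_left_mono)
    moreover have "H * exp (c * z) \<le> H * 1"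
      using that c_pos H_nonneg by (intro mult_left_mono) (auto simp: mult_pos_neg less_imp_le)
    ultimately show ?thesis using h_exp[of z] by (simp add: B_def D_def)
  qed
  \<comment> \<open>Each shift moves left by at least \<open>a0\<close>, so the comparison advances
    in slabs of width \<open>a0\<close>.\<close>
  have ind: "h z \<le> B z" if "-A \<le> z" "z < real n * a0" for n z
    using that
  proof (induction n arbitrary: z)
    case 0
    then show ?case using base by simp
  next
    case (Suc n)
    show ?case
    proof (cases "z < 0")
      case True
      then show ?thesis using base Suc by simp
    next
      case False
      have "h (z - a i) \<le> B (z - a i)" if "i \<in> I" for i
        using a0(3,4)[OF that] Suc.prems False by (intro Suc.IH) (auto simp: algebra_simps)
      then have "(\<Sum>i\<in>I. p i * h (z - a i)) \<le> (\<Sum>i\<in>I. p i * B (z - a i))"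
        using p_pos by (intro sum_mono mult_left_mono) (auto intro: less_imp_le)
      then show ?thesis using step[of z] eq[of z] by linarith
    qed
  qed
  have "h z \<le> D" for z
  proof (cases "-A \<le> z")
    case True
    obtain n where "z < real n * a0" using reals_Archimedean3[OF a0(1)] by blast
    from ind[OF True this] show ?thesis using A' by (simp add: B_def) (smt (verit) exp_ge_zero mult_nonneg_nonneg)
  next
    case False
    have "H * exp (c * z) \<le> H * 1"
      using False a0 c_pos H_nonneg by (intro mult_left_mono) (auto simp: mult_pos_neg less_imp_le)
    then show ?thesis using h_exp[of z] A' by (simp add: D_def) (smt (verit) exp_ge_zero mult_nonneg_nonneg)
  qed
  then show ?thesis by blast
qed

text \<open>This is the only modulus available for \<open>h\<close>: moving to the right it grows at
  most by an exponential factor. A value at a nearby translate therefore controls \<open>h\<close>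
  from one side only, depending on which of the two points lies to the left.\<close>

lemma h_le_shift: "y \<le> z \<Longrightarrow> h z \<le> h y * exp (c * (z - y))"
proof -
  assume "y \<le> z"
  from h_antimono[OF this] have "h z * exp (- c * z) * exp (c * z) \<le> h y * exp (- c * y) * exp (c * z)"
    by (intro mult_right_mono) auto
  then show ?thesis by (simp add: mult.assoc mult_exp_exp algebra_simps)
qed

lemma h_measurable [measurable]: "h \<in> borel_measurable borel"
proof -
  have "mono (\<lambda>z. - (h z * exp (- c * z)))" by (rule monoI) (use h_antimono in auto)
  then have [measurable]: "(\<lambda>z. - (h z * exp (- c * z))) \<in> borel_measurable borel" by (rule borel_measurable_mono)
  have "(\<lambda>z. - (- (h z * exp (- c * z))) * exp (c * z)) \<in> borel_measurable borel" by measurable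
  also have "(\<lambda>z. - (- (h z * exp (- c * z))) * exp (c * z)) = h" by (auto simp: mult.assoc mult_exp_exp)
  finally show ?thesis .
qed

lemma \<psi>_measurable [measurable]: "\<psi> \<in> borel_measurable borel"
proof -
  have "\<psi> = (\<lambda>z. h z - (\<Sum>i\<in>I. p i * h (z - a i)))" by (rule ext) (metis add_diff_cancel_left' eq)
  also have "\<dots> \<in> borel_measurable borel" by measurable
  finally show ?thesis .
qed

lemma h_integrable: "set_integrable lborel {..z} h"
proof (rule set_integrable_bound)
  have "(\<lambda>x. exp (- c * x)) absolutely_integrable_on {-z..}"
    using integrable_on_exp_minus_to_infinity[OF c_pos]
    by (intro nonnegative_absolutely_integrable_1) auto
  then have "set_integrable lborel {-z..} (\<lambda>x. exp (- c * x))"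
    unfolding set_integrable_def by (subst (asm) integrable_completion) auto
  then have "set_integrable lborel {..z} (\<lambda>x. exp (c * x))"
    unfolding set_integrable_def
    by (subst (asm) lborel_integrable_real_affine_iff[symmetric, of "-1" _ 0])
      (auto simp: indicator_def cong: if_cong)
  then show "set_integrable lborel {..z} (\<lambda>x. H * exp (c * x))" by simp
qed (auto simp: h_nonneg h_exp set_borel_measurable_def H_nonneg)

end

section \<open>Window averages\<close>

context renewal_equation
begin

lemma h_integrable_subset: "B \<in> sets lborel \<Longrightarrow> B \<subseteq> {..z} \<Longrightarrow> set_integrable lborel B h"
  by (rule set_integrable_subset[OF h_integrable])

text \<open>On the left half line \<open>\<psi>\<close> is dominated by the integrable
  \<open>h\<close>, on the right one by its exponential decay.\<close>

lemma \<psi>_integrable: "integrable lborel \<psi>"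
proof -
  have 1: "set_integrable lborel {..0} \<psi>"
    by (rule set_integrable_bound[OF h_integrable])
       (auto simp: set_borel_measurable_def \<psi>_nonneg \<psi>_le_h h_nonneg)
  have "(\<lambda>x. C * exp (- \<epsilon> * x)) absolutely_integrable_on {0..}"
    using integrable_on_cmult_left[OF integrable_on_exp_minus_to_infinity[OF eps_pos], of C] C_nonneg
    by (intro nonnegative_absolutely_integrable_1) auto
  then have "set_integrable lborel {0..} (\<lambda>x. C * exp (- \<epsilon> * x))"
    unfolding set_integrable_def by (subst (asm) integrable_completion) auto
  then have 2: "set_integrable lborel {0..} \<psi>"
    by (rule set_integrable_bound)
       (use \<psi>_nonneg \<psi>_exp C_nonneg in \<open>auto simp: set_borel_measurable_def\<close>)
  have "set_integrable lborel ({..0} \<union> {0..}) \<psi>" by (rule set_integrable_Un[OF 1 2]) auto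
  also have "{..0} \<union> {0..} = (UNIV :: real set)" by auto
  finally show ?thesis by (simp add: set_integrable_def)
qed

text \<open>The renewal equation makes this weighted window average a primitive of \<open>\<psi>\<close>.\<close>

definition window :: "real \<Rightarrow> real" where
  "window z = (\<Sum>i\<in>I. p i * (LINT x:{z - a i<..z}|lborel. h x))"

text \<open>Integrate the equation over \<open>{..z}\<close>: the translate by \<open>a i\<close>
  contributes \<open>J (z - a i)\<close>, and \<open>sum p I = 1\<close> distributes
  \<open>J z\<close> over the weights. Each difference \<open>J z - J (z - a i)\<close> is one of
  the integrals in \<open>window\<close>.\<close>

lemma window_eq: "window z = (LINT x:{..z}|lborel. \<psi> x)"
proof -
  have \<psi>_eq: "\<psi> x = h x - (\<Sum>i\<in>I. p i * h (x - a i))" for x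
    using eq[of x] by linarith
  define J where "J z = (LINT x:{..z}|lborel. h x)" for z
  have split: "J z = J (z - a i) + (LINT x:{z - a i<..z}|lborel. h x)" if "i \<in> I" for i
  proof -
    have "{..z} = {..z - a i} \<union> {z - a i<..z}" using a_pos[OF that] by auto
    then show ?thesis unfolding J_def
      by (simp, subst set_integral_Un) (auto intro: h_integrable_subset)
  qed
  have shift: "set_integrable lborel {..z} (\<lambda>x. h (x - t))"
    "(LINT x:{..z}|lborel. h (x - t)) = J (z - t)" for t
  proof -
    have ind: "indicat_real {..z} (t + x) = indicator {..z - t} x" for x by (auto simp: indicator_def)
    show "set_integrable lborel {..z} (\<lambda>x. h (x - t))"
      using h_integrable[of "z - t"] unfolding set_integrable_def
      by (subst lborel_integrable_real_affine_iff[symmetric, of 1 _ t]) (auto simp: ind)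
    show "(LINT x:{..z}|lborel. h (x - t)) = J (z - t)"
      unfolding set_lebesgue_integral_def J_def
      by (subst lborel_integral_real_affine[of 1 _ t]) (auto simp: ind)
  qed
  have sum_shift: "set_integrable lborel {..z} (\<lambda>x. \<Sum>i\<in>I. p i * h (x - a i))"
    using shift(1) unfolding set_integrable_def scaleR_sum_right
    by (intro Bochner_Integration.integrable_sum) (auto simp: mult.left_commute)
  have "(LINT x:{..z}|lborel. \<psi> x) = (LINT x:{..z}|lborel. h x - (\<Sum>i\<in>I. p i * h (x - a i)))"
    using \<psi>_eq by (intro set_lebesgue_integral_cong) auto
  also have "\<dots> = J z - (LINT x:{..z}|lborel. (\<Sum>i\<in>I. p i * h (x - a i)))"
    unfolding J_def by (intro set_integral_diff h_integrable sum_shift)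
  also have "(LINT x:{..z}|lborel. (\<Sum>i\<in>I. p i * h (x - a i))) = (\<Sum>i\<in>I. p i * J (z - a i))"
    unfolding shift(2)[symmetric] set_integral_mult_right[symmetric]
    using shift(1) unfolding set_lebesgue_integral_def scaleR_sum_right set_integrable_def
    by (intro Bochner_Integration.integral_sum) (auto simp: mult.left_commute)
  also have "J z = (\<Sum>i\<in>I. p i * J z)" by (simp add: p_sum flip: sum_distrib_right)
  also have "\<dots> - (\<Sum>i\<in>I. p i * J (z - a i)) = window z"
    unfolding window_def sum_subtractf[symmetric]
    by (intro sum.cong refl) (use split in \<open>simp add: algebra_simps\<close>)
  finally show ?thesis ..
qed

lemma window_tendsto: "(window \<longlongrightarrow> (LINT x|lborel. \<psi> x)) at_top"
  using tendsto_integral_at_top[OF _ \<psi>_integrable]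
  unfolding window_eq[abs_def] set_lebesgue_integral_def by simp

lemma window_bounds:
  assumes A: "\<And>i. i \<in> I \<Longrightarrow> a i \<le> A" 
  shows "(\<And>y. 0 \<le> y \<Longrightarrow> y \<le> A \<Longrightarrow> lo \<le> h (z - y)) \<Longrightarrow> semi_mean * lo \<le> window z"
    and "(\<And>y. 0 \<le> y \<Longrightarrow> y \<le> A \<Longrightarrow> h (z - y) \<le> hi) \<Longrightarrow> window z \<le> semi_mean * hi"
proof -
  have c: "(LINT x:{z - a i<..z}|lborel. m) = a i * m" "set_integrable lborel {z - a i<..z} (\<lambda>_. m)"
    if "i \<in> I" for i and m :: real
    using a_pos[OF that] by (auto simp: set_integral_const set_integrable_def)
  have h: "set_integrable lborel {z - a i<..z} h" for i
    by (rule h_integrable_subset) auto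
  have y: "\<exists>y. x = z - y \<and> 0 \<le> y \<and> y \<le> A" if "x \<in> {z - a i<..z}" "i \<in> I" for i x
    using that A[OF that(2)] by (intro exI[of _ "z - x"]) auto
  show "semi_mean * lo \<le> window z" if lo: "\<And>y. 0 \<le> y \<Longrightarrow> y \<le> A \<Longrightarrow> lo \<le> h (z - y)"
  proof -
    have "p i * a i * lo \<le> p i * (LINT x:{z - a i<..z}|lborel. h x)" if i: "i \<in> I" for i
    proof -
      have "(LINT x:{z - a i<..z}|lborel. lo) \<le> (LINT x:{z - a i<..z}|lborel. h x)"
        using y[OF _ i] lo c[OF i] h by (intro set_integral_mono) auto
      then show ?thesis using c[OF i] p_pos[OF i] by (simp add: mult.assoc)
    qed
    then show ?thesis unfolding semi_mean_def window_def sum_distrib_right by (intro sum_mono)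
  qed
  show "window z \<le> semi_mean * hi" if hi: "\<And>y. 0 \<le> y \<Longrightarrow> y \<le> A \<Longrightarrow> h (z - y) \<le> hi"
  proof -
    have "p i * (LINT x:{z - a i<..z}|lborel. h x) \<le> p i * a i * hi" if i: "i \<in> I" for i
    proof -
      have "(LINT x:{z - a i<..z}|lborel. h x) \<le> (LINT x:{z - a i<..z}|lborel. hi)"
        using y[OF _ i] hi c[OF i] h by (intro set_integral_mono) auto
      then show ?thesis using c[OF i] p_pos[OF i] by (simp add: mult.assoc)
    qed
    then show ?thesis unfolding semi_mean_def window_def sum_distrib_right by (intro sum_mono)
  qed
qed

end

text \<open>Convergence at translates is pointwise in the shift. A finite net makes it hold at all
  needed shifts from one index on. The tolerance \<open>2 * e\<close> is one mesh from rounding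
  \<open>y\<close> up to the grid \<open>T + k * e\<close> and one from the density of
  \<open>S\<close>.\<close>

lemma finite_net:
  fixes S :: "real set"
  assumes dense: "\<And>v. T \<le> v \<Longrightarrow> \<exists>\<sigma>\<in>S. v \<le> \<sigma> \<and> \<sigma> < v + e" and e: "0 < e"
  obtains F where "finite F" "F \<subseteq> S" "\<And>y. T \<le> y \<Longrightarrow> y \<le> T + A \<Longrightarrow> \<exists>\<sigma>\<in>F. y \<le> \<sigma> \<and> \<sigma> \<le> y + 2 * e"
proof -
  have "\<forall>k::nat. \<exists>\<sigma>\<in>S. T + real k * e \<le> \<sigma> \<and> \<sigma> < T + real k * e + e"
    using dense e by simp
  then obtain s where s: "\<And>k::nat. s k \<in> S" "\<And>k. T + real k * e \<le> s k" "\<And>k. s k < T + real k * e + e"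
    by metis
  show ?thesis
  proof (rule that[of "s ` {..nat \<lceil>A / e\<rceil>}"])
    fix y assume y: "T \<le> y" "y \<le> T + A"
    define k where "k = nat \<lceil>(y - T) / e\<rceil>"
    have "(y - T) / e \<le> A / e" using y e by (intro divide_right_mono) auto
    then have "k \<le> nat \<lceil>A / e\<rceil>" unfolding k_def by (intro nat_mono ceiling_mono)
    moreover have "real k = of_int \<lceil>(y - T) / e\<rceil>" unfolding k_def using y e by simp
    then have "(y - T) / e \<le> real k" "real k < (y - T) / e + 1" by linarith+
    then have "y - T \<le> real k * e" "real k * e < y - T + e" using e by (auto simp: field_simps)
    then have "y \<le> s k" "s k \<le> y + 2 * e" using s(2)[of k] s(3)[of k] by linarith+
    ultimately show "\<exists>\<sigma>\<in>s ` {..nat \<lceil>A / e\<rceil>}. y \<le> \<sigma> \<and> \<sigma> \<le> y + 2 * e" by auto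
  qed (use s in auto)
qed

context renewal_equation
begin

text \<open>A sequence along which \<open>h\<close> stays close to \<open>L\<close> on a whole window determines \<open>L\<close>,
  up to the modulus given by the monotonicity of \<open>h z * exp (- c z)\<close>.\<close>

lemma window_limit_bounds:
  assumes dense: "\<And>e. 0 < e \<Longrightarrow> \<exists>T\<ge>0. \<forall>v\<ge>T. \<exists>\<sigma>\<in>add_semigroup I a. v \<le> \<sigma> \<and> \<sigma> < v + e"
    and z: "filterlim z at_top sequentially"
    and lim: "\<And>s. s \<in> add_semigroup I a \<Longrightarrow> (\<lambda>n. h (z n - s)) \<longlonglongrightarrow> L"
  shows "(LINT x|lborel. \<psi> x) = semi_mean * L"
proof -
  obtain A a0 where A: "0 < A" "\<And>i. i \<in> I \<Longrightarrow> a i \<le> A" by (rule steps_bounds) blast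
  let ?I = "LINT x|lborel. \<psi> x"
  have lim_shift: "filterlim (\<lambda>n. z n - x) at_top sequentially" for x
    using filterlim_tendsto_add_at_top[OF tendsto_const[of "-x"] z] by simp
  have win: "(\<lambda>n. window (z n - x)) \<longlonglongrightarrow> ?I" for x
    by (rule filterlim_compose[OF window_tendsto lim_shift])
  have bounds: "semi_mean * ((L - e) * exp (- c * (2 * e))) \<le> ?I \<and> ?I \<le> semi_mean * ((L + e) * exp (c * (2 * e)))"
    if e: "0 < e" for e
  proof -
    obtain T where T: "0 \<le> T" "\<And>v. T \<le> v \<Longrightarrow> \<exists>\<sigma>\<in>add_semigroup I a. v \<le> \<sigma> \<and> \<sigma> < v + e"
      using dense[OF e] by blast
    obtain F where F: "finite F" "F \<subseteq> add_semigroup I a"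
      "\<And>y. T \<le> y \<Longrightarrow> y \<le> T + (A + 2 * e) \<Longrightarrow> \<exists>\<sigma>\<in>F. y \<le> \<sigma> \<and> \<sigma> \<le> y + 2 * e"
      using finite_net[OF T(2) e] by metis
    have ev: "eventually (\<lambda>n. \<forall>s\<in>F. L - e < h (z n - s) \<and> h (z n - s) < L + e) sequentially"
      using F e lim by (intro eventually_ball_finite ballI eventually_conj)
        (auto intro!: order_tendstoD)
    \<comment> \<open>The two estimates use different base points because \<open>h_le_shift\<close>
      compares in one direction. For the lower bound the window starts at
      \<open>z n - (T + 2 * e)\<close>, so that the net point \<open>z n - \<sigma>\<close> lies to
      the right of \<open>x\<close>; for the upper bound it starts at \<open>z n - T\<close>, so
      that the net point lies to the left.\<close>
    have "eventually (\<lambda>n. semi_mean * ((L - e) * exp (- c * (2 * e))) \<le> window (z n - (T + 2 * e))) sequentially"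
      using ev
    proof eventually_elim
      case (elim n)
      show ?case
      proof (rule window_bounds(1)[of A])
        fix y assume y: "0 \<le> y" "y \<le> A"
        obtain \<sigma> where \<sigma>: "\<sigma> \<in> F" "T + y \<le> \<sigma>" "\<sigma> \<le> T + y + 2 * e" using F(3)[of "T + y"] y e by auto
        define x where "x = z n - (T + 2 * e) - y"
        have x: "x \<le> z n - \<sigma>" "(z n - \<sigma>) - x \<le> 2 * e" using \<sigma> by (auto simp: x_def)
        have "L - e \<le> h x * exp (c * ((z n - \<sigma>) - x))"
          using h_le_shift[OF x(1)] elim \<sigma> by force
        also have "\<dots> \<le> h x * exp (c * (2 * e))"
          using x c_pos h_nonneg by (intro mult_left_mono) auto
        finally have "(L - e) * exp (- c * (2 * e)) \<le> h x * exp (c * (2 * e)) * exp (- c * (2 * e))"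
          by (intro mult_right_mono) auto
        also have "\<dots> = h x" by (simp add: mult.assoc mult_exp_exp)
        finally show "(L - e) * exp (- c * (2 * e)) \<le> h (z n - (T + 2 * e) - y)" by (simp add: x_def)
      qed (use A in auto)
    qed
    moreover have "eventually (\<lambda>n. window (z n - T) \<le> semi_mean * ((L + e) * exp (c * (2 * e)))) sequentially"
      using ev
    proof eventually_elim
      case (elim n)
      show ?case
      proof (rule window_bounds(2)[of A])
        fix y assume y: "0 \<le> y" "y \<le> A"
        obtain \<sigma> where \<sigma>: "\<sigma> \<in> F" "T + y \<le> \<sigma>" "\<sigma> \<le> T + y + 2 * e" using F(3)[of "T + y"] y e by auto
        define x where "x = z n - T - y"
        have x: "z n - \<sigma> \<le> x" "x - (z n - \<sigma>) \<le> 2 * e" using \<sigma> by (auto simp: x_def)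
        have "h x \<le> h (z n - \<sigma>) * exp (c * (x - (z n - \<sigma>)))" by (rule h_le_shift[OF x(1)])
        also have "\<dots> \<le> (L + e) * exp (c * (2 * e))"
          using x c_pos h_nonneg[of "z n - \<sigma>"] elim \<sigma> by (intro mult_mono) (auto intro: less_imp_le)
        finally show "h (z n - T - y) \<le> (L + e) * exp (c * (2 * e))" by (simp add: x_def)
      qed (use A in auto)
    qed
    ultimately show ?thesis
      using tendsto_lowerbound[OF win] tendsto_upperbound[OF win] by simp
  qed
  \<comment> \<open>Neither bound mentions \<open>T\<close> or the net any more, so \<open>e\<close>
    may tend to 0.\<close>
  have "((\<lambda>e. semi_mean * ((L - e) * exp (- c * (2 * e)))) \<longlongrightarrow> semi_mean * ((L - 0) * exp (- c * (2 * 0)))) (at_right 0)"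
    by (intro tendsto_intros)
  then have 1: "semi_mean * L \<le> ?I"
    by (intro tendsto_upperbound[of _ "semi_mean * L" "at_right 0"]) (use bounds in \<open>auto simp: eventually_at_right_less intro!: eventually_mono[OF eventually_at_right_less]\<close>)
  have "((\<lambda>e. semi_mean * ((L + e) * exp (c * (2 * e)))) \<longlongrightarrow> semi_mean * ((L + 0) * exp (c * (2 * 0)))) (at_right 0)"
    by (intro tendsto_intros)
  then have 2: "?I \<le> semi_mean * L"
    by (intro tendsto_lowerbound[of _ "semi_mean * L" "at_right 0"]) (use bounds in \<open>auto simp: eventually_at_right_less intro!: eventually_mono[OF eventually_at_right_less]\<close>)
  from 1 2 show ?thesis by simp
qed

text \<open>\<open>- h\<close> solves the same equation with forcing \<open>- \<psi>\<close>, which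
  still tends to 0, and \<open>extremal_sequence\<close> asks for no sign.\<close>

lemma minus_extremal:
  assumes "\<And>e. 0 < e \<Longrightarrow> eventually (\<lambda>x. - h x < L + e) at_top"
    and z: "filterlim z at_top sequentially" and hz: "(\<lambda>n. - h (z n)) \<longlonglongrightarrow> L"
    and s: "s \<in> add_semigroup I a"
  shows "(\<lambda>n. h (z n - s)) \<longlonglongrightarrow> - L"
proof -
  have eq': "- h z = (\<Sum>i\<in>I. p i * (- h (z - a i))) + (- \<psi> z)" for z
    using eq[of z] by (simp add: sum_negf)
  have \<psi>': "((\<lambda>z. - \<psi> z) \<longlongrightarrow> 0) at_top" using tendsto_minus[OF \<psi>_tendsto] by simp
  have "(\<lambda>n. - h (z n - s)) \<longlonglongrightarrow> L" by (rule extremal_sequence[OF eq' \<psi>' assms])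
  then show ?thesis using tendsto_minus by fastforce
qed

theorem renewal_nonlattice:
  assumes dense: "\<And>e. 0 < e \<Longrightarrow> \<exists>T\<ge>0. \<forall>v\<ge>T. \<exists>\<sigma>\<in>add_semigroup I a. v \<le> \<sigma> \<and> \<sigma> < v + e"
  shows "(h \<longlongrightarrow> (LINT x|lborel. \<psi> x) / semi_mean) at_top"
proof -
  obtain B where B: "\<And>z. h z \<le> B" using h_bounded by blast
  then have bd: "eventually (\<lambda>z. \<bar>h z\<bar> \<le> B) at_top" "eventually (\<lambda>z. \<bar>- h z\<bar> \<le> B) at_top"
    using h_nonneg by auto
  let ?l = "(LINT x|lborel. \<psi> x) / semi_mean"
  obtain L z where L: "filterlim z at_top sequentially" "(\<lambda>n. h (z n)) \<longlonglongrightarrow> L"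
    "\<And>e. 0 < e \<Longrightarrow> eventually (\<lambda>x. h x < L + e) at_top"
    using limsup_sequence[OF bd(1)] by blast
  obtain L' z' where L': "filterlim z' at_top sequentially" "(\<lambda>n. - h (z' n)) \<longlonglongrightarrow> L'"
    "\<And>e. 0 < e \<Longrightarrow> eventually (\<lambda>x. - h x < L' + e) at_top"
    using limsup_sequence[OF bd(2)] by blast
  have "(LINT x|lborel. \<psi> x) = semi_mean * L"
    by (rule window_limit_bounds[OF dense L(1)])
      (use extremal_sequence[OF eq \<psi>_tendsto L(3,1,2)] in auto)
  then have 1: "L = ?l" using semi_mean_pos by simp
  have "(LINT x|lborel. \<psi> x) = semi_mean * (- L')"
    by (rule window_limit_bounds[OF dense L'(1)])
      (use minus_extremal[OF L'(3,1,2)] in auto)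
  then have 2: "- L' = ?l" using semi_mean_pos by simp
  show ?thesis
  proof (rule order_tendstoI)
    fix x assume "x < ?l"
    then show "eventually (\<lambda>z. x < h z) at_top" using L'(3)[of "?l - x"] 2 by (auto elim!: eventually_mono)
  next
    fix x assume "?l < x"
    then show "eventually (\<lambda>z. h z < x) at_top" using L(3)[of "x - ?l"] 1 by (auto elim!: eventually_mono)
  qed
qed

end

section \<open>The semigroup of steps: dense and lattice cases\<close>

text \<open>Dirichlet approximation of \<open>a i / a j\<close> yields \<open>k * a i\<close> and
  \<open>m * a j\<close> at distance less than \<open>e\<close>, distinct by irrationality. Two
  close elements are all that \<open>add_semigroup_asymptotically_dense\<close> needs. The
  denominator bound \<open>N\<close> is chosen so that \<open>a j / N < e\<close>.\<close>

lemma add_semigroup_dense_irrational: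
  assumes pos: "\<And>i. i \<in> I \<Longrightarrow> 0 < a i" and ij: "i \<in> I" "j \<in> I" "a i / a j \<notin> \<rat>" and e: "0 < e"
  shows "\<exists>T\<ge>0. \<forall>v\<ge>T. \<exists>\<sigma>\<in>add_semigroup I a. v \<le> \<sigma> \<and> \<sigma> < v + e"
proof -
  define \<theta> where "\<theta> = a i / a j"
  have ai: "0 < a i" "0 < a j" using pos ij by auto
  then have \<theta>: "0 < \<theta>" by (simp add: \<theta>_def)
  define N where "N = nat \<lceil>a j / e\<rceil> + 1"
  have N: "0 < N" by (simp add: N_def)
  have "a j / e < real N" unfolding N_def by linarith
  then have Ne: "a j / real N < e" using e N by (simp add: field_simps)
  obtain m k where k: "0 < k" "k \<le> int N" "\<bar>of_int k * \<theta> - of_int m\<bar> < 1 / real N"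
    using Dirichlet_approx[OF N, of \<theta>] by blast
  have "0 < of_int k * \<theta>" using k \<theta> by simp
  moreover have "1 / real N \<le> 1" using N by simp
  ultimately have "of_int m > (-1::real)" using k(3) by linarith
  then have m: "0 \<le> m" by linarith
  define x where "x = real (nat k) * a i"
  define y where "y = real (nat m) * a j"
  have xy: "x \<in> add_semigroup I a" "y \<in> add_semigroup I a"
    unfolding x_def y_def by (intro add_semigroup_mult add_semigroup_gen ij)+
  have "x - y = (of_int k * \<theta> - of_int m) * a j"
    using k m ai by (simp add: x_def y_def \<theta>_def field_simps)
  then have "\<bar>x - y\<bar> = \<bar>of_int k * \<theta> - of_int m\<bar> * a j" using ai by (simp add: abs_mult)
  also have "\<dots> < 1 / real N * a j" using k(3) ai by (intro mult_strict_right_mono) auto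
  finally have less: "\<bar>x - y\<bar> < e" using Ne by simp
  have "x \<noteq> y"
  proof
    assume "x = y"
    then have "\<theta> = of_int m / of_int k" using k m ai by (simp add: x_def y_def \<theta>_def field_simps)
    then show False using ij(3) unfolding \<theta>_def by (metis Rats_divide Rats_of_int)
  qed
  \<comment> \<open>The integer \<open>m\<close> may be 0, and then \<open>min x y = 0\<close>;
    adding \<open>a i\<close> to both elements keeps their distance and makes them positive.\<close>
  define s where "s = a i + min x y"
  have s: "s \<in> add_semigroup I a" "s + \<bar>x - y\<bar> \<in> add_semigroup I a"
    using add_semigroup_plus[OF add_semigroup_gen[OF ij(1)] xy(1)]
      add_semigroup_plus[OF add_semigroup_gen[OF ij(1)] xy(2)]
    by (auto simp: s_def min_def abs_if)
  have "0 \<le> min x y" using ai by (simp add: x_def y_def)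
  then have "0 < s" using ai unfolding s_def by linarith
  then obtain T where "0 \<le> T" "\<And>v. T \<le> v \<Longrightarrow> \<exists>\<sigma>\<in>add_semigroup I a. v \<le> \<sigma> \<and> \<sigma> < v + \<bar>x - y\<bar>"
    using add_semigroup_asymptotically_dense[of s I a "\<bar>x - y\<bar>"] s \<open>x \<noteq> y\<close>
    by (metis zero_less_abs_iff right_minus_eq)
  then show ?thesis using less by (meson add_strict_left_mono less_trans)
qed

lemma add_semigroup_lattice:
  assumes a: "\<And>i. i \<in> I \<Longrightarrow> a i = \<rho> * real (n i)" and s: "s \<in> add_semigroup I a"
  shows "\<exists>k::nat. s = \<rho> * real k"
  using s
proof induction
  case zero
  then show ?case by (auto intro: exI[of _ 0])
next
  case (add s i)
  then obtain k where "s = \<rho> * real k" by blast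
  then show ?case using a[OF add.hyps(2)] by (intro exI[of _ "k + n i"]) (simp add: algebra_simps)
qed

text \<open>Let \<open>d\<close> be the least positive difference of two elements, in units of
  \<open>\<rho>\<close>. Division with remainder shows that \<open>d\<close> divides every
  \<open>n i\<close>, so \<open>d = 1\<close>: two elements differ by exactly \<open>\<rho>\<close>,
  and their combinations eventually hit every lattice point.\<close>

lemma add_semigroup_eventually_lattice:
  assumes a: "\<And>i. i \<in> I \<Longrightarrow> a i = \<rho> * real (n i)" and \<rho>: "0 < \<rho>"
    and n: "\<And>i. i \<in> I \<Longrightarrow> 0 < n i" and ne: "I \<noteq> {}"
    and gcd: "\<And>d. (\<And>i. i \<in> I \<Longrightarrow> d dvd n i) \<Longrightarrow> d = 1"
  obtains N where "\<And>k. N \<le> k \<Longrightarrow> \<rho> * real k \<in> add_semigroup I a"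
proof -
  obtain i0 where i0: "i0 \<in> I" using ne by blast
  let ?P = "\<lambda>d. 0 < d \<and> (\<exists>s\<in>add_semigroup I a. s + \<rho> * real d \<in> add_semigroup I a)"
  have ex: "?P (n i0)"
    using n[OF i0] add_semigroup.zero add_semigroup_gen[OF i0] a[OF i0]
    by (metis add_0)
  define d where "d = (LEAST d. ?P d)"
  have d: "?P d" unfolding d_def by (rule LeastI[of ?P, OF ex])
  then obtain s where s: "s \<in> add_semigroup I a" "s + \<rho> * real d \<in> add_semigroup I a" by blast
  have "d dvd n i" if i: "i \<in> I" for i
  proof (rule ccontr)
    assume "\<not> d dvd n i"
    then have w: "0 < n i mod d" by (simp add: dvd_eq_mod_eq_0)
    define q where "q = n i div d"
    have "real (n i) = real q * real d + real (n i mod d)"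
      unfolding q_def by (metis div_mult_mod_eq of_nat_add of_nat_mult)
    \<comment> \<open>This exhibits two elements whose difference is \<open>\<rho>\<close> times the
      remainder, contradicting the choice of \<open>d\<close>.\<close>
    then have "real q * (s + \<rho> * real d) + \<rho> * real (n i mod d) = real q * s + a i"
      using a[OF i] by (simp add: algebra_simps)
    moreover have "real q * s + a i \<in> add_semigroup I a"
      using add_semigroup_plus[OF add_semigroup_mult[OF s(1)] add_semigroup_gen[OF i]] .
    ultimately have "?P (n i mod d)" using w add_semigroup_mult[OF s(2), of q] by metis
    then have "d \<le> n i mod d" unfolding d_def by (rule Least_le)
    then show False using d by (meson leD mod_less_divisor)
  qed
  then have "d = 1" by (rule gcd)
  then have s': "a i0 + s + \<rho> \<in> add_semigroup I a" "a i0 + s \<in> add_semigroup I a"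
    using add_semigroup_plus[OF add_semigroup_gen[OF i0] s(1)]
      add_semigroup_plus[OF add_semigroup_gen[OF i0] s(2)] by (auto simp: add.assoc)
  have "0 \<le> s" using add_semigroup_lattice[OF a s(1)] \<rho> by auto
  moreover have "0 < a i0" using a[OF i0] n[OF i0] \<rho> by simp
  ultimately have "0 < a i0 + s" by simp
  from add_semigroup_asymptotically_dense[OF s'(2) this s'(1) \<rho>]
  obtain T where T: "\<And>v. T \<le> v \<Longrightarrow> \<exists>\<sigma>\<in>add_semigroup I a. v \<le> \<sigma> \<and> \<sigma> < v + \<rho>" by metis
  show ?thesis
  proof (rule that[of "nat \<lceil>T / \<rho>\<rceil>"])
    fix k assume "nat \<lceil>T / \<rho>\<rceil> \<le> k"
    then have "T / \<rho> \<le> real k" by linarith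
    then have "T \<le> \<rho> * real k" using \<rho> by (simp add: field_simps)
    then obtain \<sigma> where \<sigma>: "\<sigma> \<in> add_semigroup I a" "\<rho> * real k \<le> \<sigma>" "\<sigma> < \<rho> * real k + \<rho>"
      using T by blast
    \<comment> \<open>The window of length \<open>\<rho>\<close> is closed on the left and open on
      the right, so the only lattice point in it is its left end.\<close>
    obtain l where l: "\<sigma> = \<rho> * real l" using add_semigroup_lattice[OF a \<sigma>(1)] by blast
    have "\<rho> * real l < \<rho> * (real k + 1)" using \<sigma> l by (simp add: algebra_simps)
    then have "real l < real k + 1" using \<rho> by simp
    moreover have "real k \<le> real l" using \<sigma> l \<rho> by simp
    ultimately have "l = k" by linarith
    then show "\<rho> * real k \<in> add_semigroup I a" using \<sigma> l by simp
  qed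
qed

section \<open>The lattice case of the renewal theorem\<close>

text \<open>Here \<open>g\<close> is the deviation of a solution from its periodic candidate, with
  either sign. A weighted window of it tends to 0, whereas along the extremal sequence the same
  window tends to \<open>m * L\<close>; hence \<open>L = 0\<close>. The window has finitely many
  points, so pointwise convergence at translates suffices.\<close>

lemma (in renewal_weights) lattice_limsup:
  fixes g \<phi> :: "real \<Rightarrow> real" and n :: "'i \<Rightarrow> nat"
  assumes eq: "\<And>z. g z = (\<Sum>i\<in>I. p i * g (z - a i)) + \<phi> z" and \<phi>: "(\<phi> \<longlongrightarrow> 0) at_top"
    and bd: "eventually (\<lambda>z. \<bar>g z\<bar> \<le> B) at_top"
    and \<rho>: "0 < \<rho>" "\<And>k. N \<le> k \<Longrightarrow> \<rho> * real k \<in> add_semigroup I a"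
    and n: "\<And>i. i \<in> I \<Longrightarrow> 0 < n i"
    and win: "((\<lambda>z. \<Sum>i\<in>I. p i * (\<Sum>k<n i. g (z - \<rho> * real k))) \<longlongrightarrow> 0) at_top"
    and e: "0 < e"
  shows "eventually (\<lambda>z. g z < e) at_top"
proof -
  obtain L z where L: "filterlim z at_top sequentially" "(\<lambda>n. g (z n)) \<longlonglongrightarrow> L"
    "\<And>e. 0 < e \<Longrightarrow> eventually (\<lambda>x. g x < L + e) at_top"
    using limsup_sequence[OF bd] by blast
  have lim: "(\<lambda>n. g (z n - s)) \<longlonglongrightarrow> L" if "s \<in> add_semigroup I a" for s
    by (rule extremal_sequence[OF eq \<phi> L(3,1,2) that])
  have lim_shift: "filterlim (\<lambda>n. z n - x) at_top sequentially" for x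
    using filterlim_tendsto_add_at_top[OF tendsto_const[of "-x"] L(1)] by simp
  define m where "m = (\<Sum>i\<in>I. p i * real (n i))"
  have m: "0 < m" unfolding m_def using fin nonempty p_pos n by (intro sum_pos) auto
  \<comment> \<open>Moving the base point back by \<open>\<rho> * N\<close> turns every shift in the
    window into some \<open>\<rho> * (N + k)\<close>, which lies in the semigroup.\<close>
  have "(\<lambda>l. g (z l - \<rho> * real N - \<rho> * real k)) \<longlonglongrightarrow> L" for k
    using lim[OF \<rho>(2)[of "N + k"]] by (simp add: algebra_simps)
  then have "(\<lambda>l. \<Sum>i\<in>I. p i * (\<Sum>k<n i. g (z l - \<rho> * real N - \<rho> * real k))) \<longlonglongrightarrow>
      (\<Sum>i\<in>I. p i * (\<Sum>k<n i. L))"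
    by (intro tendsto_intros)
  moreover have "(\<lambda>l. \<Sum>i\<in>I. p i * (\<Sum>k<n i. g (z l - \<rho> * real N - \<rho> * real k))) \<longlonglongrightarrow> 0"
    by (rule filterlim_compose[OF win lim_shift])
  ultimately have "(\<Sum>i\<in>I. p i * (\<Sum>k<n i. L)) = 0" by (rule LIMSEQ_unique)
  then have "m * L = 0" by (simp add: m_def sum_distrib_right mult.assoc)
  then have "L = 0" using m by simp
  then show ?thesis using L(3)[OF e] by simp
qed

context renewal_equation
begin

context
  fixes \<rho> :: real and n :: "'a \<Rightarrow> nat" and N :: nat
  assumes \<rho>: "0 < \<rho>" "\<And>k. N \<le> k \<Longrightarrow> \<rho> * real k \<in> add_semigroup I a"
    and lattice: "\<And>i. i \<in> I \<Longrightarrow> a i = \<rho> * real (n i)"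
begin

lemma n_pos:
  assumes i: "i \<in> I"
  shows "0 < n i"
proof -
  have "0 < \<rho> * real (n i)" using a_pos[OF i] lattice[OF i] by simp
  then show ?thesis using \<rho>(1) by (simp add: zero_less_mult_iff)
qed

text \<open>The discrete counterpart of \<open>window\<close>: integrals over
  \<open>{z - a i<..z}\<close> become sums over the \<open>n i\<close> lattice points
  \<open>z - \<rho> * k\<close> in that interval.\<close>

definition lattice_window :: "real \<Rightarrow> real" where
  "lattice_window z = (\<Sum>i\<in>I. p i * (\<Sum>k<n i. h (z - \<rho> * real k)))"

lemma lattice_window_step: "lattice_window z = lattice_window (z - \<rho>) + \<psi> z"
proof -
  have "(\<Sum>k<n i. h (z - \<rho> * real k)) - (\<Sum>k<n i. h (z - \<rho> - \<rho> * real k)) = h z - h (z - a i)"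
    if "i \<in> I" for i
  proof -
    have "(\<Sum>k<n i. h (z - \<rho> - \<rho> * real k)) = (\<Sum>k<n i. h (z - \<rho> * real (Suc k)))"
      by (intro sum.cong) (auto simp: algebra_simps)
    then show ?thesis
      using sum_lessThan_telescope'[of "\<lambda>k. h (z - \<rho> * real k)" "n i"] lattice[OF that]
      by (simp add: sum_subtractf)
  qed
  then have "lattice_window z - lattice_window (z - \<rho>) = (\<Sum>i\<in>I. p i * (h z - h (z - a i)))"
    unfolding lattice_window_def sum_subtractf[symmetric] right_diff_distrib[symmetric]
    by (intro sum.cong) auto
  also have "\<dots> = h z - (\<Sum>i\<in>I. p i * h (z - a i))"
    by (simp add: right_diff_distrib sum_subtractf p_sum flip: sum_distrib_right)
  also have "\<dots> = \<psi> z" using eq[of z] by linarith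
  finally show ?thesis by simp
qed

text \<open>The series telescopes by \<open>lattice_window_step\<close>, and the remaining window at
  the far left vanishes because \<open>h\<close> decays exponentially there.\<close>

lemma lattice_window_sums: "(\<lambda>k. \<psi> (z - \<rho> * real k)) sums lattice_window z"
proof -
  have "(\<Sum>k<l. \<psi> (z - \<rho> * real k)) = lattice_window z - lattice_window (z - \<rho> * real l)" for l
  proof (induction l)
    case (Suc l)
    then show ?case using lattice_window_step[of "z - \<rho> * real l"] by (simp add: algebra_simps)
  qed simp
  moreover have h0: "(\<lambda>l. h (z - \<rho> * real l - x)) \<longlonglongrightarrow> 0" for x
  proof (rule tendsto_sandwich[of "\<lambda>_. 0" _ _ "\<lambda>l. H * exp (c * (z - \<rho> * real l - x))"])
    show "(\<lambda>l. H * exp (c * (z - \<rho> * real l - x))) \<longlonglongrightarrow> 0"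
      using c_pos \<rho>(1) by real_asymp
  qed (use h_nonneg h_exp in auto)
  have "(\<lambda>l. lattice_window (z - \<rho> * real l)) \<longlonglongrightarrow> (\<Sum>i\<in>I. p i * (\<Sum>k<n i. 0))"
    unfolding lattice_window_def by (intro tendsto_intros h0)
  then have "(\<lambda>l. lattice_window z - lattice_window (z - \<rho> * real l)) \<longlonglongrightarrow> lattice_window z - 0"
    by (intro tendsto_diff tendsto_const) simp
  ultimately show ?thesis unfolding sums_def by simp
qed

text \<open>The part of the bilateral series sitting at points beyond \<open>z\<close>. The part at
  and before \<open>z\<close> is exactly \<open>lattice_window z\<close>, so \<open>ahead z\<close>,
  which tends to 0, is the whole error.\<close>

definition "ahead z = (\<Sum>k. \<psi> (z + \<rho> * real (Suc k)))"

lemma ahead: "summable (\<lambda>k. \<psi> (z + \<rho> * real (Suc k)))"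
    "0 \<le> ahead z" "(ahead \<longlongrightarrow> 0) at_top"
proof -
  define q where "q = exp (- \<epsilon> * \<rho>)"
  have q: "0 < q" "q < 1" using eps_pos \<rho>(1) by (auto simp: q_def)
  have bd: "\<psi> (z + \<rho> * real (Suc k)) \<le> C * exp (- \<epsilon> * z) * q ^ k" for z k
  proof -
    have "\<psi> (z + \<rho> * real (Suc k)) \<le> C * exp (- \<epsilon> * (z + \<rho> * real (Suc k)))" by (rule \<psi>_exp)
    also have "\<dots> \<le> C * exp (- \<epsilon> * (z + \<rho> * real k))"
      using C_nonneg eps_pos \<rho>(1) by (intro mult_left_mono) (auto simp: algebra_simps)
    also have "\<dots> = C * exp (- \<epsilon> * z) * q ^ k"
      by (simp add: q_def exp_of_nat_mult[symmetric] mult_exp_exp algebra_simps)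
    finally show ?thesis .
  qed
  have geo: "summable (\<lambda>k. C * exp (- \<epsilon> * z) * q ^ k)" for z
    using q by (intro summable_mult summable_geometric) auto
  show sm: "summable (\<lambda>k. \<psi> (z + \<rho> * real (Suc k)))" for z
    by (rule summable_comparison_test'[OF geo]) (use bd \<psi>_nonneg in auto)
  show nn: "0 \<le> ahead z" for z
    unfolding ahead_def by (rule suminf_nonneg[OF sm \<psi>_nonneg])
  have "ahead z \<le> C * exp (- \<epsilon> * z) / (1 - q)" for z
  proof -
    have "ahead z \<le> (\<Sum>k. C * exp (- \<epsilon> * z) * q ^ k)"
      unfolding ahead_def by (rule suminf_le[OF bd sm geo])
    also have "\<dots> = C * exp (- \<epsilon> * z) / (1 - q)"
      using q by (subst suminf_mult) (auto simp: suminf_geometric summable_geometric)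
    finally show ?thesis .
  qed
  moreover have "((\<lambda>z. C * exp (- \<epsilon> * z)) \<longlongrightarrow> 0) at_top"
    using eps_pos by real_asymp
  then have "((\<lambda>z. C * exp (- \<epsilon> * z) / (1 - q)) \<longlongrightarrow> 0) at_top"
    by (rule tendsto_divide_zero)
  ultimately show "(ahead \<longlongrightarrow> 0) at_top"
    using nn by (intro tendsto_sandwich[of "\<lambda>_. 0" ahead at_top "\<lambda>z. C * exp (- \<epsilon> * z) / (1 - q)"]) auto
qed

lemma lattice_has_sum:
  "((\<lambda>k::int. \<psi> (z - \<rho> * of_int k)) has_sum (lattice_window z + ahead z)) UNIV"
proof -
  have "((\<lambda>k. \<psi> (z - \<rho> * real k)) has_sum lattice_window z) UNIV"
    using lattice_window_sums \<psi>_nonneg sums_summable[OF lattice_window_sums]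
    by (intro norm_summable_imp_has_sum) auto
  then have 1: "((\<lambda>k::int. \<psi> (z - \<rho> * of_int k)) has_sum lattice_window z) (range int)"
    by (intro has_sum_reindex[THEN iffD2]) (auto simp: o_def)
  have "((\<lambda>k. \<psi> (z + \<rho> * real (Suc k))) has_sum ahead z) UNIV"
    using ahead(1) \<psi>_nonneg by (intro norm_summable_imp_has_sum) (auto simp: ahead_def summable_sums)
  moreover have flip: "(\<lambda>k::int. \<psi> (z - \<rho> * of_int k)) \<circ> (\<lambda>k. - int (Suc k)) = (\<lambda>k. \<psi> (z + \<rho> * real (Suc k)))"
    by (simp add: fun_eq_iff algebra_simps)
  ultimately have 2: "((\<lambda>k::int. \<psi> (z - \<rho> * of_int k)) has_sum ahead z) (range (\<lambda>k. - int (Suc k)))"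
    using flip by (intro has_sum_reindex[THEN iffD2]) (simp_all add: inj_def)
  have "range int \<inter> range (\<lambda>k. - int (Suc k)) = {}" by auto
  from has_sum_Un_disjoint[OF 1 2 this]
  have "((\<lambda>k::int. \<psi> (z - \<rho> * of_int k)) has_sum (lattice_window z + ahead z)) (range int \<union> range (\<lambda>k. - int (Suc k)))" .
  also have "range int \<union> range (\<lambda>k. - int (Suc k)) = UNIV"
  proof -
    have "x \<in> range int \<union> range (\<lambda>k. - int (Suc k))" for x
      by (cases x rule: int_cases) blast+
    then show ?thesis by blast
  qed
  finally show ?thesis .
qed

text \<open>\<open>F\<close> has period \<open>\<rho>\<close> and the weights sum to 1, so
  subtracting a multiple of \<open>F\<close> preserves the renewal equation. The resulting
  \<open>g\<close> has window \<open>- ahead\<close>, and \<open>lattice_limsup\<close> applies to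
  both \<open>g\<close> and \<open>- g\<close>.\<close>

theorem renewal_lattice:
  shows "(\<lambda>k::int. \<psi> (z - \<rho> * of_int k)) summable_on UNIV"
    and "((\<lambda>z. h z - \<rho> / semi_mean * (\<Sum>\<^sub>\<infinity>k::int. \<psi> (z - \<rho> * of_int k))) \<longlongrightarrow> 0) at_top"
proof -
  show "(\<lambda>k::int. \<psi> (z - \<rho> * of_int k)) summable_on UNIV"
    using lattice_has_sum by (rule has_sum_imp_summable)
  define F where "F z = (\<Sum>\<^sub>\<infinity>k::int. \<psi> (z - \<rho> * of_int k))" for z
  have F: "F z = lattice_window z + ahead z" for z
    unfolding F_def using lattice_has_sum by (rule infsumI)
  have "F (z - \<rho>) = F z" for z
  proof -
    have "bij_betw (\<lambda>k::int. k + 1) UNIV UNIV" by (rule bij_betwI[of _ _ _ "\<lambda>k. k - 1"]) auto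
    from infsum_reindex_bij_betw[OF this, of "\<lambda>k. \<psi> (z - \<rho> * of_int k)"]
    show ?thesis unfolding F_def by (simp add: algebra_simps)
  qed
  then have F_step: "F (z - \<rho>) = F z" for z .
  have F_nat: "F (z - \<rho> * real k) = F z" for z k
  proof (induction k)
    case (Suc k)
    have "z - \<rho> * real (Suc k) = z - \<rho> * real k - \<rho>" by (simp add: algebra_simps)
    then show ?case using F_step[of "z - \<rho> * real k"] Suc by metis
  qed simp
  define g where "g z = h z - \<rho> / semi_mean * F z" for z
  define m where "m = (\<Sum>i\<in>I. p i * real (n i))"
  have m: "semi_mean = \<rho> * m"
    unfolding semi_mean_def m_def sum_distrib_left by (intro sum.cong) (auto simp: lattice)
  have geq: "g z = (\<Sum>i\<in>I. p i * g (z - a i)) + \<psi> z" for z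
  proof -
    have "(\<Sum>i\<in>I. p i * g (z - a i)) = (\<Sum>i\<in>I. p i * h (z - a i) - p i * (\<rho> / semi_mean * F z))"
      unfolding g_def by (intro sum.cong) (auto simp: lattice F_nat algebra_simps)
    also have "\<dots> = h z - \<psi> z - \<rho> / semi_mean * F z"
      using eq[of z] unfolding sum_subtractf sum_distrib_right[symmetric] p_sum by linarith
    finally show ?thesis by (simp add: g_def)
  qed
  have win: "(\<Sum>i\<in>I. p i * (\<Sum>k<n i. g (z - \<rho> * real k))) = - ahead z" for z
  proof -
    have "(\<Sum>i\<in>I. p i * (\<Sum>k<n i. g (z - \<rho> * real k))) =
      lattice_window z - (\<Sum>i\<in>I. p i * real (n i) * (\<rho> / semi_mean * F z))"
      unfolding lattice_window_def sum_subtractf[symmetric] g_def F_nat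
      by (intro sum.cong) (auto simp: sum_subtractf algebra_simps)
    also have "\<dots> = lattice_window z - m * (\<rho> / semi_mean * F z)"
      unfolding m_def sum_distrib_right ..
    \<comment> \<open>Since \<open>m * \<rho> = semi_mean\<close>, the factor
      \<open>\<rho> / semi_mean\<close> is the one for which the multiple of \<open>F\<close>
      cancels \<open>lattice_window\<close> up to \<open>ahead\<close>.\<close>
    also have "\<dots> = - ahead z" using m semi_mean_pos F by auto
    finally show ?thesis .
  qed
  obtain B where B: "\<And>z. h z \<le> B" using h_bounded by blast
  have g_bd: "eventually (\<lambda>z. \<bar>g z\<bar> \<le> B + \<rho> / semi_mean * (B * m + 1)) at_top"
  proof -
    have "eventually (\<lambda>z. ahead z < 1) at_top" using order_tendstoD(2)[OF ahead(3)] by simp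
    then show ?thesis
    proof eventually_elim
      case (elim z)
      have "lattice_window z \<le> (\<Sum>i\<in>I. p i * (\<Sum>k<n i. B))" unfolding lattice_window_def
        using B p_pos by (intro sum_mono mult_left_mono) (auto intro: less_imp_le)
      also have "\<dots> = B * m" by (simp add: m_def sum_distrib_left algebra_simps)
      finally have "F z \<le> B * m + 1" using elim F by simp
      moreover have "0 \<le> F z" unfolding F_def by (rule infsum_nonneg) (use \<psi>_nonneg in auto)
      ultimately have "0 \<le> \<rho> / semi_mean * F z" "\<rho> / semi_mean * F z \<le> \<rho> / semi_mean * (B * m + 1)"
        using semi_mean_pos \<rho>(1) by (auto intro!: mult_left_mono divide_right_mono)
      then show ?case using B[of z] h_nonneg[of z] unfolding g_def by linarith
    qed
  qed
  have up: "eventually (\<lambda>z. g z < e) at_top" if "0 < e" for e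
    using lattice_limsup[OF geq \<psi>_tendsto g_bd \<rho> n_pos _ that] tendsto_minus[OF ahead(3)]
    by (simp add: win)
  have geq': "- g z = (\<Sum>i\<in>I. p i * (- g (z - a i))) + (- \<psi> z)" for z
    using geq[of z] by (simp add: sum_negf)
  have low: "eventually (\<lambda>z. - g z < e) at_top" if "0 < e" for e
  proof (rule lattice_limsup[OF geq' _ _ \<rho> n_pos _ that])
    show "((\<lambda>z. - \<psi> z) \<longlongrightarrow> 0) at_top" using tendsto_minus[OF \<psi>_tendsto] by simp
    show "eventually (\<lambda>z. \<bar>- g z\<bar> \<le> B + \<rho> / semi_mean * (B * m + 1)) at_top" using g_bd by simp
    show "((\<lambda>z. \<Sum>i\<in>I. p i * (\<Sum>k<n i. - g (z - \<rho> * real k))) \<longlongrightarrow> 0) at_top"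
      using ahead(3) win by (simp add: sum_negf)
  qed
  have "(g \<longlongrightarrow> 0) at_top"
  proof (rule order_tendstoI)
    fix x :: real assume "x < 0"
    then show "eventually (\<lambda>z. x < g z) at_top" using low[of "-x"] by (auto elim!: eventually_mono)
  next
    fix x :: real assume "0 < x"
    then show "eventually (\<lambda>z. g z < x) at_top" by (rule up)
  qed
  then show "((\<lambda>z. h z - \<rho> / semi_mean * (\<Sum>\<^sub>\<infinity>k::int. \<psi> (z - \<rho> * of_int k))) \<longlongrightarrow> 0) at_top"
    by (simp add: g_def[abs_def] F_def)
qed

end

end

section \<open>Boundary layers\<close>

text \<open>Disjoint translates of \<open>S\<close> in the direction \<open>\<nu>\<close> fit into a slightly larger ball, which bounds
  the volume of \<open>S\<close> without Fubini's theorem in rotated coordinates.\<close>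

lemma thin_slab_volume:
  fixes S :: "'a::euclidean_space set"
  assumes S: "S \<in> sets borel" "S \<subseteq> ball z R" and \<nu>: "norm \<nu> = 1"
    and \<Phi>: "\<And>x t. \<Phi> (x + t *\<^sub>R \<nu>) = \<Phi> x + t" "\<And>x. x \<in> S \<Longrightarrow> 0 < \<Phi> x \<and> \<Phi> x \<le> \<eta>"
    and \<eta>: "0 < \<eta>" "\<eta> \<le> 1"
  shows "measure lborel S \<le> 2 * \<eta> * measure lborel (ball z (R + 1))"
proof -
  \<comment> \<open>As many translates by multiples of \<open>\<eta>\<close> as fit into total
    displacement 1; this displacement is the extra 1 in the radius. They are disjoint because
    \<open>\<Phi>\<close> takes values in \<open>(k * \<eta>, (k + 1) * \<eta>]\<close> on the
    translate number \<open>k\<close>.\<close>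
  define n where "n = nat \<lfloor>1 / \<eta>\<rfloor>"
  have "1 \<le> 1 / \<eta>" using \<eta> by simp
  then have "1 \<le> \<lfloor>1 / \<eta>\<rfloor>" by (simp add: le_floor_iff)
  then have n: "1 / \<eta> < real n + 1" "real n \<le> 1 / \<eta>" "1 \<le> real n" unfolding n_def by linarith+
  define T where "T k = (+) ((real k * \<eta>) *\<^sub>R \<nu>) ` S" for k
  have T_vim: "T k = (\<lambda>x. x - (real k * \<eta>) *\<^sub>R \<nu>) -` S" for k
    unfolding T_def by (auto simp: image_iff) (metis add.commute diff_add_cancel)
  have T_sets: "T k \<in> sets borel" for k
    unfolding T_vim using measurable_sets[OF _ S(1), of "\<lambda>x. x - (real k * \<eta>) *\<^sub>R \<nu>" borel] by simp
  have T_measure: "measure lborel (T k) = measure lborel S" for k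
  proof -
    have "emeasure lborel (T k) = emeasure (distr lborel borel ((+) (- (real k * \<eta>) *\<^sub>R \<nu>))) S"
      by (subst emeasure_distr) (auto simp: S T_vim vimage_def)
    also have "\<dots> = emeasure lborel S" by (simp add: lborel_distr_plus)
    finally show ?thesis by (simp add: measure_def)
  qed
  have disj: "disjoint_family_on T {..<n}"
  proof -
    have range: "real k * \<eta> < \<Phi> x \<and> \<Phi> x \<le> (real k + 1) * \<eta>" if "x \<in> T k" for k x
      using that \<Phi> unfolding T_def by (auto simp: algebra_simps)
    have "k = l" if "x \<in> T k" "x \<in> T l" for k l x
    proof -
      have "real k * \<eta> < (real l + 1) * \<eta>" "real l * \<eta> < (real k + 1) * \<eta>"
        using range[OF that(1)] range[OF that(2)] by linarith+
      then show "k = l" using \<eta> by simp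
    qed
    then show ?thesis unfolding disjoint_family_on_def by blast
  qed
  have sub: "(\<Union>k<n. T k) \<subseteq> ball z (R + 1)"
  proof
    fix x assume "x \<in> (\<Union>k<n. T k)"
    then obtain k y where k: "k < n" "y \<in> S" "x = (real k * \<eta>) *\<^sub>R \<nu> + y" by (auto simp: T_def)
    have "real k * \<eta> \<le> real n * \<eta>" using k \<eta> by simp
    also have "\<dots> \<le> 1" using n \<eta> by (simp add: field_simps)
    finally have "norm ((real k * \<eta>) *\<^sub>R \<nu>) \<le> 1" using \<eta> \<nu> by simp
    moreover have "norm (z - y) < R" using S(2) k by (auto simp: dist_norm)
    moreover have "z - x = (z - y) - (real k * \<eta>) *\<^sub>R \<nu>" using k by simp
    then have "norm (z - x) \<le> norm (z - y) + norm ((real k * \<eta>) *\<^sub>R \<nu>)" by (metis norm_triangle_ineq4)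
    ultimately show "x \<in> ball z (R + 1)" by (simp add: dist_norm)
  qed
  have fin: "emeasure lborel (T k) \<noteq> \<infinity>" if "k < n" for k
  proof -
    have "emeasure lborel (T k) \<le> emeasure lborel (ball z (R + 1))"
      using sub that by (intro emeasure_mono) auto
    also have "\<dots> < \<infinity>" by (rule emeasure_lborel_ball_finite)
    finally show ?thesis by simp
  qed
  have "real n * measure lborel S = (\<Sum>k<n. measure lborel (T k))" by (simp add: T_measure)
  also have "\<dots> = measure lborel (\<Union>k<n. T k)"
    using disj T_sets fin by (intro measure_finite_Union[symmetric]) auto
  also have "\<dots> \<le> measure lborel (ball z (R + 1))"
    using sub T_sets emeasure_lborel_ball_finite[of z "R + 1"]
    by (intro measure_mono_fmeasurable) (auto simp: fmeasurable_def)
  finally have *: "real n * measure lborel S \<le> measure lborel (ball z (R + 1))" .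
  \<comment> \<open>Rounding down loses at most a factor 2, because \<open>n\<close> is at least
    1.\<close>
  have "1 / \<eta> \<le> 2 * real n" using n by linarith
  then have "1 \<le> 2 * real n * \<eta>" using \<eta> by (simp add: field_simps)
  then have "measure lborel S \<le> 2 * real n * \<eta> * measure lborel S"
    using mult_right_mono[of 1 "2 * real n * \<eta>" "measure lborel S"] by simp
  also have "\<dots> = 2 * \<eta> * (real n * measure lborel S)" by simp
  also have "\<dots> \<le> 2 * \<eta> * measure lborel (ball z (R + 1))" using * \<eta> by (intro mult_left_mono) auto
  finally show ?thesis .
qed

lemma infdist_lessE:
  assumes "infdist x A < e" "A \<noteq> {}"
  obtains y where "y \<in> A" "dist x y < e"
  using assms cInf_lessD[of "dist x ` A" e] by (auto simp: infdist_def)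

text \<open>Distance is taken to the complement because this is the distance a path has to travel
  before leaving \<open>D\<close>.\<close>

definition boundary_layer :: "'a::metric_space set \<Rightarrow> real \<Rightarrow> 'a set" where
  "boundary_layer D e = {x \<in> D. infdist x (- D) < e}"

lemma boundary_layer_open: "open D \<Longrightarrow> open (boundary_layer D e)"
proof -
  assume "open D"
  have "open {x. infdist x (- D) < e}" by (intro open_Collect_less continuous_intros)
  moreover have "boundary_layer D e = D \<inter> {x. infdist x (- D) < e}" by (auto simp: boundary_layer_def)
  ultimately show ?thesis using \<open>open D\<close> by auto
qed

text \<open>\<open>\<Phi>\<close> is the height above the graph of the chart. It is Lipschitz with
  constant \<open>1 + 2 * \<Lambda>\<close>: the gradient bound makes \<open>\<phi>\<close>
  Lipschitz on the hyperplane, and the projection \<open>P\<close> is bounded crudely by 2. A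
  complement point within \<open>e\<close> stays in the chart ball and has height at most 0, so the
  layer has height at most \<open>(1 + 2 * \<Lambda>) * e\<close> and is a thin slab.\<close>

lemma C11_local_layer:
  fixes D :: "'a::euclidean_space set"
  assumes D: "open D" and ne: "- D \<noteq> {}" and \<delta>: "0 < \<delta>" and \<Lambda>: "0 < \<Lambda>" and \<nu>: "norm \<nu> = 1"
    and \<phi>: "\<And>x. x \<bullet> \<nu> = 0 \<Longrightarrow> (\<phi> has_derivative (\<lambda>h. g x \<bullet> h)) (at x within {x. x \<bullet> \<nu> = 0})"
    and g: "\<And>x. x \<bullet> \<nu> = 0 \<Longrightarrow> norm (g x) \<le> \<Lambda>"
    and chart: "D \<inter> ball z \<delta> = {y \<in> ball z \<delta>. \<phi> ((y - z) - ((y - z) \<bullet> \<nu>) *\<^sub>R \<nu>) < (y - z) \<bullet> \<nu>}"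
    and e: "0 < e" "e \<le> \<delta> / 2" "(1 + 2 * \<Lambda>) * e \<le> 1"
  shows "measure lborel (boundary_layer D e \<inter> ball z (\<delta> / 2)) \<le>
    2 * ((1 + 2 * \<Lambda>) * e) * measure lborel (ball z (\<delta> / 2 + 1))"
proof (rule thin_slab_volume[OF _ _ \<nu>])
  define P where "P y = y - (y \<bullet> \<nu>) *\<^sub>R \<nu>" for y
  define \<Phi> where "\<Phi> x = (x - z) \<bullet> \<nu> - \<phi> (P (x - z))" for x
  have \<nu>\<nu>: "\<nu> \<bullet> \<nu> = 1" using \<nu> by (simp add: norm_eq_1)
  have PH: "P y \<bullet> \<nu> = 0" for y by (simp add: P_def inner_diff_left \<nu>\<nu>)
  have lip: "norm (\<phi> x - \<phi> y) \<le> \<Lambda> * norm (x - y)" if "x \<bullet> \<nu> = 0" "y \<bullet> \<nu> = 0" for x y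
  proof (rule differentiable_bound[where S = "{x. x \<bullet> \<nu> = 0}" and f' = "\<lambda>x h. g x \<bullet> h"])
    show "convex {x. x \<bullet> \<nu> = 0}" using convex_hyperplane[of \<nu> 0] by (simp add: inner_commute)
    show "onorm ((\<bullet>) (g x)) \<le> \<Lambda>" if "x \<in> {x. x \<bullet> \<nu> = 0}" for x
    proof (rule onorm_bound)
      fix h
      have "norm (g x \<bullet> h) \<le> norm (g x) * norm h" using Cauchy_Schwarz_ineq2 by simp
      also have "\<dots> \<le> \<Lambda> * norm h" using g that by (intro mult_right_mono) auto
      finally show "norm (g x \<bullet> h) \<le> \<Lambda> * norm h" .
    qed (use \<Lambda> in simp)
  qed (use \<phi> that in auto)
  have \<Phi>_lip: "\<bar>\<Phi> x - \<Phi> y\<bar> \<le> (1 + 2 * \<Lambda>) * dist x y" for x y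
  proof -
    have Pd: "P (x - z) - P (y - z) = (x - y) - ((x - y) \<bullet> \<nu>) *\<^sub>R \<nu>"
      by (simp add: P_def algebra_simps)
    have inner: "\<bar>(x - y) \<bullet> \<nu>\<bar> \<le> norm (x - y)" using Cauchy_Schwarz_ineq2[of "x - y" \<nu>] \<nu> by simp
    have "norm (P (x - z) - P (y - z)) \<le> norm (x - y) + norm (((x - y) \<bullet> \<nu>) *\<^sub>R \<nu>)"
      unfolding Pd by (rule norm_triangle_ineq4)
    also have "\<dots> \<le> 2 * norm (x - y)" using inner \<nu> by simp
    finally have "\<Lambda> * norm (P (x - z) - P (y - z)) \<le> \<Lambda> * (2 * norm (x - y))"
      using \<Lambda> by (intro mult_left_mono) auto
    with lip[OF PH PH] have *: "\<bar>\<phi> (P (x - z)) - \<phi> (P (y - z))\<bar> \<le> 2 * \<Lambda> * norm (x - y)"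
      by (metis mult.assoc mult.commute order_trans real_norm_def)
    have "\<Phi> x - \<Phi> y = (x - y) \<bullet> \<nu> - (\<phi> (P (x - z)) - \<phi> (P (y - z)))"
      by (simp add: \<Phi>_def inner_diff_left)
    then have "\<bar>\<Phi> x - \<Phi> y\<bar> \<le> norm (x - y) + 2 * \<Lambda> * norm (x - y)" using inner * by linarith
    then show ?thesis by (simp add: dist_norm algebra_simps)
  qed
  show "\<Phi> (x + t *\<^sub>R \<nu>) = \<Phi> x + t" for x t
  proof -
    have "P (x + t *\<^sub>R \<nu> - z) = P (x - z)" by (simp add: P_def inner_diff_left inner_add_left \<nu>\<nu> algebra_simps)
    then show ?thesis by (simp add: \<Phi>_def inner_diff_left inner_add_left \<nu>\<nu>)
  qed
  have \<Phi>_iff: "x \<in> D \<longleftrightarrow> 0 < \<Phi> x" if "x \<in> ball z \<delta>" for x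
    using chart that unfolding \<Phi>_def P_def by (auto simp: set_eq_iff)
  show "0 < \<Phi> x \<and> \<Phi> x \<le> (1 + 2 * \<Lambda>) * e" if x: "x \<in> boundary_layer D e \<inter> ball z (\<delta> / 2)" for x
  proof -
    have xD: "x \<in> D" "infdist x (- D) < e" using x by (auto simp: boundary_layer_def)
    obtain y where y: "y \<in> - D" "dist x y < e" using infdist_lessE[OF xD(2) ne] .
    have "x \<in> ball z \<delta>" using x \<delta> by auto
    moreover have "dist z y \<le> dist z x + dist x y" by (rule dist_triangle)
    then have "y \<in> ball z \<delta>" using x y e by auto
    ultimately have "0 < \<Phi> x" "\<Phi> y \<le> 0" using \<Phi>_iff xD y by (auto simp: not_less)
    moreover have "(1 + 2 * \<Lambda>) * dist x y \<le> (1 + 2 * \<Lambda>) * e" using y \<Lambda> by (intro mult_left_mono) auto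
    ultimately show ?thesis using \<Phi>_lip[of x y] by linarith
  qed
qed (use D \<Lambda> e boundary_layer_open[OF D] in auto)

text \<open>The frontier is compact, so finitely many charts cover it. A segment from a layer point
  to a nearby complement point crosses the frontier, which puts the layer point into one of the
  chart balls.\<close>

lemma C11_boundary_layer:
  fixes D :: "'a::euclidean_space set"
  assumes D: "C11_open D" "bounded D"
  shows "\<exists>C. \<forall>e>0. measure lborel (boundary_layer D e) \<le> C * e"
proof -
  have oD: "open D" using D by (simp add: C11_open_def)
  have ne: "- D \<noteq> {}" using D(2) not_bounded_UNIV by (metis Compl_eq_Diff_UNIV Diff_eq_empty_iff bounded_subset)
  obtain \<delta> \<Lambda> where \<delta>: "0 < \<delta>" and \<Lambda>: "0 < \<Lambda>" and charts: "\<forall>z\<in>frontier D. \<exists>\<nu> \<phi> g.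
        let H = {x. x \<bullet> \<nu> = 0} in
          norm \<nu> = 1 \<and> \<phi> 0 = 0 \<and> g 0 = 0 \<and>
          (\<forall>x\<in>H. g x \<in> H \<and> (\<phi> has_derivative (\<lambda>h. g x \<bullet> h)) (at x within H)
                 \<and> norm (g x) \<le> \<Lambda>) \<and>
          (\<forall>x\<in>H. \<forall>y\<in>H. norm (g x - g y) \<le> \<Lambda> * norm (x - y)) \<and>
          D \<inter> ball z \<delta> =
            {y \<in> ball z \<delta>. \<phi> ((y - z) - ((y - z) \<bullet> \<nu>) *\<^sub>R \<nu>) < (y - z) \<bullet> \<nu>}"
    using D(1) unfolding C11_open_def by blast
  \<comment> \<open>With \<open>e \<le> \<delta> / 4\<close> a layer point is within
    \<open>\<delta> / 4 + \<delta> / 4\<close> of a chart centre; the other bound keeps the slab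
    thickness at most 1.\<close>
  define e0 where "e0 = min (\<delta> / 4) (1 / (1 + 2 * \<Lambda>))"
  have e0: "0 < e0" using \<delta> \<Lambda> by (simp add: e0_def)
  define V where "V z = 2 * (1 + 2 * \<Lambda>) * measure lborel (ball z (\<delta> / 2 + 1))" for z :: 'a
  have V: "0 \<le> V z" for z using \<Lambda> by (simp add: V_def)
  have local: "measure lborel (boundary_layer D e \<inter> ball z (\<delta> / 2)) \<le> V z * e"
    if "z \<in> frontier D" "0 < e" "e \<le> e0" for z e
  proof -
    from charts that(1) obtain \<nu> \<phi> g where
      "norm \<nu> = 1" "\<And>x. x \<bullet> \<nu> = 0 \<Longrightarrow> (\<phi> has_derivative (\<lambda>h. g x \<bullet> h)) (at x within {x. x \<bullet> \<nu> = 0})"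
      "\<And>x. x \<bullet> \<nu> = 0 \<Longrightarrow> norm (g x) \<le> \<Lambda>"
      "D \<inter> ball z \<delta> = {y \<in> ball z \<delta>. \<phi> ((y - z) - ((y - z) \<bullet> \<nu>) *\<^sub>R \<nu>) < (y - z) \<bullet> \<nu>}"
      unfolding Let_def by blast
    note c = this
    have "(1 + 2 * \<Lambda>) * e \<le> (1 + 2 * \<Lambda>) * (1 / (1 + 2 * \<Lambda>))"
      using that \<Lambda> by (intro mult_left_mono) (auto simp: e0_def)
    then have e: "(1 + 2 * \<Lambda>) * e \<le> 1" using \<Lambda> by simp
    have "e \<le> \<delta> / 2" using that \<delta> by (simp add: e0_def)
    from C11_local_layer[OF oD ne \<delta> \<Lambda> c that(2) this e] show ?thesis by (simp add: V_def algebra_simps)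
  qed
  have "compact (frontier D)" using D(2) by (rule compact_frontier_bounded)
  moreover have "frontier D \<subseteq> \<Union>((\<lambda>z. ball z (\<delta> / 4)) ` frontier D)" using \<delta> by force
  ultimately obtain Z where Z: "Z \<subseteq> frontier D" "finite Z" "frontier D \<subseteq> (\<Union>z\<in>Z. ball z (\<delta> / 4))"
    by (metis (no_types, lifting) compactE_image open_ball)
  have cover: "boundary_layer D e \<subseteq> (\<Union>z\<in>Z. boundary_layer D e \<inter> ball z (\<delta> / 2))" if e: "0 < e" "e \<le> e0" for e
  proof
    fix x assume x: "x \<in> boundary_layer D e"
    then have xD: "x \<in> D" "infdist x (- D) < e" by (auto simp: boundary_layer_def)
    obtain y where y: "y \<in> - D" "dist x y < e" using infdist_lessE[OF xD(2) ne] .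
    have "closed_segment x y \<inter> frontier D \<noteq> {}"
      using xD y by (intro connected_Int_frontier) auto
    then obtain w where w: "w \<in> closed_segment x y" "w \<in> frontier D" by blast
    then obtain z where z: "z \<in> Z" "dist z w < \<delta> / 4" using Z by auto
    have "dist x w \<le> dist x y" using w(1) dist_in_closed_segment by (metis dist_commute)
    then have "dist x w < \<delta> / 4" using y e by (simp add: e0_def)
    then have "dist z x < \<delta> / 2" using z(2) dist_triangle[of z x w] by (simp add: dist_commute)
    then show "x \<in> (\<Union>z\<in>Z. boundary_layer D e \<inter> ball z (\<delta> / 2))" using x z by auto
  qed
  have Dm: "D \<in> fmeasurable lborel"
    using emeasure_bounded_finite[OF D(2)] oD by (auto simp: fmeasurable_def)
  have layer_sets: "boundary_layer D e \<in> sets borel" for e using boundary_layer_open[OF oD] by auto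
  have layer_sub: "boundary_layer D e \<subseteq> D" for e by (auto simp: boundary_layer_def)
  show ?thesis
  proof (intro exI allI impI)
    fix e :: real assume e: "0 < e"
    \<comment> \<open>The first summand of the constant serves \<open>e \<le> e0\<close>; for larger
      \<open>e\<close> the volume of \<open>D\<close> is already at most the second summand times
      \<open>e\<close>.\<close>
    show "measure lborel (boundary_layer D e) \<le> ((\<Sum>z\<in>Z. V z) + measure lborel D / e0) * e"
    proof (cases "e \<le> e0")
      case True
      have "measure lborel (boundary_layer D e) \<le> measure lborel (\<Union>z\<in>Z. boundary_layer D e \<inter> ball z (\<delta> / 2))"
        using cover[OF e True] layer_sets layer_sub
        by (intro measure_mono_fmeasurable fmeasurableI2[OF Dm]) (auto intro!: sets.finite_UN Z(2))
      also have "\<dots> \<le> (\<Sum>z\<in>Z. measure lborel (boundary_layer D e \<inter> ball z (\<delta> / 2)))"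
        using layer_sets layer_sub Z(2)
        by (intro measure_UNION_le) auto
      also have "\<dots> \<le> (\<Sum>z\<in>Z. V z * e)" using local Z e True by (intro sum_mono) auto
      also have "\<dots> \<le> ((\<Sum>z\<in>Z. V z) + measure lborel D / e0) * e"
        using e e0 by (simp add: distrib_right flip: sum_distrib_right)
      finally show ?thesis .
    next
      case False
      have "measure lborel (boundary_layer D e) \<le> measure lborel D"
        using layer_sets layer_sub by (intro measure_mono_fmeasurable Dm) auto
      also have "\<dots> \<le> measure lborel D / e0 * e" using False e0
          mult_right_mono[of e0 e "measure lborel D"] by (simp add: field_simps)
      also have "\<dots> \<le> ((\<Sum>z\<in>Z. V z) + measure lborel D / e0) * e"
        using V e by (intro mult_right_mono) (auto intro: sum_nonneg)
      finally show ?thesis .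
    qed
  qed
qed

text \<open>Along the single basis vector \<open>b\<close> the layer is contained in two end
  intervals of length \<open>e\<close>.\<close>

lemma interval_boundary_layer:
  fixes u v :: "'a::euclidean_space"
  assumes dim: "DIM('a) = 1"
  shows "\<exists>C. \<forall>e>0. measure lborel (boundary_layer (box u v) e) \<le> C * e"
proof (intro exI allI impI)
  fix e :: real assume e: "0 < e"
  obtain b :: 'a where b: "Basis = {b}" using dim card_1_singletonE by metis
  have bb: "b \<bullet> b = 1" using b by (metis inner_same_Basis insertI1)
  have sub: "boundary_layer (box u v) e \<subseteq> box u (u + e *\<^sub>R b) \<union> box (v - e *\<^sub>R b) v"
  proof
    fix x assume x: "x \<in> boundary_layer (box u v) e"
    have ne: "- box u v \<noteq> {}" using bounded_box[of u v] not_bounded_UNIV by (metis Compl_empty_eq double_compl)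
    obtain y where y: "y \<in> - box u v" "dist x y < e"
      using infdist_lessE[OF _ ne, of x e] x by (auto simp: boundary_layer_def)
    have "\<bar>(x - y) \<bullet> b\<bar> \<le> norm (x - y)" by (rule Basis_le_norm) (simp add: b)
    then have "\<bar>x \<bullet> b - y \<bullet> b\<bar> < e" using y by (simp add: dist_norm inner_diff_left)
    moreover have "y \<bullet> b \<le> u \<bullet> b \<or> v \<bullet> b \<le> y \<bullet> b" using y by (auto simp: box_def b)
    ultimately show "x \<in> box u (u + e *\<^sub>R b) \<union> box (v - e *\<^sub>R b) v"
      using x by (auto simp: boundary_layer_def box_def b inner_add_left inner_diff_left bb)
  qed
  have box: "measure lborel (box p (q::'a)) \<le> e" if "q - p = e *\<^sub>R b" for p q
  proof -
    have "(q - p) \<bullet> b = e" using that bb by simp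
    then show ?thesis using e by (simp add: measure_lborel_box_eq b inner_diff_left)
  qed
  have "measure lborel (boundary_layer (box u v) e) \<le> measure lborel (box u (u + e *\<^sub>R b) \<union> box (v - e *\<^sub>R b) v)"
    using sub boundary_layer_open[OF open_box, of u v e] by (intro measure_mono_fmeasurable) auto
  also have "\<dots> \<le> measure lborel (box u (u + e *\<^sub>R b)) + measure lborel (box (v - e *\<^sub>R b) v)"
    by (intro measure_Un_le) auto
  also have "\<dots> \<le> 2 * e" using box[of "u + e *\<^sub>R b" u] box[of v "v - e *\<^sub>R b"] by simp
  finally show "measure lborel (boundary_layer (box u v) e) \<le> 2 * e" .
qed

section \<open>Integrals of negative powers of the distance to the complement\<close>

lemma dyadic_powr_bound:
  fixes p y :: real
  assumes y: "0 < y" "y < 1" and p: "0 < p"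
  obtains k where "y < (1/2) ^ k" "y powr - p \<le> 2 powr ((real k + 1) * p)"
proof -
  have ex: "\<exists>n. (1/2::real) ^ n \<le> y" using real_arch_pow_inv[OF y(1), of "1/2"] by (auto intro: less_imp_le)
  define n where "n = (LEAST n. (1/2::real) ^ n \<le> y)"
  have n: "(1/2::real) ^ n \<le> y" unfolding n_def using ex by (rule LeastI_ex)
  have "n \<noteq> 0" using n y by (metis leD power_0)
  then obtain k where k: "n = Suc k" by (cases n) auto
  have "y < (1/2) ^ k" using not_less_Least[of k "\<lambda>n. (1/2::real) ^ n \<le> y"] k n_def by auto
  moreover have "y powr - p \<le> 2 powr ((real k + 1) * p)"
  proof -
    have "y powr - p \<le> ((1/2) ^ n) powr - p"
      by (rule powr_mono2'[OF _ _ n]) (use p in auto)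
    also have "(1/2::real) ^ n = 2 powr (- real n)"
      by (simp add: powr_minus powr_realpow power_one_over inverse_eq_divide)
    also have "- real n = - (real k + 1)" by (simp add: k)
    also have "(2 powr (- (real k + 1))) powr - p = 2 powr ((real k + 1) * p)"
      unfolding powr_powr by (simp add: algebra_simps)
    finally show ?thesis .
  qed
  ultimately show ?thesis by (rule that)
qed

text \<open>The layer of width \<open>(1/2) ^ k\<close> has volume at most
  \<open>C * (1/2) ^ k\<close>, and the integrand on the matching dyadic shell is at most
  \<open>2 powr ((k + 1) * p)\<close>. The products form a geometric series that converges because
  \<open>p < 1\<close>. Where the distance is at least 1 the integrand is at most 1.\<close>

lemma boundary_layer_integral:
  fixes D :: "'a::euclidean_space set"
  assumes D: "open D" "emeasure lborel D < \<infinity>" and layer: "\<And>e. 0 < e \<Longrightarrow> measure lborel (boundary_layer D e) \<le> C * e"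
    and p: "0 < p" "p < 1" 
  shows "(\<integral>\<^sup>+x\<in>D. ennreal (infdist x (- D) powr - p) \<partial>lborel) < \<infinity>"
proof -
  have C: "0 \<le> C" using order_trans[OF measure_nonneg layer[of 1]] by simp
  have [measurable]: "D \<in> sets borel" "boundary_layer D e \<in> sets borel" for e
    using D boundary_layer_open by (auto intro: borel_open)
  have ne: "- D \<noteq> {}" using D(2) by (metis Compl_empty_eq double_compl emeasure_lborel_UNIV order_less_irrefl)
  have em: "emeasure lborel (boundary_layer D e) \<le> ennreal (C * e)" if "0 < e" for e
  proof -
    have "emeasure lborel (boundary_layer D e) \<le> emeasure lborel D"
      by (intro emeasure_mono) (auto simp: boundary_layer_def)
    then have "emeasure lborel (boundary_layer D e) \<noteq> \<infinity>" using D(2) by auto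
    then have "emeasure lborel (boundary_layer D e) = ennreal (measure lborel (boundary_layer D e))"
      by (simp add: emeasure_eq_ennreal_measure)
    then show ?thesis using layer[OF that] by (simp add: ennreal_leI)
  qed
  have pt: "ennreal (infdist x (- D) powr - p) * indicator D x \<le> indicator D x +
      (\<Sum>k. ennreal (2 powr ((real k + 1) * p)) * indicator (boundary_layer D ((1/2) ^ k)) x)" for x
  proof (cases "x \<in> D \<and> infdist x (- D) < 1")
    case True
    have "0 < infdist x (- D)" using True D ne by (metis ComplD closed_Compl infdist_pos_not_in_closed)
    then obtain k where k: "infdist x (- D) < (1/2) ^ k"
      "infdist x (- D) powr - p \<le> 2 powr ((real k + 1) * p)"
      using dyadic_powr_bound True p by metis
    have "ennreal (infdist x (- D) powr - p) * indicator D x \<le>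
      ennreal (2 powr ((real k + 1) * p)) * indicator (boundary_layer D ((1/2) ^ k)) x"
      using True k by (auto simp: boundary_layer_def ennreal_leI)
    also have "\<dots> \<le> (\<Sum>k. ennreal (2 powr ((real k + 1) * p)) * indicator (boundary_layer D ((1/2) ^ k)) x)"
      (is "?f k \<le> suminf ?f")
    proof -
      have "sum ?f {k} \<le> suminf ?f" by (rule sum_le_suminf) auto
      then show ?thesis by (simp only: sum.insert sum.empty finite.emptyI empty_iff not_False_eq_True add_0_right)
    qed
    finally show ?thesis by (rule order_trans) simp
  next
    case False
    have "ennreal (infdist x (- D) powr - p) * indicator D x \<le> indicator D x"
    proof (cases "x \<in> D")
      case True
      then have "1 \<le> infdist x (- D)" using False by simp
      then have "infdist x (- D) powr - p \<le> 1"
        using powr_mono[of "-p" 0 "infdist x (- D)"] p by simp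
      then show ?thesis using True by simp
    qed simp
    then show ?thesis by (rule order_trans) simp
  qed
  have "(\<integral>\<^sup>+x\<in>D. ennreal (infdist x (- D) powr - p) \<partial>lborel) \<le> (\<integral>\<^sup>+x. indicator D x +
      (\<Sum>k. ennreal (2 powr ((real k + 1) * p)) * indicator (boundary_layer D ((1/2) ^ k)) x) \<partial>lborel)"
    by (intro nn_integral_mono pt)
  also have "\<dots> = emeasure lborel D + (\<Sum>k. ennreal (2 powr ((real k + 1) * p)) * emeasure lborel (boundary_layer D ((1/2) ^ k)))"
    by (subst nn_integral_add) (auto simp: nn_integral_suminf nn_integral_cmult)
  also have "(\<Sum>k. ennreal (2 powr ((real k + 1) * p)) * emeasure lborel (boundary_layer D ((1/2) ^ k)))
      \<le> (\<Sum>k. ennreal (2 powr p * C * (2 powr (p - 1)) ^ k))"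
  proof (rule suminf_le)
    fix k
    have "ennreal (2 powr ((real k + 1) * p)) * emeasure lborel (boundary_layer D ((1/2) ^ k)) \<le>
      ennreal (2 powr ((real k + 1) * p)) * ennreal (C * (1/2) ^ k)"
      by (intro mult_left_mono em) auto
    also have "\<dots> = ennreal (2 powr ((real k + 1) * p) * (C * (1/2) ^ k))"
      using C by (intro ennreal_mult[symmetric]) auto
    also have "2 powr ((real k + 1) * p) * (C * (1/2) ^ k) = 2 powr p * C * (2 powr (p - 1)) ^ k"
    proof -
      have "(1/2::real) ^ k = 2 powr (- real k)"
        by (simp add: powr_minus powr_realpow power_one_over inverse_eq_divide)
      moreover have "(2 powr (p - 1)) ^ k = 2 powr ((p - 1) * real k)"
        by (simp add: powr_powr flip: powr_realpow)
      ultimately show ?thesis by (simp add: powr_add[symmetric] algebra_simps) 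
    qed
    finally show "ennreal (2 powr ((real k + 1) * p)) * emeasure lborel (boundary_layer D ((1/2) ^ k)) \<le>
      ennreal (2 powr p * C * (2 powr (p - 1)) ^ k)" .
  qed auto
  also have "(\<Sum>k. ennreal (2 powr p * C * (2 powr (p - 1)) ^ k)) = ennreal (\<Sum>k. 2 powr p * C * (2 powr (p - 1)) ^ k)"
  proof (rule suminf_ennreal2)
    have "(2::real) powr (p - 1) < 2 powr 0" using p by (intro powr_less_mono) auto
    then show "summable (\<lambda>k. 2 powr p * C * (2 powr (p - 1)) ^ k)"
      by (intro summable_mult summable_geometric) auto
  qed (use C in auto)
  finally have "(\<integral>\<^sup>+x\<in>D. ennreal (infdist x (- D) powr - p) \<partial>lborel) \<le> emeasure lborel D + ennreal (\<Sum>k. 2 powr p * C * (2 powr (p - 1)) ^ k)"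
    by (simp add: add_left_mono)
  also have "\<dots> < \<infinity>" using D(2) by simp
  finally show ?thesis .
qed

text \<open>Interpolation: \<open>min 1 y \<le> y powr (p / \<alpha>)\<close> because
  \<open>0 < p / \<alpha> \<le> 1\<close>. This weakens the possibly non-integrable power
  \<open>- \<alpha>\<close> of the distance to the integrable power \<open>- p\<close>, at the price
  of the exponent of \<open>t\<close>.\<close>

lemma boundary_layer_min_integral:
  fixes D :: "'a::euclidean_space set"
  assumes D: "open D" "emeasure lborel D < \<infinity>" and layer: "\<And>e. 0 < e \<Longrightarrow> measure lborel (boundary_layer D e) \<le> C * e"
    and p: "0 < p" "p < 1" "p \<le> \<alpha>"
  obtains C' where "0 \<le> C'" "\<And>t. 0 < t \<Longrightarrow> (\<integral>\<^sup>+x\<in>D. ennreal (min 1 (t * infdist x (- D) powr - \<alpha>)) \<partial>lborel)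
    \<le> ennreal (C' * t powr (p / \<alpha>))"
proof -
  define J where "J = (\<integral>\<^sup>+x\<in>D. ennreal (infdist x (- D) powr - p) \<partial>lborel)"
  have J: "J < \<infinity>" unfolding J_def using boundary_layer_integral[OF D layer p(1,2)] .
  have [measurable]: "D \<in> sets borel" using D by auto
  have [measurable]: "(\<lambda>x. infdist x (- D)) \<in> borel_measurable borel"
    by (intro borel_measurable_continuous_onI continuous_on_infdist continuous_on_id)
  show ?thesis
  proof (rule that[of "enn2real J"])
    fix t :: real assume t: "0 < t"
    have min_le: "min 1 y \<le> y powr (p / \<alpha>)" if "0 \<le> y" for y :: real
    proof (cases "y \<le> 1")
      case True
      have "p / \<alpha> \<le> 1" using p by simp
      then have "y powr 1 \<le> y powr (p / \<alpha>)" by (rule powr_mono'[OF _ that True])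
      then show ?thesis using that by simp
    next
      case False
      then have "1 \<le> y powr (p / \<alpha>)" using p by (intro ge_one_powr_ge_zero) auto
      then show ?thesis by simp
    qed
    have "(\<integral>\<^sup>+x\<in>D. ennreal (min 1 (t * infdist x (- D) powr - \<alpha>)) \<partial>lborel) \<le>
      (\<integral>\<^sup>+x. ennreal (t powr (p / \<alpha>)) * (ennreal (infdist x (- D) powr - p) * indicator D x) \<partial>lborel)"
    proof (intro nn_integral_mono)
      fix x
      have "min 1 (t * infdist x (- D) powr - \<alpha>) \<le> (t * infdist x (- D) powr - \<alpha>) powr (p / \<alpha>)"
        using t by (intro min_le) auto
      also have "\<dots> = t powr (p / \<alpha>) * infdist x (- D) powr - p"
        using t p by (simp add: powr_mult powr_powr)
      finally have "ennreal (min 1 (t * infdist x (- D) powr - \<alpha>)) \<le> ennreal (t powr (p / \<alpha>)) * ennreal (infdist x (- D) powr - p)"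
        by (simp add: ennreal_leI flip: ennreal_mult)
      then show "ennreal (min 1 (t * infdist x (- D) powr - \<alpha>)) * indicator D x \<le> ennreal (t powr (p / \<alpha>)) * (ennreal (infdist x (- D) powr - p) * indicator D x)"
        by (auto simp: indicator_def)
    qed
    also have "\<dots> = ennreal (t powr (p / \<alpha>)) * J"
      unfolding J_def by (intro nn_integral_cmult) measurable
    also have "\<dots> = ennreal (enn2real J * t powr (p / \<alpha>))"
      using J by (subst ennreal_mult) (auto simp: mult.commute)
    finally show "(\<integral>\<^sup>+x\<in>D. ennreal (min 1 (t * infdist x (- D) powr - \<alpha>)) \<partial>lborel) \<le> ennreal (enn2real J * t powr (p / \<alpha>))" .
  qed auto
qed

section \<open>Similitudes and Brownian scaling\<close>

lemma nn_integral_lborel_plus: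
  fixes f :: "'a::euclidean_space \<Rightarrow> ennreal"
  assumes [measurable]: "f \<in> borel_measurable borel"
  shows "(\<integral>\<^sup>+x. f (x + c) \<partial>lborel) = (\<integral>\<^sup>+x. f x \<partial>lborel)"
proof -
  have "(\<integral>\<^sup>+x. f x \<partial>lborel) = (\<integral>\<^sup>+x. f x \<partial>(distr lborel borel ((+) c)))" by (simp add: lborel_distr_plus)
  also have "\<dots> = (\<integral>\<^sup>+x. f (c + x) \<partial>lborel)" by (subst nn_integral_distr) auto
  finally show ?thesis by (simp add: add.commute)
qed

text \<open>The image of Lebesgue measure is again translation invariant, so by uniqueness of Haar measure
  it is a multiple of Lebesgue measure; the unit ball, which \<open>T\<close> preserves, shows that the factor is 1.\<close>

lemma lborel_orthogonal_transformation:
  fixes T :: "'a::euclidean_space \<Rightarrow> 'a"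
  assumes T: "orthogonal_transformation T"
  shows "distr lborel borel T = lborel"
proof (rule measure_eqI)
  have lin: "linear T" using T by (rule orthogonal_transformation_linear)
  have cont: "continuous_on UNIV T" using lin by (rule linear_continuous_on_compose[OF continuous_on_id])
  then have [measurable]: "T \<in> borel_measurable borel" by (rule borel_measurable_continuous_onI)
  obtain T' where T': "\<And>x. T (T' x) = x" "\<And>x. T' (T x) = x"
    using orthogonal_transformation_bij[OF T] by (metis bij_inv_eq_iff)
  fix A assume "A \<in> sets (distr lborel borel T)"
  then have A[measurable]: "A \<in> sets borel" by simp
  let ?B = "ball 0 1 :: 'a set"
  have B: "emeasure lborel (ball y 1) = emeasure lborel ?B" for y :: 'a
    using emeasure_ball[of 1 y] emeasure_ball[of 1 "0::'a"] by simp
  have [measurable]: "?B \<in> sets borel" by simp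
  have eT: "emeasure (distr lborel borel T) A = (\<integral>\<^sup>+x. indicator A (T x) \<partial>lborel)"
    using nn_integral_distr[of T lborel borel "indicator A"] by simp
  have "emeasure lborel ?B * emeasure (distr lborel borel T) A =
      (\<integral>\<^sup>+y. indicator ?B y * (\<integral>\<^sup>+x. indicator A (T x) \<partial>lborel) \<partial>lborel)"
    by (subst nn_integral_multc) (auto simp: eT intro!: borel_measurable_indicator)
  \<comment> \<open>Adding \<open>y\<close> after \<open>T\<close> is the same as adding
    \<open>T' y\<close> before it, so the inner integral is unaffected by \<open>y\<close>.\<close>
  also have "\<dots> = (\<integral>\<^sup>+y. indicator ?B y * (\<integral>\<^sup>+x. indicator A (T x + y) \<partial>lborel) \<partial>lborel)"
  proof (intro nn_integral_cong)
    fix y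
    have "(\<integral>\<^sup>+x. indicator A (T x) \<partial>lborel) = (\<integral>\<^sup>+x. indicator A (T (x + T' y)) \<partial>lborel)"
      by (subst nn_integral_lborel_plus[of "\<lambda>x. indicator A (T x)"]) auto
    then show "indicator ?B y * (\<integral>\<^sup>+x. indicator A (T x) \<partial>lborel) =
        indicator ?B y * (\<integral>\<^sup>+x. indicator A (T x + y) \<partial>lborel)"
      by (simp add: linear_add[OF lin] T')
  qed
  also have "\<dots> = (\<integral>\<^sup>+y. \<integral>\<^sup>+x. indicator ?B y * indicator A (T x + y) \<partial>lborel \<partial>lborel)"
    by (simp add: nn_integral_cmult)
  also have "\<dots> = (\<integral>\<^sup>+x. \<integral>\<^sup>+y. indicator ?B y * indicator A (T x + y) \<partial>lborel \<partial>lborel)"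
    by (rule lborel_pair.Fubini') measurable
  also have "\<dots> = (\<integral>\<^sup>+x. \<integral>\<^sup>+y. indicator (ball y 1) (T x) * indicator A y \<partial>lborel \<partial>lborel)"
  proof (rule nn_integral_cong)
    fix x
    have "(\<integral>\<^sup>+y. indicator ?B y * indicator A (T x + y) \<partial>lborel) =
        (\<integral>\<^sup>+y. indicator ?B (y + - T x) * indicator A (T x + (y + - T x)) \<partial>lborel)"
      by (subst nn_integral_lborel_plus[of "\<lambda>y. indicator ?B y * indicator A (T x + y)"]) auto
    also have "\<dots> = (\<integral>\<^sup>+y. indicator (ball y 1) (T x) * indicator A y \<partial>lborel)"
      by (intro nn_integral_cong) (auto simp: indicator_def dist_norm norm_minus_commute)
    finally show "(\<integral>\<^sup>+y. indicator ?B y * indicator A (T x + y) \<partial>lborel) =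
        (\<integral>\<^sup>+y. indicator (ball y 1) (T x) * indicator A y \<partial>lborel)" .
  qed
  also have "\<dots> = (\<integral>\<^sup>+y. \<integral>\<^sup>+x. indicator (ball y 1) (T x) * indicator A y \<partial>lborel \<partial>lborel)"
    by (rule lborel_pair.Fubini'[symmetric]) (simp add: indicator_def[abs_def] mem_ball, measurable)
  also have "\<dots> = (\<integral>\<^sup>+y. emeasure lborel ?B * indicator A y \<partial>lborel)"
  proof (intro nn_integral_cong)
    fix y
    have "(\<integral>\<^sup>+x. indicator (ball y 1) (T x) * indicator A y \<partial>lborel) =
        (\<integral>\<^sup>+x. indicator (ball (T' y) 1) x * indicator A y \<partial>lborel)"
    proof (intro nn_integral_cong)
      fix x
      have "dist y (T x) = dist (T' y) x"
        using T unfolding orthogonal_transformation_isometry by (metis T'(1))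
      then show "indicator (ball y 1) (T x) * indicator A y = (indicator (ball (T' y) 1) x * indicator A y :: ennreal)"
        by (simp add: indicator_def)
    qed
    also have "\<dots> = emeasure lborel ?B * indicator A y"
      by (subst nn_integral_multc) (auto simp: B[of "T' y"] intro!: borel_measurable_indicator)
    finally show "(\<integral>\<^sup>+x. indicator (ball y 1) (T x) * indicator A y \<partial>lborel) = emeasure lborel ?B * indicator A y" .
  qed
  also have "\<dots> = emeasure lborel ?B * emeasure lborel A" by (simp add: nn_integral_cmult)
  finally have *: "emeasure lborel ?B * emeasure (distr lborel borel T) A = emeasure lborel ?B * emeasure lborel A" .
  have "emeasure lborel ?B \<noteq> 0" "emeasure lborel ?B \<noteq> \<infinity>"
    using emeasure_ball[of 1 "0::'a"] emeasure_lborel_ball_finite[of "0::'a" 1] unit_ball_vol_pos[of "real DIM('a)"]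
    by (auto simp: ennreal_eq_0_iff not_le)
  then show "emeasure (distr lborel borel T) A = emeasure lborel A"
    using * by (simp add: ennreal_mult_cancel_left)
qed simp

text \<open>After subtracting \<open>R 0\<close> and dividing by \<open>r\<close>, an isometry
  fixing the origin remains, and such an isometry of a Euclidean space is linear and
  orthogonal.\<close>

lemma similitudeE:
  fixes R :: "'a::euclidean_space \<Rightarrow> 'a"
  assumes "similitude R r"
  obtains T where "orthogonal_transformation T" "0 < r" "\<And>x. R x = R 0 + r *\<^sub>R T x"
proof (rule that[of "\<lambda>x. (R x - R 0) /\<^sub>R r"])
  show r: "0 < r" using assms by (simp add: similitude_def)
  have "dist ((R x - R 0) /\<^sub>R r) ((R y - R 0) /\<^sub>R r) = dist x y" for x y
  proof -
    have "(R x - R 0) /\<^sub>R r - (R y - R 0) /\<^sub>R r = (R x - R y) /\<^sub>R r" by (simp flip: scaleR_diff_right)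
    then show ?thesis using assms r by (simp add: dist_norm similitude_def)
  qed
  then show "orthogonal_transformation (\<lambda>x. (R x - R 0) /\<^sub>R r)"
    by (simp add: orthogonal_transformation_isometry)
qed (use assms in \<open>auto simp: similitude_def\<close>)

lemma similitude_continuous:
  fixes R :: "'a::euclidean_space \<Rightarrow> 'a"
  assumes "similitude R r"
  shows "continuous_on S R"
proof -
  obtain T where T: "orthogonal_transformation T" "\<And>x. R x = R 0 + r *\<^sub>R T x"
    using similitudeE[OF assms] by metis
  have "continuous_on S T"
    using orthogonal_transformation_linear[OF T(1)] by (rule linear_continuous_on_compose[OF continuous_on_id])
  then have "continuous_on S (\<lambda>x. R 0 + r *\<^sub>R T x)" by (intro continuous_intros)
  then show ?thesis by (rule continuous_on_eq) (simp only: T(2)[symmetric])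
qed

lemma similitude_inverse:
  fixes R :: "'a::euclidean_space \<Rightarrow> 'a"
  assumes "similitude R r"
  obtains R' where "similitude R' (1 / r)" "\<And>x. R (R' x) = x" "\<And>x. R' (R x) = x"
proof -
  obtain T where T: "orthogonal_transformation T" "0 < r" "\<And>x. R x = R 0 + r *\<^sub>R T x"
    using similitudeE[OF assms] by metis
  have surj: "\<exists>x. R x = y" for y
  proof -
    obtain x where x: "T x = (y - R 0) /\<^sub>R r" using orthogonal_transformation_surj[OF T(1)] by (metis surjD)
    have "R x = y" unfolding T(3)[of x] x using T(2) by simp
    then show ?thesis by blast
  qed
  have inj: "R x = R y \<Longrightarrow> x = y" for x y
    using assms T(2) unfolding similitude_def by (metis mult_eq_0_iff norm_eq_zero right_minus_eq less_irrefl)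
  obtain R' where R': "\<And>y. R (R' y) = y" using surj by metis
  have "norm (R' x - R' y) = 1 / r * norm (x - y)" for x y
    using assms T(2) R' unfolding similitude_def
    by (metis (no_types) mult.commute nonzero_mult_div_cancel_left times_divide_eq_right mult_1 less_irrefl)
  then have "similitude R' (1 / r)" using T(2) by (simp add: similitude_def)
  then show ?thesis using that R' inj by blast
qed

lemma similitude_image_open:
  fixes R :: "'a::euclidean_space \<Rightarrow> 'a"
  assumes R: "similitude R r" and D: "open D"
  shows "open (R ` D)"
proof -
  obtain R' where R': "similitude R' (1 / r)" "\<And>x. R (R' x) = x" "\<And>x. R' (R x) = x"
    using similitude_inverse[OF R] by metis
  have "R ` D = R' -` D" using R'(2,3) by (auto simp: image_iff) metis
  moreover have "open (R' -` D)" using similitude_continuous[OF R'(1), of UNIV] D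
    by (simp add: continuous_on_open_vimage)
  ultimately show ?thesis by simp
qed

lemma nn_integral_similitude:
  fixes R :: "'a::euclidean_space \<Rightarrow> 'a"
  assumes R: "similitude R r" and [measurable]: "f \<in> borel_measurable borel"
  shows "(\<integral>\<^sup>+x. f x \<partial>lborel) = ennreal (r ^ DIM('a)) * (\<integral>\<^sup>+x. f (R x) \<partial>lborel)"
proof -
  obtain T where T: "orthogonal_transformation T" "0 < r" "\<And>x. R x = R 0 + r *\<^sub>R T x"
    using similitudeE[OF R] by metis
  have cont: "continuous_on UNIV T"
    using orthogonal_transformation_linear[OF T(1)] by (rule linear_continuous_on_compose[OF continuous_on_id])
  then have [measurable]: "T \<in> borel_measurable borel" by (rule borel_measurable_continuous_onI)
  have "(\<integral>\<^sup>+x. f x \<partial>lborel) = (\<integral>\<^sup>+x. f x \<partial>(density (distr lborel borel (\<lambda>x. R 0 + r *\<^sub>R x)) (\<lambda>_. \<bar>r\<bar>^DIM('a))))"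
    using T(2) by (subst lborel_affine[of r "R 0", symmetric]) auto
  also have "\<dots> = ennreal (r ^ DIM('a)) * (\<integral>\<^sup>+x. f (R 0 + r *\<^sub>R x) \<partial>lborel)"
    using T(2) by (simp add: nn_integral_density nn_integral_distr nn_integral_cmult)
  also have "(\<integral>\<^sup>+x. f (R 0 + r *\<^sub>R x) \<partial>lborel) = (\<integral>\<^sup>+x. f (R 0 + r *\<^sub>R x) \<partial>(distr lborel borel T))"
    by (simp add: lborel_orthogonal_transformation[OF T(1)])
  also have "\<dots> = (\<integral>\<^sup>+x. f (R x) \<partial>lborel)"
    by (subst nn_integral_distr) (auto simp only: T(3)[symmetric] borel_measurable_const measurable_lborel1, measurable)
  finally show ?thesis .
qed

lemma emeasure_similitude_image:
  fixes R :: "'a::euclidean_space \<Rightarrow> 'a"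
  assumes R: "similitude R r" and A: "open A"
  shows "emeasure lborel (R ` A) = ennreal (r ^ DIM('a)) * emeasure lborel A"
proof -
  have [measurable]: "R ` A \<in> sets borel" "A \<in> sets borel" using similitude_image_open[OF R A] A by auto
  have inj: "R x = R y \<Longrightarrow> x = y" for x y using similitude_inverse[OF R] by metis
  have "emeasure lborel (R ` A) = (\<integral>\<^sup>+x. indicator (R ` A) x \<partial>lborel)" by simp
  also have "\<dots> = ennreal (r ^ DIM('a)) * (\<integral>\<^sup>+x. indicator (R ` A) (R x) \<partial>lborel)"
    by (rule nn_integral_similitude[OF R]) measurable
  also have "(\<integral>\<^sup>+x. indicator (R ` A) (R x) \<partial>lborel) = (\<integral>\<^sup>+x. indicator A x \<partial>lborel)"
    using inj by (intro nn_integral_cong) (auto simp: indicator_def)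
  finally show ?thesis by simp
qed

text \<open>Space scaling by \<open>r\<close> multiplies variances by \<open>r\<^sup>2\<close>,
  which the time change cancels; the orthogonal part leaves the isotropic Gaussian alone.\<close>

lemma brownian_motion_scale:
  fixes W :: "real \<Rightarrow> 'w \<Rightarrow> 'a::euclidean_space" and U :: "'a \<Rightarrow> 'a"
  assumes W: "brownian_motion M W" and U: "orthogonal_transformation U" and r: "0 < r"
  shows "brownian_motion M (\<lambda>t \<omega>. r *\<^sub>R U (W (t / r\<^sup>2) \<omega>))"
proof -
  define R where "R x = r *\<^sub>R U x" for x
  have lin: "linear U" using U by (rule orthogonal_transformation_linear)
  have R0: "R 0 = 0" using linear_0[OF lin] by (simp add: R_def)
  have Rdiff: "R (x - y) = R x - R y" for x y using linear_diff[OF lin] by (simp add: R_def scaleR_diff_right)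
  have Rnorm: "norm (R x) = r * norm x" for x
    using r orthogonal_transformation_norm[OF U] by (simp add: R_def)
  have R: "similitude R r" using r Rnorm by (simp add: similitude_def flip: Rdiff)
  have cont: "continuous_on UNIV R" by (rule similitude_continuous[OF R])
  then have [measurable]: "R \<in> borel_measurable borel" by (rule borel_measurable_continuous_onI)
  interpret prob_space M using W by (simp add: brownian_motion_def)
  have Wm: "W t \<in> borel_measurable M" if "0 \<le> t" for t using W that by (simp add: brownian_motion_def)
  have t': "0 \<le> t / r\<^sup>2" if "0 \<le> t" for t using that by simp
  have "brownian_motion M (\<lambda>t \<omega>. R (W (t / r\<^sup>2) \<omega>))"
    unfolding brownian_motion_def
  proof (intro conjI allI impI ballI)
    show "prob_space M" by unfold_locales
    show "(\<lambda>\<omega>. R (W (t / r\<^sup>2) \<omega>)) \<in> borel_measurable M" if "0 \<le> t" for t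
      using Wm[OF t'[OF that]] by measurable
    have "AE \<omega> in M. W 0 \<omega> = 0" using W by (simp add: brownian_motion_def)
    then show "AE \<omega> in M. R (W (0 / r\<^sup>2) \<omega>) = 0" by (auto simp: R0)
    show "indep_increments M (\<lambda>t \<omega>. R (W (t / r\<^sup>2) \<omega>))"
      unfolding indep_increments_def
    proof (intro allI impI)
      fix t :: "nat \<Rightarrow> real" and n assume t: "0 \<le> t 0 \<and> incseq t"
      have inc: "indep_increments M W" using W by (simp add: brownian_motion_def)
      have "0 \<le> t 0 / r\<^sup>2 \<and> incseq (\<lambda>i. t i / r\<^sup>2)"
        using t by (auto simp: incseq_def divide_right_mono)
      with inc have "indep_vars (\<lambda>_. borel) (\<lambda>i \<omega>. W (t (Suc i) / r\<^sup>2) \<omega> - W (t i / r\<^sup>2) \<omega>) {..<n}"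
        unfolding indep_increments_def by (elim allE[of _ "\<lambda>i. t i / r\<^sup>2"]) auto
      from indep_vars_compose2[OF this, of "\<lambda>_. R" "\<lambda>_. borel"]
      show "indep_vars (\<lambda>_. borel) (\<lambda>i \<omega>. R (W (t (Suc i) / r\<^sup>2) \<omega>) - R (W (t i / r\<^sup>2) \<omega>)) {..<n}"
        by (simp add: Rdiff)
    qed
    show "continuous_on {0..} (\<lambda>t. R (W (t / r\<^sup>2) \<omega>))" if "\<omega> \<in> space M" for \<omega>
    proof -
      have "continuous_on {0..} (\<lambda>t. W t \<omega>)" using W that by (simp add: brownian_motion_def)
      then have "continuous_on {0..} (\<lambda>t. W (t / r\<^sup>2) \<omega>)"
        by (rule continuous_on_compose2) (use r in \<open>auto intro!: continuous_intros\<close>)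
      from continuous_on_compose2[OF cont this] show ?thesis by auto
    qed
    fix s t :: real assume st: "0 \<le> s \<and> s < t"
    define h where "h = t - s"
    define p where "p h y = exp (- (norm y)\<^sup>2 / (2 * h)) / (2 * pi * h) powr (real DIM('a) / 2)" for h and y :: 'a
    have h: "0 < h" using st by (simp add: h_def)
    have [measurable]: "p h \<in> borel_measurable borel" for h unfolding p_def by measurable
    have s't': "0 \<le> s / r\<^sup>2" "s / r\<^sup>2 < t / r\<^sup>2" using st r by (auto simp: divide_strict_right_mono)
    have "distributed M lborel (\<lambda>\<omega>. W t \<omega> - W s \<omega>) (\<lambda>y. ennreal (p (t - s) y))"
      if "0 \<le> s" "s < t" for s t
      using W that unfolding brownian_motion_def p_def by blast
    from this[OF s't']
    have D: "distributed M lborel (\<lambda>\<omega>. W (t / r\<^sup>2) \<omega> - W (s / r\<^sup>2) \<omega>) (\<lambda>y. ennreal (p (h / r\<^sup>2) y))"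
      unfolding h_def diff_divide_distrib .
    define X where "X \<omega> = W (t / r\<^sup>2) \<omega> - W (s / r\<^sup>2) \<omega>" for \<omega>
    have D': "distributed M lborel X (\<lambda>y. ennreal (p (h / r\<^sup>2) y))" using D unfolding X_def .
    have [measurable]: "X \<in> borel_measurable M" using distributed_measurable[OF D'] by simp
    \<comment> \<open>The factor from the normalizing constant is the Jacobian of \<open>R\<close>,
      so the change of variables below leaves the density \<open>p h\<close>.\<close>
    have scale: "p (h / r\<^sup>2) x = r ^ DIM('a) * p h (R x)" for x
    proof -
      have "(2 * pi * (h / r\<^sup>2)) powr (real DIM('a) / 2) = (2 * pi * h) powr (real DIM('a) / 2) / (r\<^sup>2) powr (real DIM('a) / 2)"
        using h r by (simp add: powr_divide)
      also have "(r\<^sup>2) powr (real DIM('a) / 2) = r ^ DIM('a)"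
        using r by (simp add: powr_powr flip: powr_realpow powr_numeral)
      finally have 1: "(2 * pi * (h / r\<^sup>2)) powr (real DIM('a) / 2) = (2 * pi * h) powr (real DIM('a) / 2) / r ^ DIM('a)" .
      have 2: "- (norm x)\<^sup>2 / (2 * (h / r\<^sup>2)) = - (norm (R x))\<^sup>2 / (2 * h)"
        using r h by (simp add: Rnorm power_mult_distrib field_simps)
      show ?thesis unfolding p_def 1 2 by simp
    qed
    have "0 \<le> p h y" for y by (simp add: p_def)
    then have scale': "ennreal (p (h / r\<^sup>2) x) = ennreal (r ^ DIM('a)) * ennreal (p h (R x))" for x
      unfolding scale using r by (intro ennreal_mult) auto
    have "distr M lborel (\<lambda>\<omega>. R (X \<omega>)) = density lborel (\<lambda>y. ennreal (p h y))"
    proof (rule measure_eqI)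
      fix A assume "A \<in> sets (distr M lborel (\<lambda>\<omega>. R (X \<omega>)))"
      then have [measurable]: "A \<in> sets borel" by simp
      have "emeasure (distr M lborel (\<lambda>\<omega>. R (X \<omega>))) A = emeasure (distr M lborel X) (R -` A)"
        by (simp add: emeasure_distr vimage_def Int_def measurable_sets_borel[of R borel A, unfolded vimage_def])
      also have "\<dots> = (\<integral>\<^sup>+x. ennreal (p (h / r\<^sup>2) x) * indicator (R -` A) x \<partial>lborel)"
        using measurable_sets_borel[of R borel A]
        by (simp add: distributed_distr_eq_density[OF D'] emeasure_density)
      also have "\<dots> = (\<integral>\<^sup>+x. ennreal (r ^ DIM('a)) * (ennreal (p h (R x)) * indicator A (R x)) \<partial>lborel)"
        by (intro nn_integral_cong) (auto simp: scale' indicator_def)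
      also have "\<dots> = ennreal (r ^ DIM('a)) * (\<integral>\<^sup>+x. ennreal (p h (R x)) * indicator A (R x) \<partial>lborel)"
        by (rule nn_integral_cmult) measurable
      also have "\<dots> = (\<integral>\<^sup>+x. ennreal (p h x) * indicator A x \<partial>lborel)"
        by (rule nn_integral_similitude[OF R, symmetric]) measurable
      also have "\<dots> = emeasure (density lborel (\<lambda>y. ennreal (p h y))) A"
        by (simp add: emeasure_density)
      finally show "emeasure (distr M lborel (\<lambda>\<omega>. R (X \<omega>))) A = emeasure (density lborel (\<lambda>y. ennreal (p h y))) A" .
    qed simp
    then have "distributed M lborel (\<lambda>\<omega>. R (X \<omega>)) (\<lambda>y. ennreal (p h y))"
      unfolding distributed_def by simp
    then show "distributed M lborel (\<lambda>\<omega>. R (W (t / r\<^sup>2) \<omega>) - R (W (s / r\<^sup>2) \<omega>))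
          (\<lambda>y. ennreal (exp (- (norm y)\<^sup>2 / (2 * (t - s))) / (2 * pi * (t - s)) powr (real DIM('a) / 2)))"
      by (simp add: X_def Rdiff p_def h_def)
  qed
  then show ?thesis by (simp add: R_def)
qed

section \<open>Exit times\<close>

text \<open>Dyadic subdivision, so that each level refines the preceding one and events at grid
  times are monotone in the level \<open>k\<close>.\<close>

definition grid :: "real \<Rightarrow> real \<Rightarrow> nat \<Rightarrow> nat \<Rightarrow> real" where
  "grid u v k i = u + (v - u) * (real i / 2 ^ k)"

lemma grid_bounds:
  assumes "u \<le> v" "i \<le> 2 ^ k"
  shows "u \<le> grid u v k i" "grid u v k i \<le> v"
proof -
  have "real i / 2 ^ k \<le> 1" using assms(2) by (simp add: field_simps of_nat_le_iff[of i "2 ^ k", symmetric, simplified])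
  then have "(v - u) * (real i / 2 ^ k) \<le> (v - u) * 1" using assms(1) by (intro mult_left_mono) auto
  then show "grid u v k i \<le> v" by (simp add: grid_def)
  show "u \<le> grid u v k i" using assms by (simp add: grid_def)
qed

lemma grid_Suc: "grid u v (Suc k) (2 * i) = grid u v k i"
  by (simp add: grid_def)

lemma grid_dense:
  assumes s: "u \<le> s" "s \<le> v"
  obtains i where "\<And>k. i k \<le> 2 ^ k" "(\<lambda>k. grid u v k (i k)) \<longlonglongrightarrow> s"
proof -
  obtain \<theta> where \<theta>: "0 \<le> \<theta>" "\<theta> \<le> 1" "s = u + (v - u) * \<theta>"
  proof (cases "u = v")
    case True
    then show ?thesis using that[of 0] s by auto
  next
    case False
    then show ?thesis using that[of "(s - u) / (v - u)"] s by (auto simp: field_simps)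
  qed
  define i where "i k = nat \<lfloor>2 ^ k * \<theta>\<rfloor>" for k :: nat
  have i: "real (i k) \<le> 2 ^ k * \<theta>" "2 ^ k * \<theta> < real (i k) + 1" for k
  proof -
    have "0 \<le> 2 ^ k * \<theta>" using \<theta> by simp
    then have "real (i k) = of_int \<lfloor>2 ^ k * \<theta>\<rfloor>" unfolding i_def by simp
    then show "real (i k) \<le> 2 ^ k * \<theta>" "2 ^ k * \<theta> < real (i k) + 1" by linarith+
  qed
  have le: "i k \<le> 2 ^ k" for k
  proof -
    have "2 ^ k * \<theta> \<le> 2 ^ k * (1::real)" using \<theta> by (intro mult_left_mono) auto
    then have "real (i k) \<le> 2 ^ k" using i(1)[of k] by linarith
    then show ?thesis by simp
  qed
  have "(\<lambda>k. real (i k) / 2 ^ k) \<longlonglongrightarrow> \<theta>"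
  proof (rule tendsto_sandwich[of "\<lambda>k. \<theta> - (1/2) ^ k" _ _ "\<lambda>k. \<theta>"])
    show "(\<lambda>k. \<theta> - (1/2::real) ^ k) \<longlonglongrightarrow> \<theta>" by real_asymp
    show "\<forall>\<^sub>F k in sequentially. \<theta> - (1/2) ^ k \<le> real (i k) / 2 ^ k"
    proof (intro always_eventually allI)
      fix k show "\<theta> - (1/2) ^ k \<le> real (i k) / 2 ^ k"
        using divide_right_mono[of "2 ^ k * \<theta> - 1" "real (i k)" "2 ^ k"] i(2)[of k]
        by (simp add: diff_divide_distrib power_one_over)
    qed
    show "\<forall>\<^sub>F k in sequentially. real (i k) / 2 ^ k \<le> \<theta>"
      using i(1) by (intro always_eventually allI) (simp add: field_simps)
  qed auto
  then have "(\<lambda>k. grid u v k (i k)) \<longlonglongrightarrow> u + (v - u) * \<theta>"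
    unfolding grid_def by (intro tendsto_intros)
  then show ?thesis using le \<theta>(3) that by metis
qed

text \<open>On a compact time interval a path inside \<open>D\<close> keeps a positive distance from
  the complement; conversely a uniform gap at dyadic times passes to all times by continuity. An
  uncountable condition thus becomes a countable one. The complement is nonempty here, which matters
  since \<open>infdist\<close> to the empty set is 0.\<close>

lemma path_in_open_iff_grid:
  fixes w :: "real \<Rightarrow> 'a::euclidean_space"
  assumes w: "continuous_on {0..} w" and D: "open D" "D \<noteq> UNIV" and uv: "0 \<le> u" "u \<le> v"
  shows "(\<forall>s\<in>{u..v}. w s \<in> D) \<longleftrightarrow>
    (\<exists>m::nat. \<forall>k. \<forall>i\<le>2^k. 1 / real (Suc m) \<le> infdist (w (grid u v k i)) (- D))"
proof
  have ne: "- D \<noteq> {}" using D by auto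
  assume *: "\<forall>s\<in>{u..v}. w s \<in> D"
  have "continuous_on {u..v} (\<lambda>s. infdist (w s) (- D))"
    by (intro continuous_on_infdist continuous_on_subset[OF w]) (use uv in auto)
  then obtain s0 where s0: "s0 \<in> {u..v}" "\<And>s. s \<in> {u..v} \<Longrightarrow> infdist (w s0) (- D) \<le> infdist (w s) (- D)"
    using continuous_attains_inf[of "{u..v}" "\<lambda>s. infdist (w s) (- D)"] uv by auto
  have "0 < infdist (w s0) (- D)"
    using * s0(1) D ne by (metis ComplD closed_Compl infdist_pos_not_in_closed)
  then obtain m where m: "1 / real (Suc m) < infdist (w s0) (- D)"
    using reals_Archimedean by (metis inverse_eq_divide)
  have "1 / real (Suc m) \<le> infdist (w (grid u v k i)) (- D)" if "i \<le> 2 ^ k" for k i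
    using s0(2)[of "grid u v k i"] grid_bounds[OF uv(2) that] m by auto
  then show "\<exists>m::nat. \<forall>k. \<forall>i\<le>2^k. 1 / real (Suc m) \<le> infdist (w (grid u v k i)) (- D)" by blast
next
  assume "\<exists>m::nat. \<forall>k. \<forall>i\<le>2^k. 1 / real (Suc m) \<le> infdist (w (grid u v k i)) (- D)"
  then obtain m where m: "\<And>k i. i \<le> 2^k \<Longrightarrow> 1 / real (Suc m) \<le> infdist (w (grid u v k i)) (- D)" by blast
  show "\<forall>s\<in>{u..v}. w s \<in> D"
  proof
    fix s assume "s \<in> {u..v}"
    then have s: "u \<le> s" "s \<le> v" by auto
    obtain i where i: "\<And>k. i k \<le> 2 ^ k" "(\<lambda>k. grid u v k (i k)) \<longlonglongrightarrow> s" using grid_dense[OF s] by blast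
    have "(\<lambda>k. w (grid u v k (i k))) \<longlonglongrightarrow> w s"
    proof (rule continuous_on_tendsto_compose[OF w i(2)])
      show "s \<in> {0..}" using s uv by simp
      show "\<forall>\<^sub>F k in sequentially. grid u v k (i k) \<in> {0..}"
    proof (intro always_eventually allI)
      fix k show "grid u v k (i k) \<in> {0..}" using grid_bounds(1)[OF uv(2) i(1)[of k]] uv by simp
    qed
    qed
    then have "(\<lambda>k. infdist (w (grid u v k (i k))) (- D)) \<longlonglongrightarrow> infdist (w s) (- D)"
      by (rule tendsto_infdist)
    then have "1 / real (Suc m) \<le> infdist (w s) (- D)"
      by (rule tendsto_lowerbound) (use m i in auto)
    moreover have "0 < 1 / real (Suc m)" by simp
    ultimately have "0 < infdist (w s) (- D)" by linarith
    then show "w s \<in> D" by (metis ComplI infdist_zero less_irrefl)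
  qed
qed

lemma exit_time_nonneg: "0 \<le> exit_time D w"
  unfolding exit_time_def by (intro Inf_greatest) (auto intro: less_imp_le)

text \<open>A rational time strictly beyond \<open>s\<close> makes the event a countable union.
  Negative \<open>s\<close> is separate because exit times are never negative.\<close>

lemma exit_time_gt_iff:
  "exit_time D w > ereal s \<longleftrightarrow> s < 0 \<or> (\<exists>q\<in>\<rat>. 0 < q \<and> s < q \<and> (\<forall>t\<in>{0<..<q}. w t \<in> D))"
proof (cases "s < 0")
  case True
  then have "ereal s < 0" by simp
  also have "0 \<le> exit_time D w" by (rule exit_time_nonneg)
  finally show ?thesis using True by blast
next
  case False
  show ?thesis
  proof
    assume "exit_time D w > ereal s"
    then obtain x where x: "ereal s < x" "x < exit_time D w" using dense by blast
    obtain r where r: "x = ereal r"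
    proof (cases x)
      case PInf then show ?thesis using x by simp
    next
      case MInf then show ?thesis using x by simp
    qed (use that in blast)
    obtain q where q: "q \<in> \<rat>" "s < q" "q < r" using Rats_dense_in_real[of s r] x r by auto
    have "w t \<in> D" if "t \<in> {0<..<q}" for t
    proof (rule ccontr)
      assume "w t \<notin> D"
      then have "exit_time D w \<le> ereal t" unfolding exit_time_def using that by (intro Inf_lower) auto
      then have "ereal r < ereal t" using x r by (metis order_less_le_trans)
      then show False using that q by simp
    qed
    then show "s < 0 \<or> (\<exists>q\<in>\<rat>. 0 < q \<and> s < q \<and> (\<forall>t\<in>{0<..<q}. w t \<in> D))"
      using q False by (intro disjI2 bexI[of _ q]) auto
  next
    assume "s < 0 \<or> (\<exists>q\<in>\<rat>. 0 < q \<and> s < q \<and> (\<forall>t\<in>{0<..<q}. w t \<in> D))"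
    then obtain q where q: "s < q" "\<And>t. 0 < t \<Longrightarrow> t < q \<Longrightarrow> w t \<in> D" using False by auto
    have "ereal q \<le> exit_time D w"
      unfolding exit_time_def using q(2) by (intro Inf_greatest) (auto, metis not_le)
    then show "exit_time D w > ereal s" using q(1) by (metis less_ereal.simps(1) order_less_le_trans)
  qed
qed

text \<open>As \<open>D\<close> is open, a continuous path that is in \<open>D\<close> at time
  \<open>s\<close> remains there a little longer. The exit time looks only at positive times, so
  time 0 is covered by the assumption on the start.\<close>

lemma exit_time_gt_iff_path:
  fixes w :: "real \<Rightarrow> 'a::euclidean_space"
  assumes w: "continuous_on {0..} w" and D: "open D" and w0: "w 0 \<in> D" and s: "0 \<le> s"
  shows "exit_time D w > ereal s \<longleftrightarrow> (\<forall>t\<in>{0..s}. w t \<in> D)"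
proof
  assume "exit_time D w > ereal s"
  then obtain q where "s < q" "\<forall>t\<in>{0<..<q}. w t \<in> D" using s unfolding exit_time_gt_iff by auto
  then show "\<forall>t\<in>{0..s}. w t \<in> D" using w0 by (metis atLeastAtMost_iff greaterThanLessThan_iff order_le_less order_le_less_trans)
next
  assume *: "\<forall>t\<in>{0..s}. w t \<in> D"
  obtain A where A: "open A" "A \<inter> {0..} = w -` D \<inter> {0..}"
    using w D unfolding continuous_on_open_invariant by blast
  have "s \<in> A" using A(2) * s by auto
  then obtain e where e: "0 < e" "ball s e \<subseteq> A" using A(1) open_contains_ball by blast
  obtain q where q: "q \<in> \<rat>" "s < q" "q < s + e" using Rats_dense_in_real[of s "s + e"] e by auto
  have "w t \<in> D" if "t \<in> {0<..<q}" for t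
  proof (cases "t \<le> s")
    case True
    then show ?thesis using * that by auto
  next
    case False
    then have "t \<in> ball s e" using that q by (auto simp: dist_real_def)
    then have "t \<in> A \<inter> {0..}" using e(2) that by auto
    then show ?thesis unfolding A(2) by simp
  qed
  then show "exit_time D w > ereal s"
    unfolding exit_time_gt_iff using q s by (intro disjI2 bexI[of _ q]) auto
qed

text \<open>\<open>F\<close> is instantiated both with the underlying probability space and with the
  sigma-algebra generated by the process.\<close>

locale continuous_process =
  fixes F :: "'w measure" and W :: "real \<Rightarrow> 'w \<Rightarrow> 'a::euclidean_space"
  assumes W_meas: "\<And>t. 0 \<le> t \<Longrightarrow> W t \<in> borel_measurable F"
    and W_cont: "\<And>\<omega>. \<omega> \<in> space F \<Longrightarrow> continuous_on {0..} (\<lambda>t. W t \<omega>)"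
begin

lemma shifted_cont: "\<omega> \<in> space F \<Longrightarrow> continuous_on {0..} (\<lambda>t. x + W t \<omega>)"
  using W_cont by (intro continuous_intros) auto

text \<open>Measurability is joint in the starting point and \<open>\<omega>\<close>, since the heat
  content integrates probabilities over starting points.\<close>

lemma stay_sets:
  assumes D: "open D" "D \<noteq> UNIV" and uv: "0 \<le> u" "u \<le> v"
  shows "{z \<in> space (borel \<Otimes>\<^sub>M F). \<forall>s\<in>{u..v}. fst z + W s (snd z) \<in> D} \<in> sets (borel \<Otimes>\<^sub>M F)"
proof -
  have g: "0 \<le> grid u v k i" if "i \<le> 2 ^ k" for k i
    using grid_bounds(1)[OF uv(2) that] uv by simp
  have [measurable]: "(\<lambda>x. infdist x (- D)) \<in> borel_measurable borel"
    by (intro borel_measurable_continuous_onI continuous_on_infdist continuous_on_id)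
  have m: "{z \<in> space (borel \<Otimes>\<^sub>M F). 1 / real (Suc m) \<le> infdist (fst z + W (grid u v k i) (snd z)) (- D)}
      \<in> sets (borel \<Otimes>\<^sub>M F)" if "i \<in> {..2 ^ k}" for m k i
  proof -
    have [measurable]: "W (grid u v k i) \<in> borel_measurable F" using W_meas g that by simp
    show ?thesis by measurable
  qed
  have "{z \<in> space (borel \<Otimes>\<^sub>M F). \<forall>s\<in>{u..v}. fst z + W s (snd z) \<in> D} =
    {z \<in> space (borel \<Otimes>\<^sub>M F). \<exists>m::nat. \<forall>k. \<forall>i\<in>{..2^k}. 1 / real (Suc m) \<le> infdist (fst z + W (grid u v k i) (snd z)) (- D)}"
    by (intro Collect_cong conj_cong refl, subst path_in_open_iff_grid)
       (auto simp: D uv space_pair_measure intro!: shifted_cont)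
  also have "\<dots> \<in> sets (borel \<Otimes>\<^sub>M F)"
    using m by (intro sets.sets_Collect_countable_Ex sets.sets_Collect_countable_All sets.sets_Collect_finite_All) auto
  finally show ?thesis .
qed

lemma exit_time_measurable:
  assumes D: "open D" "D \<noteq> UNIV"
  shows "(\<lambda>z. exit_time D (\<lambda>t. fst z + W t (snd z))) \<in> borel_measurable (borel \<Otimes>\<^sub>M F)"
proof -
  have open_stay: "{z \<in> space (borel \<Otimes>\<^sub>M F). \<forall>t\<in>{0<..<q}. fst z + W t (snd z) \<in> D} \<in> sets (borel \<Otimes>\<^sub>M F)"
    if q: "0 < q" for q
  proof -
    \<comment> \<open>Closed intervals exhausting the open interval from 0 to \<open>q\<close>; the
      offset 2 keeps their end points in order already for \<open>n = 0\<close>.\<close>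
    have q1: "0 \<le> q / real (n + 2)" "q / real (n + 2) \<le> q - q / real (n + 2)" for n
    proof -
      show "0 \<le> q / real (n + 2)" using q by simp
      have "q * 2 \<le> q * real (n + 2)" using q by (intro mult_left_mono) auto
      then show "q / real (n + 2) \<le> q - q / real (n + 2)" using q by (simp add: field_simps)
    qed
    have ex: "\<exists>n. t \<in> {q / real (n + 2)..q - q / real (n + 2)}" if t: "t \<in> {0<..<q}" for t
    proof -
      have "(\<lambda>n. q / real (n + 2)) \<longlonglongrightarrow> 0" by real_asymp
      then have "eventually (\<lambda>n. q / real (n + 2) < min t (q - t)) sequentially"
        by (rule order_tendstoD) (use t in auto)
      then obtain n where "q / real (n + 2) < min t (q - t)" by (auto simp: eventually_sequentially)
      then show ?thesis by (intro exI[of _ n]) auto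
    qed
    have sub: "{q / real (n + 2)..q - q / real (n + 2)} \<subseteq> {0<..<q}" for n
    proof -
      have "0 < q / real (n + 2)" using q by simp
      then show ?thesis by auto
    qed
    have "{z \<in> space (borel \<Otimes>\<^sub>M F). \<forall>t\<in>{0<..<q}. fst z + W t (snd z) \<in> D} =
      {z \<in> space (borel \<Otimes>\<^sub>M F). \<forall>n. \<forall>t\<in>{q / real (n + 2)..q - q / real (n + 2)}. fst z + W t (snd z) \<in> D}"
      by (intro Collect_cong conj_cong refl) (metis ex sub subsetD)
    also have "\<dots> \<in> sets (borel \<Otimes>\<^sub>M F)"
      by (intro sets.sets_Collect_countable_All stay_sets D q1)
    finally show ?thesis .
  qed
  have gt: "{z \<in> space (borel \<Otimes>\<^sub>M F). exit_time D (\<lambda>t. fst z + W t (snd z)) > ereal s} \<in> sets (borel \<Otimes>\<^sub>M F)" for s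
  proof (cases "s < 0")
    case True
    then show ?thesis by (simp add: exit_time_gt_iff)
  next
    case False
    then have "{z \<in> space (borel \<Otimes>\<^sub>M F). exit_time D (\<lambda>t. fst z + W t (snd z)) > ereal s} =
      (\<Union>q\<in>{q\<in>\<rat>. 0 < q \<and> s < q}. {z \<in> space (borel \<Otimes>\<^sub>M F). \<forall>t\<in>{0<..<q}. fst z + W t (snd z) \<in> D})"
      unfolding exit_time_gt_iff by blast
    also have "\<dots> \<in> sets (borel \<Otimes>\<^sub>M F)"
      using open_stay countable_rat by (intro sets.countable_UN'') (auto intro: countable_subset[of _ "\<rat>"])
    finally show ?thesis .
  qed
  show ?thesis
    unfolding borel_measurable_ereal_iff_Ioi
  proof
    fix a :: ereal
    let ?\<tau> = "\<lambda>z. exit_time D (\<lambda>t. fst z + W t (snd z))"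
    show "?\<tau> -` {a<..} \<inter> space (borel \<Otimes>\<^sub>M F) \<in> sets (borel \<Otimes>\<^sub>M F)"
    proof (cases a)
      case (real s)
      have "?\<tau> -` {a<..} \<inter> space (borel \<Otimes>\<^sub>M F) = {z \<in> space (borel \<Otimes>\<^sub>M F). ?\<tau> z > ereal s}" using real by auto
      then show ?thesis using gt by simp
    next
      case PInf
      then have "?\<tau> -` {a<..} \<inter> space (borel \<Otimes>\<^sub>M F) = {}" by auto
      then show ?thesis by simp
    next
      case MInf
      have "- \<infinity> < ?\<tau> z" for z using exit_time_nonneg[of D] by (metis MInfty_neq_ereal(1) ereal_infty_less(2) ereal_infty_less_eq(2) zero_ereal_def)
      then have "?\<tau> -` {a<..} \<inter> space (borel \<Otimes>\<^sub>M F) = space (borel \<Otimes>\<^sub>M F)" using MInf by auto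
      then show ?thesis by simp
    qed
  qed
qed

end

section \<open>Survival probabilities of Brownian motion\<close>

definition gauss :: "real \<Rightarrow> 'a::euclidean_space \<Rightarrow> real" where
  "gauss h y = exp (- (norm y)\<^sup>2 / (2 * h)) / (2 * pi * h) powr (real DIM('a) / 2)"

lemma gauss_measurable [measurable]: "gauss h \<in> borel_measurable borel"
  unfolding gauss_def by measurable

lemma gauss_nonneg: "0 \<le> gauss h y"
  by (simp add: gauss_def)

locale brownian =
  fixes M :: "'w measure" and W :: "real \<Rightarrow> 'w \<Rightarrow> 'a::euclidean_space"
  assumes bm: "brownian_motion M W"
begin

sublocale prob_space M
  using bm by (simp add: brownian_motion_def)

sublocale continuous_process M W
  using bm by unfold_locales (auto simp: brownian_motion_def)

lemma start: "AE \<omega> in M. W 0 \<omega> = 0"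
  using bm by (simp add: brownian_motion_def)

lemma increment_distr: "0 \<le> s \<Longrightarrow> s < t \<Longrightarrow> distr M borel (\<lambda>\<omega>. W t \<omega> - W s \<omega>) = density lborel (\<lambda>y. ennreal (gauss (t - s) y))"
proof -
  assume "0 \<le> s" "s < t"
  then have D: "distributed M lborel (\<lambda>\<omega>. W t \<omega> - W s \<omega>) (\<lambda>y. ennreal (gauss (t - s) y))"
    using bm unfolding brownian_motion_def gauss_def by blast
  have "distr M borel (\<lambda>\<omega>. W t \<omega> - W s \<omega>) = distr M lborel (\<lambda>\<omega>. W t \<omega> - W s \<omega>)"
    by (rule distr_cong) auto
  then show ?thesis using distributed_distr_eq_density[OF D] by simp
qed

lemma increment_measurable: "0 \<le> s \<Longrightarrow> 0 \<le> t \<Longrightarrow> (\<lambda>\<omega>. W t \<omega> - W s \<omega>) \<in> borel_measurable M"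
  using W_meas by (intro borel_measurable_diff) auto

lemma grid_indep:
  assumes "0 \<le> h"
  shows "indep_vars (\<lambda>_. borel) (\<lambda>i \<omega>. W (h * real (Suc i)) \<omega> - W (h * real i) \<omega>) {..<n}"
proof -
  have "0 \<le> h * real 0 \<and> incseq (\<lambda>i. h * real i)"
    using assms by (auto simp: incseq_def mult_left_mono)
  then show ?thesis using bm unfolding brownian_motion_def indep_increments_def
    by (elim conjE allE[of _ "\<lambda>i. h * real i"]) auto
qed

text \<open>Comparing with the density of doubled variance, whose total mass is 1, avoids computing
  Gaussian integrals.\<close>

lemma increment_tail:
  assumes st: "0 \<le> s" "s \<le> t" "t - s \<le> h" and h: "0 < h" and a: "0 < a"
  shows "prob {\<omega> \<in> space M. a < norm (W t \<omega> - W s \<omega>)} \<le> 2 powr (real DIM('a) / 2) * (4 * h / a\<^sup>2)"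
proof (cases "s = t")
  case True
  then show ?thesis using a h by simp
next
  case False
  define c where "c = 2 powr (real DIM('a) / 2)"
  define u where "u = t - s"
  have u: "0 < u" "u \<le> h" using False st by (auto simp: u_def)
  have [measurable]: "(\<lambda>\<omega>. W t \<omega> - W s \<omega>) \<in> borel_measurable M" using st by (intro increment_measurable) auto
  have mass: "(\<integral>\<^sup>+y. ennreal (gauss (2 * u) (y::'a)) \<partial>lborel) = 1"
  proof -
    have *: "0 \<le> 2 * u" "(0::real) < 2 * u" using u by auto
    have "(\<integral>\<^sup>+y. ennreal (gauss (2 * u) (y::'a)) \<partial>lborel) = emeasure (density lborel (\<lambda>y. ennreal (gauss (2 * u) (y::'a)))) UNIV"
      by (subst emeasure_density) auto
    also have "\<dots> = emeasure (distr M borel (\<lambda>\<omega>. W (2 * u) \<omega> - W 0 \<omega>)) UNIV"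
      using increment_distr[of 0 "2 * u"] * by simp
    also have "\<dots> = 1"
      using increment_measurable[of 0 "2 * u"] * by (simp add: emeasure_distr emeasure_space_1)
    finally show ?thesis .
  qed
  \<comment> \<open>Doubling the variance halves the exponent and costs the normalizing factor
    \<open>c\<close>; the other half of the exponent is at most its value on the sphere of radius
    \<open>a\<close>.\<close>
  have dens: "gauss u y \<le> c * exp (- a\<^sup>2 / (4 * u)) * gauss (2 * u) y" if "a < norm y" for y :: 'a
  proof -
    have c: "(2 * pi * (2 * u)) powr (real DIM('a) / 2) = c * (2 * pi * u) powr (real DIM('a) / 2)"
    proof -
      have "2 * pi * (2 * u) = 2 * (2 * pi * u)" by simp
      then show ?thesis using u by (simp only: c_def powr_mult)
    qed
    have "gauss u y = c * exp (- (norm y)\<^sup>2 / (4 * u)) * gauss (2 * u) y"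
    proof -
      have "exp (- (norm y)\<^sup>2 / (2 * u)) = exp (- (norm y)\<^sup>2 / (4 * u)) * exp (- (norm y)\<^sup>2 / (2 * (2 * u)))"
        using u by (simp add: mult_exp_exp field_simps)
      then show ?thesis unfolding gauss_def c by (simp add: c_def)
    qed
    also have "\<dots> \<le> c * exp (- a\<^sup>2 / (4 * u)) * gauss (2 * u) y"
      using that a u by (intro mult_right_mono mult_left_mono gauss_nonneg)
        (auto simp: c_def divide_right_mono power_mono)
    finally show ?thesis .
  qed
  have "emeasure M {\<omega> \<in> space M. a < norm (W t \<omega> - W s \<omega>)} = emeasure (distr M borel (\<lambda>\<omega>. W t \<omega> - W s \<omega>)) {y. a < norm y}"
    by (subst emeasure_distr) (auto intro!: arg_cong[where f="emeasure M"])
  also have "\<dots> = (\<integral>\<^sup>+y. ennreal (gauss u y) * indicator {y::'a. a < norm y} y \<partial>lborel)"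
    using False st by (subst increment_distr) (auto simp: emeasure_density u_def)
  also have "\<dots> \<le> (\<integral>\<^sup>+y. ennreal (c * exp (- a\<^sup>2 / (4 * u))) * ennreal (gauss (2 * u) (y::'a)) \<partial>lborel)"
  proof (rule nn_integral_mono)
    fix y :: 'a
    show "ennreal (gauss u y) * indicator {y. a < norm y} y \<le> ennreal (c * exp (- a\<^sup>2 / (4 * u))) * ennreal (gauss (2 * u) y)"
    proof (cases "a < norm y")
      case True
      then show ?thesis using dens[OF True]
        by (simp add: c_def gauss_nonneg ennreal_leI flip: ennreal_mult)
    qed simp
  qed
  also have "\<dots> = ennreal (c * exp (- a\<^sup>2 / (4 * u)))"
    by (subst nn_integral_cmult) (auto simp: mass)
  finally have "prob {\<omega> \<in> space M. a < norm (W t \<omega> - W s \<omega>)} \<le> c * exp (- a\<^sup>2 / (4 * u))"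
    by (simp add: emeasure_eq_measure c_def)
  \<comment> \<open>The exponential decay is given up for \<open>exp (- x) \<le> 1 / x\<close>: a
    bound linear in time is the form that the Laplace transform of the subordinator can process
    later.\<close>
  also have "\<dots> \<le> c * (4 * h / a\<^sup>2)"
  proof (rule mult_left_mono)
    have "a\<^sup>2 / (4 * h) \<le> a\<^sup>2 / (4 * u)" using u h by (intro divide_left_mono) auto
    also have "\<dots> \<le> exp (a\<^sup>2 / (4 * u))" using exp_ge_add_one_self[of "a\<^sup>2 / (4 * u)"] by linarith
    finally have "inverse (exp (a\<^sup>2 / (4 * u))) \<le> inverse (a\<^sup>2 / (4 * h))"
      using a h by (intro le_imp_inverse_le) auto
    then show "exp (- a\<^sup>2 / (4 * u)) \<le> 4 * h / a\<^sup>2" by (simp add: exp_minus)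
  qed (simp add: c_def)
  finally show ?thesis by (simp add: c_def)
qed

lemma grid_telescope: "(\<Sum>j<i. W (h * real (Suc j)) \<omega> - W (h * real j) \<omega>) = W (h * real i) \<omega> - W 0 \<omega>"
  using sum_lessThan_telescope[of "\<lambda>j. W (h * real j) \<omega>" i] by simp

text \<open>Ottaviani's argument: decompose according to the first passage above \<open>2 * a\<close>.\<close>

lemma grid_maximal:
  assumes h: "0 < h" and a: "0 < a"
  shows "prob {\<omega> \<in> space M. \<exists>i\<le>n. 2 * a < norm (W (h * real i) \<omega> - W 0 \<omega>)}
    \<le> 2 * (2 powr (real DIM('a) / 2) * (4 * (h * real n) / a\<^sup>2))"
proof -
  define y where "y = 2 powr (real DIM('a) / 2) * (4 * (h * real n) / a\<^sup>2)"
  have y0: "0 \<le> y" using h by (simp add: y_def)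
  define Y where "Y i \<omega> = W (h * real i) \<omega> - W 0 \<omega>" for i \<omega>
  have Ym[measurable]: "Y i \<in> borel_measurable M" for i
    unfolding Y_def using h by (intro increment_measurable) auto
  define \<Delta> where "\<Delta> i \<omega> = W (h * real (Suc i)) \<omega> - W (h * real i) \<omega>" for i \<omega>
  have Y_sum: "Y i \<omega> = (\<Sum>j<i. \<Delta> j \<omega>)" for i \<omega> unfolding Y_def \<Delta>_def grid_telescope ..
  have ind: "indep_vars (\<lambda>_. borel) \<Delta> {..<n}" unfolding \<Delta>_def using h by (intro grid_indep) simp
  define A where "A i = {\<omega> \<in> space M. 2 * a < norm (Y i \<omega>) \<and> (\<forall>j<i. norm (Y j \<omega>) \<le> 2 * a)}" for i
  define B where "B = {\<omega> \<in> space M. a < norm (Y n \<omega>)}"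
  have [measurable]: "A i \<in> events" "B \<in> events" for i unfolding A_def B_def by measurable
  have disj: "disjoint_family_on A {..n}"
    unfolding disjoint_family_on_def A_def
  proof (intro ballI impI)
    fix i j :: nat assume "i \<noteq> j"
    then consider "i < j" | "j < i" by linarith
    then show "{\<omega> \<in> space M. 2 * a < norm (Y i \<omega>) \<and> (\<forall>j<i. norm (Y j \<omega>) \<le> 2 * a)} \<inter>
      {\<omega> \<in> space M. 2 * a < norm (Y j \<omega>) \<and> (\<forall>k<j. norm (Y k \<omega>) \<le> 2 * a)} = {}"
      by cases (auto simp: not_le[symmetric])
  qed
  have union: "{\<omega> \<in> space M. \<exists>i\<le>n. 2 * a < norm (Y i \<omega>)} = (\<Union>i\<le>n. A i)"
  proof (intro equalityI subsetI)
    fix \<omega> assume "\<omega> \<in> {\<omega> \<in> space M. \<exists>i\<le>n. 2 * a < norm (Y i \<omega>)}"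
    then obtain i where i: "\<omega> \<in> space M" "i \<le> n" "2 * a < norm (Y i \<omega>)" by blast
    define l where "l = (LEAST i. 2 * a < norm (Y i \<omega>))"
    have "2 * a < norm (Y l \<omega>)" unfolding l_def using i(3) by (rule LeastI)
    moreover have "l \<le> i" unfolding l_def using i(3) by (rule Least_le)
    moreover have "norm (Y j \<omega>) \<le> 2 * a" if "j < l" for j
      using not_less_Least[of j "\<lambda>i. 2 * a < norm (Y i \<omega>)"] that l_def by (simp add: not_less)
    ultimately have "\<omega> \<in> A l" "l \<le> n" using i by (auto simp: A_def)
    then show "\<omega> \<in> (\<Union>i\<le>n. A i)" by blast
  qed (auto simp: A_def)
  have step: "prob (A i) \<le> prob (A i \<inter> B) + prob (A i) * y" if i: "i \<le> n" for i
  proof -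
    define Z where "Z = {\<omega> \<in> space M. a < norm (Y n \<omega> - Y i \<omega>)}"
    have [measurable]: "Z \<in> events" unfolding Z_def by measurable
    \<comment> \<open>After first exceeding \<open>2 * a\<close> at step \<open>i\<close>, the walk
      either ends beyond \<open>a\<close> or moves by more than \<open>a\<close> afterwards. The
      second event depends only on later increments and is independent of
      \<open>A i\<close>.\<close>
    have "A i \<subseteq> (A i \<inter> B) \<union> (A i \<inter> Z)"
    proof
      fix \<omega> assume \<omega>: "\<omega> \<in> A i"
      have "norm (Y i \<omega>) \<le> norm (Y n \<omega>) + norm (Y n \<omega> - Y i \<omega>)"
        by (metis norm_minus_commute norm_triangle_sub)
      then show "\<omega> \<in> (A i \<inter> B) \<union> (A i \<inter> Z)" using \<omega> by (auto simp: A_def B_def Z_def)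
    qed
    then have "prob (A i) \<le> prob ((A i \<inter> B) \<union> (A i \<inter> Z))" by (intro finite_measure_mono) auto
    also have "\<dots> \<le> prob (A i \<inter> B) + prob (A i \<inter> Z)" by (intro measure_Un_le) auto
    also have "prob (A i \<inter> Z) = prob (A i) * prob Z"
    proof -
      let ?X1 = "\<lambda>\<omega>. restrict (\<lambda>j. \<Delta> j \<omega>) {..<i}" and ?X2 = "\<lambda>\<omega>. restrict (\<lambda>j. \<Delta> j \<omega>) {i..<n}"
      let ?A = "{f \<in> space (PiM {..<i} (\<lambda>_. borel)). 2 * a < norm (\<Sum>j<i. f j :: 'a) \<and> (\<forall>k\<in>{..<i}. norm (\<Sum>j<k. f j) \<le> 2 * a)}"
      let ?Z = "{f \<in> space (PiM {i..<n} (\<lambda>_. borel)). a < norm (\<Sum>j\<in>{i..<n}. f j :: 'a)}"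
      have iv: "indep_var (PiM {..<i} (\<lambda>_. borel)) ?X1 (PiM {i..<n} (\<lambda>_. borel)) ?X2"
        by (rule indep_var_restrict[OF ind]) (use i in auto)
      have comp: "(\<lambda>f. f j) \<in> borel_measurable (PiM J (\<lambda>_. borel))" if "j \<in> J" for j J
        using that by measurable
      have sA: "?A \<in> sets (PiM {..<i} (\<lambda>_. borel))"
      proof -
        have [measurable]: "(\<lambda>f. \<Sum>j<k. f j) \<in> borel_measurable (PiM {..<i} (\<lambda>_. borel :: 'a measure))" if "k \<le> i" for k
          using that by (intro borel_measurable_sum comp) auto
        have c1: "{f \<in> space (PiM {..<i} (\<lambda>_. borel)). 2 * a < norm (\<Sum>j<i. f j :: 'a)} \<in> sets (PiM {..<i} (\<lambda>_. borel))" by measurable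
        have c2: "{f \<in> space (PiM {..<i} (\<lambda>_. borel)). \<forall>k\<in>{..<i}. norm (\<Sum>j<k. f j :: 'a) \<le> 2 * a} \<in> sets (PiM {..<i} (\<lambda>_. borel))"
        proof (rule sets.sets_Collect_finite_All)
          fix k assume "k \<in> {..<i}"
          then have [measurable]: "(\<lambda>f. \<Sum>j<k. f j) \<in> borel_measurable (PiM {..<i} (\<lambda>_. borel :: 'a measure))"
            by (intro borel_measurable_sum comp) auto
          show "{f \<in> space (PiM {..<i} (\<lambda>_. borel)). norm (\<Sum>j<k. f j :: 'a) \<le> 2 * a} \<in> sets (PiM {..<i} (\<lambda>_. borel))" by measurable
        qed simp
        show ?thesis by (rule sets.sets_Collect_conj[OF c2 c1])
      qed
      have sZ: "?Z \<in> sets (PiM {i..<n} (\<lambda>_. borel))"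
      proof -
        have [measurable]: "(\<lambda>f. \<Sum>j\<in>{i..<n}. f j) \<in> borel_measurable (PiM {i..<n} (\<lambda>_. borel :: 'a measure))"
          by (intro borel_measurable_sum comp) auto
        show ?thesis by measurable
      qed
      have "?X1 -` ?A \<inter> space M = A i"
        unfolding A_def Y_sum by (auto simp: space_PiM sum.cong[OF refl restrict_apply'])
      moreover have "?X2 -` ?Z \<inter> space M = Z"
      proof -
        have "Y n \<omega> - Y i \<omega> = (\<Sum>j\<in>{i..<n}. \<Delta> j \<omega>)" for \<omega>
          unfolding Y_sum using i by (simp add: lessThan_atLeast0 sum_diff_nat_ivl)
        then show ?thesis unfolding Z_def by (auto simp: space_PiM)
      qed
      moreover have "(\<lambda>x. (?X1 x, ?X2 x)) -` (?A \<times> ?Z) \<inter> space M = (?X1 -` ?A \<inter> space M) \<inter> (?X2 -` ?Z \<inter> space M)"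
        by auto
      ultimately show ?thesis using indep_varD[OF iv sA sZ] by simp
    qed
    also have "prob Z \<le> y"
    proof (cases "i = n")
      case True
      then show ?thesis using a y0 by (simp add: Z_def)
    next
      case False
      then have "0 < h * real n" using i h by simp
      moreover have "h * real i \<le> h * real n" using i h by simp
      ultimately show ?thesis
        using increment_tail[of "h * real i" "h * real n" "h * real n" a] a h
        by (simp add: Z_def Y_def y_def)
    qed
    finally show ?thesis by (simp add: mult_left_mono)
  qed
  let ?P = "prob (\<Union>i\<le>n. A i)"
  have P: "?P = (\<Sum>i\<le>n. prob (A i))" by (rule finite_measure_finite_Union) (use disj in auto)
  also have "\<dots> \<le> (\<Sum>i\<le>n. prob (A i \<inter> B) + prob (A i) * y)" by (intro sum_mono step) simp
  also have "\<dots> = prob (\<Union>i\<le>n. A i \<inter> B) + ?P * y"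
  proof -
    have "prob (\<Union>i\<le>n. A i \<inter> B) = (\<Sum>i\<le>n. prob (A i \<inter> B))"
      by (rule finite_measure_finite_Union) (use disj in \<open>auto simp: disjoint_family_on_def\<close>)
    then show ?thesis by (simp add: P sum.distrib sum_distrib_right)
  qed
  also have "prob (\<Union>i\<le>n. A i \<inter> B) \<le> prob B" by (intro finite_measure_mono) auto
  also have "prob B \<le> y"
  proof (cases "n = 0")
    case True
    then show ?thesis using a y0 by (simp add: B_def Y_def)
  next
    case False
    then show ?thesis
      using increment_tail[of 0 "h * real n" "h * real n" a] a h by (simp add: B_def Y_def y_def)
  qed
  finally have *: "?P \<le> y + ?P * y" by simp
  \<comment> \<open>For \<open>y \<le> 1/2\<close> the term \<open>?P * y\<close> is absorbed on the
    left; for larger \<open>y\<close> the bound exceeds 1.\<close>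
  have "?P \<le> 2 * y"
  proof (cases "y \<le> 1/2")
    case True
    then have "?P * y \<le> ?P * (1/2)" by (intro mult_left_mono) auto
    then show ?thesis using * by simp
  next
    case False
    then show ?thesis using prob_le_1[of "\<Union>i\<le>n. A i"] by linarith
  qed
  then show ?thesis unfolding union[symmetric] Y_def y_def by simp
qed

text \<open>By continuity a displacement of at least \<open>\<delta>\<close> shows up on some dyadic
  grid as one above \<open>\<delta> / 2\<close>, and the grid events increase with the level. The
  claim is about any event \<open>E\<close> of such paths, so no supremum has to be measured. The
  constant is 2 times 4 times 16, the last from squaring \<open>\<delta> / 4\<close>.\<close>

lemma maximal_inequality:
  assumes s: "0 \<le> s" and \<delta>: "0 < \<delta>"
    and E: "E \<in> events" "\<And>\<omega>. \<omega> \<in> E \<Longrightarrow> \<exists>u\<in>{0..s}. \<delta> \<le> norm (W u \<omega> - W 0 \<omega>)"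
  shows "prob E \<le> 128 * 2 powr (real DIM('a) / 2) * (s / \<delta>\<^sup>2)"
proof (cases "s = 0")
  case True
  then have "E = {}" using E(2) \<delta> by fastforce
  then show ?thesis using s by simp
next
  case False
  then have s0: "0 < s" using s by simp
  \<comment> \<open>The threshold is half of \<open>\<delta>\<close>, hence strictly exceeded by the
    displacement at \<open>u\<close>, and the strict inequality survives on fine grids.\<close>
  define V where "V k = {\<omega> \<in> space M. \<exists>i\<le>2 ^ k. 2 * (\<delta> / 4) < norm (W (grid 0 s k i) \<omega> - W 0 \<omega>)}" for k
  have Vm[measurable]: "V k \<in> events" for k
  proof -
    have [measurable]: "(\<lambda>\<omega>. W (grid 0 s k i) \<omega> - W 0 \<omega>) \<in> borel_measurable M" for i
      using s by (intro increment_measurable) (auto simp: grid_def)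
    show ?thesis unfolding V_def by measurable
  qed
  have inc: "incseq V"
  proof (rule incseq_SucI, rule subsetI)
    fix k \<omega> assume "\<omega> \<in> V k"
    then obtain i where i: "\<omega> \<in> space M" "i \<le> 2 ^ k" "2 * (\<delta> / 4) < norm (W (grid 0 s k i) \<omega> - W 0 \<omega>)"
      by (auto simp: V_def)
    then show "\<omega> \<in> V (Suc k)" unfolding V_def
      by (auto intro!: exI[of _ "2 * i"] simp: grid_Suc)
  qed
  have Vk: "prob (V k) \<le> 128 * 2 powr (real DIM('a) / 2) * (s / \<delta>\<^sup>2)" for k
    using grid_maximal[of "s / 2 ^ k" "\<delta> / 4" "2 ^ k"] s0 \<delta>
    by (simp add: V_def grid_def power2_eq_square field_simps)
  have "E \<subseteq> (\<Union>k. V k)"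
  proof
    fix \<omega> assume \<omega>: "\<omega> \<in> E"
    then have sp: "\<omega> \<in> space M" using sets.sets_into_space[OF E(1)] by auto
    obtain u where u: "u \<in> {0..s}" "\<delta> \<le> norm (W u \<omega> - W 0 \<omega>)" using E(2)[OF \<omega>] by blast
    then have us: "0 \<le> u" "u \<le> s" by auto
    obtain i where i: "\<And>k. i k \<le> 2 ^ k" "(\<lambda>k. grid 0 s k (i k)) \<longlonglongrightarrow> u" using grid_dense[OF us] by blast
    have "(\<lambda>k. W (grid 0 s k (i k)) \<omega>) \<longlonglongrightarrow> W u \<omega>"
      by (rule continuous_on_tendsto_compose[OF W_cont[OF sp] i(2)])
         (use s us in \<open>auto simp: grid_def\<close>)
    then have "(\<lambda>k. norm (W (grid 0 s k (i k)) \<omega> - W 0 \<omega>)) \<longlonglongrightarrow> norm (W u \<omega> - W 0 \<omega>)"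
      by (intro tendsto_intros)
    moreover have "2 * (\<delta> / 4) < norm (W u \<omega> - W 0 \<omega>)" using u \<delta> by simp
    ultimately have "eventually (\<lambda>k. 2 * (\<delta> / 4) < norm (W (grid 0 s k (i k)) \<omega> - W 0 \<omega>)) sequentially"
      by (rule order_tendstoD)
    then obtain k where "2 * (\<delta> / 4) < norm (W (grid 0 s k (i k)) \<omega> - W 0 \<omega>)"
      by (auto simp: eventually_sequentially)
    then have "\<omega> \<in> V k" using sp i(1) by (auto simp: V_def)
    then show "\<omega> \<in> (\<Union>k. V k)" by blast
  qed
  then have "prob E \<le> prob (\<Union>k. V k)" by (intro finite_measure_mono) auto
  also have "\<dots> \<le> 128 * 2 powr (real DIM('a) / 2) * (s / \<delta>\<^sup>2)"
    using finite_Lim_measure_incseq[OF _ inc] Vk Vm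
    by (intro LIMSEQ_le_const2[of "\<lambda>k. prob (V k)"]) (auto simp: image_subset_iff)
  finally show ?thesis .
qed

section \<open>Survival probabilities and their scaling\<close>

text \<open>The right-hand side does not mention \<open>W\<close>: positions on a uniform grid are
  partial sums of independent Gaussian increments. This is how two Brownian motions on the same
  space are compared.\<close>

lemma grid_law:
  assumes h: "0 < h" and n: "0 < n" and A[measurable]: "A \<in> sets borel"
  shows "prob {\<omega> \<in> space M. \<forall>i\<le>n. x + W (h * real i) \<omega> \<in> A} =
    measure (PiM {..<n} (\<lambda>_. density lborel (\<lambda>y. ennreal (gauss h y))))
      {f \<in> space (PiM {..<n} (\<lambda>_. borel)). \<forall>i\<in>{..n}. x + (\<Sum>j<i. f j) \<in> A}"
proof -
  define \<Delta> where "\<Delta> i \<omega> = W (h * real (Suc i)) \<omega> - W (h * real i) \<omega>" for i \<omega>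
  let ?B = "{f \<in> space (PiM {..<n} (\<lambda>_. borel)). \<forall>i\<in>{..n}. x + (\<Sum>j<i. f j) \<in> A}"
  have ind: "indep_vars (\<lambda>_. borel) \<Delta> {..<n}" unfolding \<Delta>_def using h by (intro grid_indep) simp
  have \<Delta>[measurable]: "\<Delta> i \<in> borel_measurable M" for i
    unfolding \<Delta>_def using h by (intro increment_measurable) auto
  have \<Delta>_distr: "distr M borel (\<Delta> i) = density lborel (\<lambda>y. ennreal (gauss h y))" for i
    unfolding \<Delta>_def using increment_distr[of "h * real i" "h * real (Suc i)"] h by (simp add: algebra_simps)
  have law: "distr M (PiM {..<n} (\<lambda>_. borel)) (\<lambda>\<omega>. \<lambda>i\<in>{..<n}. \<Delta> i \<omega>) = PiM {..<n} (\<lambda>_. density lborel (\<lambda>y. ennreal (gauss h y)))"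
    using indep_vars_iff_distr_eq_PiM'[where I = "{..<n}" and M' = "\<lambda>_. borel" and X = \<Delta>] ind n
    by (auto simp: \<Delta>_distr)
  have sB: "?B \<in> sets (PiM {..<n} (\<lambda>_. borel))"
  proof (rule sets.sets_Collect_finite_All)
    fix i assume "i \<in> {..n}"
    then have [measurable]: "(\<lambda>f. \<Sum>j<i. f j) \<in> borel_measurable (PiM {..<n} (\<lambda>_. borel :: 'a measure))"
      by (intro borel_measurable_sum measurable_component_singleton) auto
    show "{f \<in> space (PiM {..<n} (\<lambda>_. borel)). x + (\<Sum>j<i. f j) \<in> A} \<in> sets (PiM {..<n} (\<lambda>_. borel))" by measurable
  qed simp
  have m: "(\<lambda>\<omega>. \<lambda>i\<in>{..<n}. \<Delta> i \<omega>) \<in> measurable M (PiM {..<n} (\<lambda>_. borel))" by measurable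
  have [measurable]: "W (h * real i) \<in> borel_measurable M" for i using h by (intro W_meas) simp
  \<comment> \<open>The start at 0 holds only almost surely, so the two events agree only up to a
    null set.\<close>
  have "prob {\<omega> \<in> space M. \<forall>i\<le>n. x + W (h * real i) \<omega> \<in> A} =
      prob ((\<lambda>\<omega>. \<lambda>i\<in>{..<n}. \<Delta> i \<omega>) -` ?B \<inter> space M)"
  proof (rule measure_eq_AE)
    show "AE \<omega> in M. (\<omega> \<in> {\<omega> \<in> space M. \<forall>i\<le>n. x + W (h * real i) \<omega> \<in> A}) =
        (\<omega> \<in> (\<lambda>\<omega>. \<lambda>i\<in>{..<n}. \<Delta> i \<omega>) -` ?B \<inter> space M)"
      using start
    proof eventually_elim
      case (elim \<omega>)
      have "(\<Sum>j<i. (\<lambda>i\<in>{..<n}. \<Delta> i \<omega>) j) = W (h * real i) \<omega>" if "i \<le> n" for i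
      proof -
        have "(\<Sum>j<i. (\<lambda>i\<in>{..<n}. \<Delta> i \<omega>) j) = (\<Sum>j<i. \<Delta> j \<omega>)" using that by (intro sum.cong) auto
        also have "\<dots> = W (h * real i) \<omega>" unfolding \<Delta>_def grid_telescope elim by simp
        finally show ?thesis .
      qed
      then show ?case by (auto simp: space_PiM)
    qed
    show "{\<omega> \<in> space M. \<forall>i\<le>n. x + W (h * real i) \<omega> \<in> A} \<in> events" by measurable
    show "(\<lambda>\<omega>. \<lambda>i\<in>{..<n}. \<Delta> i \<omega>) -` ?B \<inter> space M \<in> events" by (rule measurable_sets[OF m sB])
  qed
  also have "\<dots> = measure (distr M (PiM {..<n} (\<lambda>_. borel)) (\<lambda>\<omega>. \<lambda>i\<in>{..<n}. \<Delta> i \<omega>)) ?B"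
    by (rule measure_distr[OF m sB, symmetric])
  finally show ?thesis unfolding law .
qed

text \<open>Survival up to a deterministic time, phrased through the path on a closed interval; the
  random time is inserted later by independence.\<close>

definition survival :: "'a set \<Rightarrow> 'a \<Rightarrow> real \<Rightarrow> real" where
  "survival D x s = prob {\<omega> \<in> space M. \<forall>u\<in>{0..s}. x + W u \<omega> \<in> D}"

lemma survival_sets:
  assumes D: "open D" "D \<noteq> UNIV"
  shows "{\<omega> \<in> space M. \<forall>u\<in>{0..s}. x + W u \<omega> \<in> D} \<in> events"
proof (cases "0 \<le> s")
  case True
  have "(\<lambda>\<omega>. (x, \<omega>)) \<in> measurable M (borel \<Otimes>\<^sub>M M)" by measurable
  from measurable_sets[OF this stay_sets[OF D order_refl True]]
  have "(\<lambda>\<omega>. (x, \<omega>)) -` {z \<in> space (borel \<Otimes>\<^sub>M M). \<forall>u\<in>{0..s}. fst z + W u (snd z) \<in> D} \<inter> space M \<in> events" .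
  also have "(\<lambda>\<omega>. (x, \<omega>)) -` {z \<in> space (borel \<Otimes>\<^sub>M M). \<forall>u\<in>{0..s}. fst z + W u (snd z) \<in> D} \<inter> space M =
      {\<omega> \<in> space M. \<forall>u\<in>{0..s}. x + W u \<omega> \<in> D}"
    by (auto simp: space_pair_measure)
  finally show ?thesis .
qed simp

lemma survival_bounds: "0 \<le> survival D x s" "survival D x s \<le> 1"
  by (auto simp: survival_def)

lemma survival_antimono:
  assumes "open D" "D \<noteq> UNIV" "s \<le> t"
  shows "survival D x t \<le> survival D x s"
  unfolding survival_def using assms survival_sets[OF assms(1,2)] by (intro finite_measure_mono) auto

text \<open>Leaving \<open>D\<close> requires a displacement of at least the distance from
  \<open>x\<close> to the complement, which \<open>maximal_inequality\<close> makes
  unlikely.\<close>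

lemma survival_lower:
  assumes D: "open D" "D \<noteq> UNIV" and x: "x \<in> D" and s: "0 \<le> s"
  shows "1 - survival D x s \<le> 128 * 2 powr (real DIM('a) / 2) * (s / (infdist x (- D))\<^sup>2)"
proof -
  let ?T = "{\<omega> \<in> space M. \<forall>u\<in>{0..s}. x + W u \<omega> \<in> D}"
  have ne: "- D \<noteq> {}" using D by auto
  have pos: "0 < infdist x (- D)" using x D ne by (metis ComplD closed_Compl infdist_pos_not_in_closed)
  have [measurable]: "W 0 \<in> borel_measurable M" by (rule W_meas) simp
  have [measurable]: "?T \<in> events" by (rule survival_sets[OF D])
  define E where "E = {\<omega> \<in> space M. W 0 \<omega> = 0} - ?T"
  have E[measurable]: "E \<in> events" unfolding E_def by measurable
  have "1 - survival D x s = prob (space M - ?T)" unfolding survival_def by (simp add: prob_compl)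
  also have "\<dots> = prob E"
    by (rule measure_eq_AE) (use start in \<open>auto simp: E_def\<close>)
  also have "\<dots> \<le> 128 * 2 powr (real DIM('a) / 2) * (s / (infdist x (- D))\<^sup>2)"
  proof (rule maximal_inequality[OF s pos E])
    fix \<omega> assume "\<omega> \<in> E"
    then obtain u where u: "u \<in> {0..s}" "x + W u \<omega> \<in> - D" "W 0 \<omega> = 0" by (auto simp: E_def)
    then have "infdist x (- D) \<le> dist x (x + W u \<omega>)" by (intro infdist_le)
    then show "\<exists>u\<in>{0..s}. infdist x (- D) \<le> norm (W u \<omega> - W 0 \<omega>)"
      using u by (intro bexI[of _ u]) (auto simp: dist_norm)
  qed
  finally show ?thesis .
qed

text \<open>A path starting in \<open>A\<close> cannot enter \<open>B\<close> without leaving the union.\<close>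

lemma survival_disjoint_Un:
  assumes A: "open A" and B: "open B" and AB: "A \<inter> B = {}" "A \<union> B \<noteq> UNIV" and x: "x \<in> A"
  shows "survival (A \<union> B) x s = survival A x s"
  unfolding survival_def
proof (rule measure_eq_AE)
  show "{\<omega> \<in> space M. \<forall>u\<in>{0..s}. x + W u \<omega> \<in> A \<union> B} \<in> events" using A B AB by (intro survival_sets) auto
  show "{\<omega> \<in> space M. \<forall>u\<in>{0..s}. x + W u \<omega> \<in> A} \<in> events" using A AB by (intro survival_sets) auto
  show "AE \<omega> in M. (\<omega> \<in> {\<omega> \<in> space M. \<forall>u\<in>{0..s}. x + W u \<omega> \<in> A \<union> B}) =
      (\<omega> \<in> {\<omega> \<in> space M. \<forall>u\<in>{0..s}. x + W u \<omega> \<in> A})"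
    using start AE_space
  proof eventually_elim
    case (elim \<omega>)
    have "\<forall>u\<in>{0..s}. x + W u \<omega> \<in> A" if *: "\<forall>u\<in>{0..s}. x + W u \<omega> \<in> A \<union> B"
    proof (cases "0 \<le> s")
      case True
      have "connected ((\<lambda>u. x + W u \<omega>) ` {0..s})"
        by (intro connected_continuous_image continuous_on_subset[OF shifted_cont[OF elim(2)]]) auto
      moreover have "(\<lambda>u. x + W u \<omega>) ` {0..s} \<subseteq> A \<union> B" using * by auto
      moreover have "x \<in> A \<inter> (\<lambda>u. x + W u \<omega>) ` {0..s}" using x elim True by (auto intro!: image_eqI[of _ _ 0])
      ultimately have "B \<inter> (\<lambda>u. x + W u \<omega>) ` {0..s} = {}"
        using connectedD[of "(\<lambda>u. x + W u \<omega>) ` {0..s}" A B] A B AB by blast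
      then show ?thesis using * by blast
    qed simp
    then show ?case by auto
  qed
qed

end

text \<open>Survival is an increasing union over the gap \<open>1 / Suc m\<close> of decreasing
  intersections over the grid level. Continuity of measures reduces it to grid events, whose
  probabilities \<open>grid_law\<close> expresses without the process. Positivity of
  \<open>s\<close> makes the mesh positive.\<close>

lemma survival_unique:
  fixes X Y :: "real \<Rightarrow> 'w \<Rightarrow> 'a::euclidean_space"
  assumes X: "brownian_motion M X" and Y: "brownian_motion M Y"
    and D: "open D" "D \<noteq> UNIV" and s: "0 < s"
  shows "brownian.survival M X D x s = brownian.survival M Y D x s"
proof -
  define A where "A m = {y. 1 / real (Suc m) \<le> infdist y (- D)}" for m
  define E where "E Z m k = {\<omega> \<in> space M. \<forall>i\<le>2^k. x + Z (s / 2 ^ k * real i) \<omega> \<in> A m}"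
    for Z :: "real \<Rightarrow> 'w \<Rightarrow> 'a" and m k
  have A: "A m \<in> sets borel" for m
  proof -
    have "closed (A m)" unfolding A_def by (intro closed_Collect_le continuous_intros)
    then show ?thesis by auto
  qed
  have lim: "(\<lambda>m. measure M (\<Inter>k. E Z m k)) \<longlonglongrightarrow> brownian.survival M Z D x s \<and>
     (\<forall>m. (\<lambda>k. measure M (E Z m k)) \<longlonglongrightarrow> measure M (\<Inter>k. E Z m k))"
    if Z: "brownian_motion M Z" for Z
  proof -
    interpret brownian M Z by unfold_locales (rule Z)
    have g: "grid 0 s k i = s / 2 ^ k * real i" for k i by (simp add: grid_def)
    have Em[measurable]: "E Z m k \<in> events" for m k
    proof -
      have [measurable]: "Z (s / 2 ^ k * real i) \<in> borel_measurable M" for i using s by (intro W_meas) simp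
      note A[measurable]
      show ?thesis unfolding E_def by measurable
    qed
    have dec: "decseq (E Z m)" for m
    proof (rule decseq_SucI, rule subsetI)
      fix k \<omega> assume \<omega>: "\<omega> \<in> E Z m (Suc k)"
      have "x + Z (s / 2 ^ k * real i) \<omega> \<in> A m" if "i \<le> 2 ^ k" for i
      proof -
        have "2 * i \<le> 2 ^ Suc k" using that by simp
        then have "x + Z (s / 2 ^ Suc k * real (2 * i)) \<omega> \<in> A m" using \<omega> unfolding E_def by blast
        moreover have "s / 2 ^ Suc k * real (2 * i) = s / 2 ^ k * real i" by simp
        ultimately show ?thesis by metis
      qed
      then show "\<omega> \<in> E Z m k" using \<omega> unfolding E_def by auto
    qed
    have inc: "incseq (\<lambda>m. \<Inter>k. E Z m k)"
    proof -
      have "A m \<subseteq> A (Suc m)" for m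
      proof
        fix y assume "y \<in> A m"
        moreover have "1 / real (Suc (Suc m)) \<le> 1 / real (Suc m)" by (simp add: field_simps)
        ultimately show "y \<in> A (Suc m)" unfolding A_def by simp
      qed
      then have "E Z m k \<subseteq> E Z (Suc m) k" for m k unfolding E_def by blast
      then show ?thesis by (intro incseq_SucI) blast
    qed
    have U: "(\<Union>m. \<Inter>k. E Z m k) = {\<omega> \<in> space M. \<forall>u\<in>{0..s}. x + Z u \<omega> \<in> D}"
    proof -
      have "(\<forall>u\<in>{0..s}. x + Z u \<omega> \<in> D) \<longleftrightarrow> (\<exists>m. \<forall>k. \<omega> \<in> E Z m k)" if "\<omega> \<in> space M" for \<omega>
        using path_in_open_iff_grid[OF shifted_cont[OF that] D, of 0 s x] s that
        by (simp add: E_def A_def g)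
      then show ?thesis by (auto simp: E_def)
    qed
    show ?thesis
    proof -
      have r1: "range (E Z m) \<subseteq> events" for m using Em by auto
      have r2: "range (\<lambda>m. \<Inter>k. E Z m k) \<subseteq> events" using Em by auto
      show ?thesis
        unfolding survival_def U[symmetric]
        by (intro conjI allI finite_Lim_measure_incseq[OF r2 inc] finite_Lim_measure_decseq[OF r1 dec])
    qed
  qed
  have "measure M (E X m k) = measure M (E Y m k)" for m k
  proof -
    interpret X: brownian M X by unfold_locales (rule X)
    interpret Y: brownian M Y by unfold_locales (rule Y)
    have "0 < s / 2 ^ k" "(0::nat) < 2 ^ k" using s by auto
    from X.grid_law[OF this A] Y.grid_law[OF this A] show ?thesis unfolding E_def by simp
  qed
  note EE = this
  have "measure M (\<Inter>k. E X m k) = measure M (\<Inter>k. E Y m k)" for m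
    using lim[OF X, THEN conjunct2, rule_format, of m] lim[OF Y, THEN conjunct2, rule_format, of m]
    unfolding EE by (rule LIMSEQ_unique)
  note EI = this
  show ?thesis
    using lim[OF X, THEN conjunct1] lim[OF Y, THEN conjunct1] unfolding EI by (rule LIMSEQ_unique)
qed

text \<open>With \<open>X\<close> the rescaled and rotated motion,
  \<open>R x + X u = R (x + W (u / r\<^sup>2))\<close>, so the two survival events coincide after a
  time change; \<open>survival_unique\<close> then replaces \<open>X\<close> by
  \<open>W\<close>.\<close>

lemma (in brownian) survival_similitude:
  fixes R :: "'a \<Rightarrow> 'a"
  assumes R: "similitude R r" and D: "open D" "D \<noteq> UNIV" and s: "0 \<le> s" and x: "x \<in> D"
  shows "survival (R ` D) (R x) s = survival D x (s / r\<^sup>2)"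
proof -
  obtain T where T: "orthogonal_transformation T" "0 < r" "\<And>x. R x = R 0 + r *\<^sub>R T x"
    using similitudeE[OF R] by metis
  have lin: "linear T" using T(1) by (rule orthogonal_transformation_linear)
  define X where "X t \<omega> = r *\<^sub>R T (W (t / r\<^sup>2) \<omega>)" for t \<omega>
  have X: "brownian_motion M X" unfolding X_def[abs_def] using bm T by (intro brownian_motion_scale)
  have inj: "R x = R y \<Longrightarrow> x = y" for x y using similitude_inverse[OF R] by metis
  have surj: "\<exists>x. R x = y" for y using similitude_inverse[OF R] by metis
  have RD: "open (R ` D)" "R ` D \<noteq> UNIV"
  proof -
    show "open (R ` D)" by (rule similitude_image_open[OF R D(1)])
    obtain y where "y \<notin> D" using D(2) by blast
    then have "R y \<notin> R ` D" using inj by auto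
    then show "R ` D \<noteq> UNIV" by blast
  qed
  show ?thesis
  proof (cases "s = 0")
    case True
    \<comment> \<open>Time 0 has no grid of positive mesh; both sides are 1 because the start lies
      in the open set.\<close>
    have "survival D' x' 0 = 1" if "open D'" "D' \<noteq> UNIV" "x' \<in> D'" for D' x'
      unfolding survival_def using survival_sets[OF that(1,2), of 0 x'] start that(3)
      by (subst prob_Collect_eq_1) (auto elim!: AE_mp)
    then show ?thesis using True RD D x by simp
  next
    case False
    then have s: "0 < s" using s by simp
    have key: "R x + X u \<omega> \<in> R ` D \<longleftrightarrow> x + W (u / r\<^sup>2) \<omega> \<in> D" for u \<omega>
    proof -
      have "R x + X u \<omega> = R (x + W (u / r\<^sup>2) \<omega>)"
        unfolding T(3)[of x] T(3)[of "x + W (u / r\<^sup>2) \<omega>"] X_def by (simp add: linear_add[OF lin] scaleR_add_right)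
      then show ?thesis using inj by auto
    qed
    have "survival (R ` D) (R x) s = brownian.survival M X (R ` D) (R x) s"
      by (rule survival_unique[OF bm X RD s])
    also have "\<dots> = prob {\<omega> \<in> space M. \<forall>u\<in>{0..s}. R x + X u \<omega> \<in> R ` D}"
      by (rule brownian.survival_def) (unfold_locales, rule X)
    also have "{\<omega> \<in> space M. \<forall>u\<in>{0..s}. R x + X u \<omega> \<in> R ` D} = {\<omega> \<in> space M. \<forall>u\<in>{0..s / r\<^sup>2}. x + W u \<omega> \<in> D}"
    proof -
      have "{0..s / r\<^sup>2} = (\<lambda>u. u / r\<^sup>2) ` {0..s}"
        using T(2) by (auto simp: field_simps image_iff intro!: bexI[of _ "_ * r\<^sup>2"])
      then show ?thesis unfolding key by auto
    qed
    finally show ?thesis by (simp add: survival_def)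
  qed
qed

section \<open>Subordination\<close>

lemma min_one_le_exp: "0 \<le> y \<Longrightarrow> min 1 y \<le> 2 * (1 - exp (- y))" for y :: real
proof (cases "y \<le> 1")
  case True
  assume y: "0 \<le> y"
  have "exp (- y) = inverse (exp y)" by (rule exp_minus)
  also have "\<dots> \<le> inverse (1 + y)" using y by (intro le_imp_inverse_le exp_ge_add_one_self) auto
  also have "\<dots> \<le> 1 - y / 2"
  proof -
    have "1 \<le> (1 - y / 2) * (1 + y)" using y True mult_left_mono[of y 1 y] by (simp add: algebra_simps)
    then show ?thesis using y by (simp add: field_simps)
  qed
  finally show ?thesis using True by simp
next
  case False
  have "2 \<le> exp (1::real)" using exp_ge_add_one_self[of 1] by simp
  then have "exp (- 1) \<le> (1/2::real)" using le_imp_inverse_le[of 2 "exp (1::real)"] by (simp add: exp_minus)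
  moreover have "exp (- y) \<le> exp (- 1)" using False by simp
  ultimately have "exp (- y) \<le> 1/2" by (rule order_trans[rotated])
  moreover have "min 1 y = 1" using False by simp
  ultimately show ?thesis by simp
qed

text \<open>The transforms at the integers are the moments of \<open>exp (- X)\<close>, and a bounded
  distribution is determined by its moments.\<close>

lemma (in prob_space) laplace_transform_unique:
  fixes X Y :: "'a \<Rightarrow> real"
  assumes X[measurable]: "X \<in> borel_measurable M" and Y[measurable]: "Y \<in> borel_measurable M"
    and X0: "AE \<omega> in M. 0 \<le> X \<omega>" and Y0: "AE \<omega> in M. 0 \<le> Y \<omega>"
    and eq: "\<And>l. 0 < l \<Longrightarrow> expectation (\<lambda>\<omega>. exp (- l * X \<omega>)) = expectation (\<lambda>\<omega>. exp (- l * Y \<omega>))"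
  shows "distr M borel X = distr M borel Y"
proof -
  define U where "U X \<omega> = exp (- X \<omega>)" for X :: "'a \<Rightarrow> real" and \<omega>
  have Um[measurable]: "U Z \<in> borel_measurable M" if "Z \<in> borel_measurable M" for Z
    using that unfolding U_def by measurable
  have Upow: "U Z \<omega> ^ k = exp (- real k * Z \<omega>)" for Z k \<omega>
    by (simp add: U_def flip: exp_of_nat_mult)
  have Uint: "integrable M (\<lambda>\<omega>. U Z \<omega> ^ k)" and Ubd: "expectation (\<lambda>\<omega>. \<bar>U Z \<omega>\<bar> ^ k) \<le> 1"
    if [measurable]: "Z \<in> borel_measurable M" and Z0: "AE \<omega> in M. 0 \<le> Z \<omega>" for Z k
  proof -
    have bd: "AE \<omega> in M. norm (U Z \<omega> ^ k) \<le> 1"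
      using Z0 by eventually_elim (simp add: Upow)
    then show int: "integrable M (\<lambda>\<omega>. U Z \<omega> ^ k)" by (intro integrable_const_bound) auto
    have "expectation (\<lambda>\<omega>. U Z \<omega> ^ k) \<le> expectation (\<lambda>\<omega>. 1)"
      using bd by (intro integral_mono_AE int) auto
    then show "expectation (\<lambda>\<omega>. \<bar>U Z \<omega>\<bar> ^ k) \<le> 1" by (simp add: U_def prob_space)
  qed
  have moments: "expectation (\<lambda>\<omega>. U X \<omega> ^ k) = expectation (\<lambda>\<omega>. U Y \<omega> ^ k)" for k
    using eq[of "real k"] by (cases "k = 0") (auto simp: Upow)
  let ?\<mu> = "\<lambda>Z. distr M borel (U Z)"
  have rd: "real_distribution (?\<mu> Z)" if "Z \<in> borel_measurable M" for Z
    using that by (intro real_distribution_distr) simp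
  have "char (?\<mu> X) t = char (?\<mu> Y) t" for t
  proof -
    \<comment> \<open>The remainder bound of the Taylor expansion of a characteristic function. All
      absolute moments of \<open>U\<close> are at most 1, so it tends to 0 for every fixed
      \<open>t\<close>, whichever variable is used.\<close>
    define e where "e n = 2 * \<bar>t\<bar> ^ n / fact n" for n
    have approx: "cmod (char (?\<mu> Z) t - (\<Sum>k\<le>n. ((\<i> * t) ^ k / fact k) * expectation (\<lambda>\<omega>. U Z \<omega> ^ k))) \<le> e n"
      if Z: "Z \<in> borel_measurable M" "AE \<omega> in M. 0 \<le> Z \<omega>" for Z n
    proof -
      have "cmod (char (?\<mu> Z) t - (\<Sum>k\<le>n. ((\<i> * t) ^ k / fact k) * expectation (\<lambda>\<omega>. U Z \<omega> ^ k)))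
        \<le> e n * expectation (\<lambda>\<omega>. \<bar>U Z \<omega>\<bar> ^ n)"
        unfolding e_def by (rule char_approx1') (use Z Uint in auto)
      also have "\<dots> \<le> e n * 1" by (intro mult_left_mono Ubd Z) (simp add: e_def)
      finally show ?thesis by simp
    qed
    have bound: "cmod (char (?\<mu> X) t - char (?\<mu> Y) t) \<le> 2 * e n" for n
      using norm_triangle_le_diff approx[OF X X0, of n] approx[OF Y Y0, of n] unfolding moments
      by (smt (verit, ccfv_SIG) norm_minus_commute norm_triangle_ineq4 diff_add_cancel add_diff_eq diff_diff_eq2)
    have "(\<lambda>n. \<bar>t\<bar> ^ n / fact n) \<longlonglongrightarrow> 0"
      using summable_LIMSEQ_zero[OF summable_exp[of "\<bar>t\<bar>"]] by (simp add: field_simps)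
    then have "(\<lambda>n. 4 * (\<bar>t\<bar> ^ n / fact n)) \<longlonglongrightarrow> 4 * 0" by (intro tendsto_intros)
    then have "(\<lambda>n. 2 * e n) \<longlonglongrightarrow> 0" by (simp add: e_def)
    then have "cmod (char (?\<mu> X) t - char (?\<mu> Y) t) \<le> 0"
      by (rule LIMSEQ_le_const) (use bound in auto)
    then show ?thesis by simp
  qed
  then have "?\<mu> X = ?\<mu> Y" using rd X Y by (intro Levy_uniqueness) auto
  then have "distr (?\<mu> X) borel (\<lambda>x. - ln x) = distr (?\<mu> Y) borel (\<lambda>x. - ln x)" by simp
  then show ?thesis by (simp add: distr_distr o_def U_def)
qed

locale subordinator = 
  fixes M :: "'w measure" and S :: "real \<Rightarrow> 'w \<Rightarrow> real" and \<beta> :: real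
  assumes sub: "stable_subordinator M \<beta> S"
begin

sublocale prob_space M
  using sub by (simp add: stable_subordinator_def)

lemma S_meas: "0 \<le> t \<Longrightarrow> S t \<in> borel_measurable M"
  using sub by (simp add: stable_subordinator_def)

lemma laplace: "0 \<le> t \<Longrightarrow> 0 < l \<Longrightarrow> expectation (\<lambda>\<omega>. exp (- l * S t \<omega>)) = exp (- t * l powr \<beta>)"
  using sub by (simp add: stable_subordinator_def)

lemma S_mono: "0 \<le> s \<Longrightarrow> s \<le> t \<Longrightarrow> AE \<omega> in M. S s \<omega> \<le> S t \<omega>"
proof -
  assume st: "0 \<le> s" "s \<le> t"
  have "AE \<omega> in M. mono_on {0..} (\<lambda>t. S t \<omega>) \<and> (\<forall>t\<ge>0. continuous (at_right t) (\<lambda>t. S t \<omega>))"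
    using sub by (simp add: stable_subordinator_def)
  then show ?thesis by eventually_elim (use st in \<open>auto simp: mono_on_def\<close>)
qed

lemma S_nonneg: "0 \<le> t \<Longrightarrow> AE \<omega> in M. 0 \<le> S t \<omega>"
proof -
  assume t: "0 \<le> t"
  have "AE \<omega> in M. S 0 \<omega> = 0" using sub by (simp add: stable_subordinator_def)
  with S_mono[OF order_refl t] show ?thesis by eventually_elim simp
qed

text \<open>Both Laplace transforms at \<open>l\<close> equal
  \<open>exp (- (t / c powr \<beta>) * l powr \<beta>)\<close>.\<close>

lemma S_scaling:
  assumes t: "0 \<le> t" and c: "0 < c"
  shows "distr M borel (\<lambda>\<omega>. S t \<omega> / c) = distr M borel (S (t / c powr \<beta>))"
proof (rule laplace_transform_unique)
  have t': "0 \<le> t / c powr \<beta>" using t by simp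
  show "(\<lambda>\<omega>. S t \<omega> / c) \<in> borel_measurable M" using S_meas[OF t] by measurable
  show "S (t / c powr \<beta>) \<in> borel_measurable M" by (rule S_meas[OF t'])
  show "AE \<omega> in M. 0 \<le> S t \<omega> / c" using S_nonneg[OF t] by eventually_elim (use c in simp)
  show "AE \<omega> in M. 0 \<le> S (t / c powr \<beta>) \<omega>" by (rule S_nonneg[OF t'])
  fix l :: real assume l: "0 < l"
  have "expectation (\<lambda>\<omega>. exp (- l * (S t \<omega> / c))) = expectation (\<lambda>\<omega>. exp (- (l / c) * S t \<omega>))" by simp
  also have "\<dots> = exp (- t * (l / c) powr \<beta>)" using l c t by (intro laplace) auto
  also have "\<dots> = exp (- (t / c powr \<beta>) * l powr \<beta>)" using l c by (simp add: powr_divide)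
  also have "\<dots> = expectation (\<lambda>\<omega>. exp (- l * S (t / c powr \<beta>) \<omega>))" using laplace[OF t' l] by simp
  finally show "expectation (\<lambda>\<omega>. exp (- l * (S t \<omega> / c))) = expectation (\<lambda>\<omega>. exp (- l * S (t / c powr \<beta>) \<omega>))" .
qed

text \<open>For \<open>\<beta> < 1\<close> the mean of \<open>S t\<close> is infinite for
  \<open>t > 0\<close>, so only truncated expectations are available. The elementary bound
  \<open>min_one_le_exp\<close> converts the truncation into the Laplace transform at
  \<open>c\<close>.\<close>

lemma S_min_expectation:
  assumes t: "0 \<le> t" and c: "0 < c"
  shows "expectation (\<lambda>\<omega>. min 1 (c * S t \<omega>)) \<le> 2 * min 1 (t * c powr \<beta>)"
proof -
  have [measurable]: "S t \<in> borel_measurable M" by (rule S_meas[OF t])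
  have i1: "integrable M (\<lambda>\<omega>. min 1 (c * S t \<omega>))"
    using S_nonneg[OF t] c by (intro integrable_const_bound[of _ 1]) (auto elim!: AE_mp)
  have i2: "integrable M (\<lambda>\<omega>. exp (- c * S t \<omega>))"
    using S_nonneg[OF t] c by (intro integrable_const_bound[of _ 1]) (auto elim!: AE_mp)
  have "expectation (\<lambda>\<omega>. min 1 (c * S t \<omega>)) \<le> expectation (\<lambda>\<omega>. 2 * (1 - exp (- c * S t \<omega>)))"
  proof (rule integral_mono_AE[OF i1])
    show "integrable M (\<lambda>\<omega>. 2 * (1 - exp (- c * S t \<omega>)))" using i2 by simp
    show "AE \<omega> in M. min 1 (c * S t \<omega>) \<le> 2 * (1 - exp (- c * S t \<omega>))"
      using S_nonneg[OF t] by eventually_elim (use c min_one_le_exp[of "c * _"] in simp)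
  qed
  also have "\<dots> = 2 * (1 - exp (- t * c powr \<beta>))"
    using i2 laplace[OF t c] by (simp add: prob_space)
  also have "1 - exp (- t * c powr \<beta>) \<le> min 1 (t * c powr \<beta>)"
    using exp_ge_add_one_self[of "- t * c powr \<beta>"] by simp
  finally show ?thesis by simp
qed

end

lemma space_process_algebra [simp]: "space (process_algebra M X) = space M"
  by (simp add: process_algebra_def)

lemma process_algebra_measurable:
  assumes "0 \<le> t"
  shows "X t \<in> borel_measurable (process_algebra M X)"
proof -
  have "(\<lambda>\<omega>. \<lambda>t\<in>{0..}. X t \<omega>) \<in> measurable (process_algebra M X) (PiM {0..} (\<lambda>_. borel))"
    unfolding process_algebra_def by (rule measurable_vimage_algebra1) (auto simp: space_PiM)
  from measurable_compose[OF this measurable_component_singleton[of t]] assms show ?thesis by simp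
qed

section \<open>Killed Brownian motion at an independent stable time\<close>

locale killed_bm = brownian M W + subordinator M S \<beta>
  for M :: "'w measure" and W :: "real \<Rightarrow> 'w \<Rightarrow> 'a::euclidean_space" and S :: "real \<Rightarrow> 'w \<Rightarrow> real" and \<beta> :: real +
  assumes indep: "indep_processes M W S"
begin

definition alive :: "'a set \<Rightarrow> real \<Rightarrow> 'a \<Rightarrow> real" where
  "alive D t x = prob {\<omega> \<in> space M. exit_time D (\<lambda>s. x + W s \<omega>) > ereal (S t \<omega>)}"

lemma alive_bounds: "0 \<le> alive D t x" "alive D t x \<le> 1"
  by (auto simp: alive_def)

lemma exit_time_fst_measurable:
  assumes D: "open D" "D \<noteq> UNIV" and F: "continuous_process F W"
  shows "(\<lambda>\<omega>. exit_time D (\<lambda>s. x + W s \<omega>)) \<in> borel_measurable F"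
proof -
  have "(\<lambda>\<omega>. (x, \<omega>)) \<in> measurable F (borel \<Otimes>\<^sub>M F)" by measurable
  from measurable_compose[OF this continuous_process.exit_time_measurable[OF F D]] show ?thesis by simp
qed

lemma alive_measurable:
  assumes D: "open D" "D \<noteq> UNIV" and t: "0 \<le> t"
  shows "alive D t \<in> borel_measurable borel"
proof -
  have [measurable]: "S t \<in> borel_measurable M" by (rule S_meas[OF t])
  have [measurable]: "(\<lambda>z. exit_time D (\<lambda>t. fst z + W t (snd z))) \<in> borel_measurable (borel \<Otimes>\<^sub>M M)"
    by (rule exit_time_measurable[OF D])
  have "{z \<in> space (borel \<Otimes>\<^sub>M M). ereal (S t (snd z)) < exit_time D (\<lambda>t. fst z + W t (snd z))} \<in> sets (borel \<Otimes>\<^sub>M M)"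
    by measurable
  from measurable_emeasure_Pair[OF this]
  have "(\<lambda>x. enn2real (emeasure M (Pair x -` {z \<in> space (borel \<Otimes>\<^sub>M M). ereal (S t (snd z)) < exit_time D (\<lambda>t. fst z + W t (snd z))}))) \<in> borel_measurable borel"
    by measurable
  also have "(\<lambda>x. enn2real (emeasure M (Pair x -` {z \<in> space (borel \<Otimes>\<^sub>M M). ereal (S t (snd z)) < exit_time D (\<lambda>t. fst z + W t (snd z))}))) = alive D t"
    unfolding alive_def measure_def
    by (intro ext arg_cong[where f="\<lambda>A. enn2real (emeasure M A)"]) (auto simp: space_pair_measure)
  finally show ?thesis .
qed

text \<open>The exit time is measurable for the sigma-algebra generated by \<open>W\<close> alone,
  as \<open>continuous_process\<close> is instantiated with it. Independence of the process algebras
  then passes to these two random variables.\<close>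

lemma exit_indep:
  assumes D: "open D" "D \<noteq> UNIV" and t: "0 \<le> t"
  shows "indep_var borel (\<lambda>\<omega>. exit_time D (\<lambda>s. x + W s \<omega>)) borel (\<lambda>\<omega>. ereal (S t \<omega>))"
proof -
  have F: "continuous_process (process_algebra M W) W"
    by unfold_locales (auto intro: process_algebra_measurable W_cont)
  have \<tau>: "(\<lambda>\<omega>. exit_time D (\<lambda>s. x + W s \<omega>)) \<in> borel_measurable (process_algebra M W)"
    by (rule exit_time_fst_measurable[OF D F])
  have S: "(\<lambda>\<omega>. ereal (S t \<omega>)) \<in> borel_measurable (process_algebra M S)"
    using process_algebra_measurable[OF t, of S M] by measurable
  have sub: "sigma_sets (space M) {f -` A \<inter> space M |A. A \<in> sets borel} \<subseteq> sets (process_algebra M X)"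
    if f: "f \<in> borel_measurable (process_algebra M X)" for f :: "'w \<Rightarrow> 'c::topological_space" and X :: "real \<Rightarrow> 'w \<Rightarrow> 'd::topological_space"
  proof -
    have "{f -` A \<inter> space M |A. A \<in> sets borel} \<subseteq> sets (process_algebra M X)"
      using measurable_sets[OF f] by auto
    from sets.sigma_sets_subset[OF this] show ?thesis by simp
  qed
  have ind: "indep_set (sets (process_algebra M W)) (sets (process_algebra M S))"
    using indep by (simp add: indep_processes_def)
  show ?thesis
    unfolding indep_var_eq
  proof (intro conjI)
    show "(\<lambda>\<omega>. exit_time D (\<lambda>s. x + W s \<omega>)) \<in> borel_measurable M"
      by (rule exit_time_fst_measurable[OF D]) unfold_locales
    show "(\<lambda>\<omega>. ereal (S t \<omega>)) \<in> borel_measurable M" using S_meas[OF t] by measurable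
    show "indep_set (sigma_sets (space M) {(\<lambda>\<omega>. exit_time D (\<lambda>s. x + W s \<omega>)) -` A \<inter> space M |A. A \<in> sets borel})
      (sigma_sets (space M) {(\<lambda>\<omega>. ereal (S t \<omega>)) -` A \<inter> space M |A. A \<in> sets borel})"
      using ind sub[OF \<tau>] sub[OF S] unfolding indep_sets2_eq by blast
  qed
qed

lemma survival_measurable:
  assumes D: "open D" "D \<noteq> UNIV"
  shows "survival D x \<in> borel_measurable borel"
proof -
  have "mono (\<lambda>s. - survival D x s)" using survival_antimono[OF D] by (auto intro!: monoI)
  then have "(\<lambda>s. - survival D x s) \<in> borel_measurable borel" by (rule borel_measurable_mono)
  then show ?thesis by simp
qed

text \<open>By independence the joint law of exit time and \<open>S t\<close> is a product measure;
  integrating over the exit time with the clock frozen leaves the deterministic-time survival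
  probability. Scaling, monotonicity and additivity are all transferred through this
  formula.\<close>

lemma alive_eq:
  assumes D: "open D" "D \<noteq> UNIV" and x: "x \<in> D" and t: "0 \<le> t"
  shows "alive D t x = expectation (\<lambda>\<omega>. survival D x (S t \<omega>))"
    and "integrable M (\<lambda>\<omega>. survival D x (S t \<omega>))"
proof -
  define \<tau> where "\<tau> \<omega> = exit_time D (\<lambda>s. x + W s \<omega>)" for \<omega>
  have [measurable]: "S t \<in> borel_measurable M" by (rule S_meas[OF t])
  have [measurable]: "\<tau> \<in> borel_measurable M"
    unfolding \<tau>_def by (rule exit_time_fst_measurable[OF D]) unfold_locales
  have [measurable]: "survival D x \<in> borel_measurable borel" by (rule survival_measurable[OF D])
  show int: "integrable M (\<lambda>\<omega>. survival D x (S t \<omega>))"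
    by (rule integrable_const_bound[of _ 1]) (auto simp: survival_bounds)
  interpret T: prob_space "distr M borel \<tau>" by (rule prob_space_distr) simp
  define \<sigma> where "\<sigma> \<omega> = ereal (S t \<omega>)" for \<omega>
  have [measurable]: "\<sigma> \<in> borel_measurable M" unfolding \<sigma>_def by measurable
  interpret U: prob_space "distr M borel \<sigma>" by (rule prob_space_distr) simp
  interpret P: pair_sigma_finite "distr M borel \<tau>" "distr M borel \<sigma>" by unfold_locales
  let ?A = "{z :: ereal \<times> ereal. z \<in> space (borel \<Otimes>\<^sub>M borel) \<and> snd z < fst z}"
  have A: "?A \<in> sets (borel \<Otimes>\<^sub>M borel)" by measurable
  have eq: "distr M borel \<tau> \<Otimes>\<^sub>M distr M borel \<sigma> = distr M (borel \<Otimes>\<^sub>M borel) (\<lambda>\<omega>. (\<tau> \<omega>, \<sigma> \<omega>))"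
    using exit_indep[OF D t, of x] unfolding indep_var_distribution_eq \<tau>_def[symmetric] \<sigma>_def[symmetric] by simp
  have "?A \<in> sets (distr M borel \<tau> \<Otimes>\<^sub>M distr M borel \<sigma>)" using A by simp
  from P.measurable_emeasure_Pair2[OF this]
  have m: "(\<lambda>s. emeasure (distr M borel \<tau>) ((\<lambda>a. (a, s)) -` ?A)) \<in> borel_measurable borel" by simp
  have "emeasure M {\<omega> \<in> space M. ereal (S t \<omega>) < \<tau> \<omega>} = emeasure (distr M (borel \<Otimes>\<^sub>M borel) (\<lambda>\<omega>. (\<tau> \<omega>, \<sigma> \<omega>))) ?A"
    by (subst emeasure_distr[OF _ A]) (auto simp: space_pair_measure \<sigma>_def intro!: arg_cong[where f="emeasure M"])
  also have "\<dots> = (\<integral>\<^sup>+s. emeasure (distr M borel \<tau>) ((\<lambda>a. (a, s)) -` ?A) \<partial>distr M borel \<sigma>)"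
    unfolding eq[symmetric] by (rule P.emeasure_pair_measure_alt2) (use A in simp)
  also have "\<dots> = (\<integral>\<^sup>+\<omega>. emeasure (distr M borel \<tau>) ((\<lambda>a. (a, \<sigma> \<omega>)) -` ?A) \<partial>M)"
    by (rule nn_integral_distr) (use m in simp_all)
  also have "\<dots> = (\<integral>\<^sup>+\<omega>. ennreal (survival D x (S t \<omega>)) \<partial>M)"
  proof (rule nn_integral_cong_AE)
    show "AE \<omega> in M. emeasure (distr M borel \<tau>) ((\<lambda>a. (a, \<sigma> \<omega>)) -` ?A) = ennreal (survival D x (S t \<omega>))"
      using S_nonneg[OF t]
    proof eventually_elim
      case (elim \<omega>')
      define s where "s = S t \<omega>'"
      have "(\<lambda>a. (a, \<sigma> \<omega>')) -` ?A = {a. ereal s < a}" by (auto simp: space_pair_measure \<sigma>_def s_def)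
      then have "emeasure (distr M borel \<tau>) ((\<lambda>a. (a, \<sigma> \<omega>')) -` ?A) = emeasure M {\<omega> \<in> space M. ereal s < \<tau> \<omega>}"
        by (simp add: emeasure_distr vimage_def Int_def conj_commute)
      moreover have "prob {\<omega> \<in> space M. ereal s < \<tau> \<omega>} = survival D x s"
        unfolding survival_def
      proof (rule measure_eq_AE)
        show "{\<omega> \<in> space M. \<forall>u\<in>{0..s}. x + W u \<omega> \<in> D} \<in> events" by (rule survival_sets[OF D])
        show "{\<omega> \<in> space M. ereal s < \<tau> \<omega>} \<in> events" by measurable
        show "AE \<omega> in M. (\<omega> \<in> {\<omega> \<in> space M. ereal s < \<tau> \<omega>}) = (\<omega> \<in> {\<omega> \<in> space M. \<forall>u\<in>{0..s}. x + W u \<omega> \<in> D})"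
          using start AE_space
        proof eventually_elim
          fix \<omega> assume "W 0 \<omega> = 0" "\<omega> \<in> space M"
          then show "(\<omega> \<in> {\<omega> \<in> space M. ereal s < \<tau> \<omega>}) = (\<omega> \<in> {\<omega> \<in> space M. \<forall>u\<in>{0..s}. x + W u \<omega> \<in> D})"
            using exit_time_gt_iff_path[OF shifted_cont D(1), of \<omega> x s] x elim by (simp add: \<tau>_def s_def)
        qed
      qed
      ultimately show ?case by (simp add: emeasure_eq_measure s_def)
    qed
  qed
  also have "\<dots> = ennreal (expectation (\<lambda>\<omega>. survival D x (S t \<omega>)))"
    using int by (intro nn_integral_eq_integral) (auto simp: survival_bounds)
  finally have "ennreal (alive D t x) = ennreal (expectation (\<lambda>\<omega>. survival D x (S t \<omega>)))"
    by (simp add: alive_def \<tau>_def emeasure_eq_measure)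
  then show "alive D t x = expectation (\<lambda>\<omega>. survival D x (S t \<omega>))"
    by (subst (asm) ennreal_inj) (auto simp: alive_bounds survival_bounds intro!: integral_nonneg_AE)
qed

lemma alive_antimono:
  assumes D: "open D" "D \<noteq> UNIV" and x: "x \<in> D" and st: "0 \<le> s" "s \<le> t"
  shows "alive D t x \<le> alive D s x"
proof -
  have t: "0 \<le> t" using st by simp
  show ?thesis
    unfolding alive_eq(1)[OF D x t] alive_eq(1)[OF D x st(1)]
    using S_mono[OF st] by (intro integral_mono_AE alive_eq(2)[OF D x] t st)
      (auto intro: survival_antimono[OF D] elim!: AE_mp)
qed

lemma alive_disjoint_Un:
  assumes A: "open A" and B: "open B" and AB: "A \<inter> B = {}" "A \<union> B \<noteq> UNIV" and x: "x \<in> A" and t: "0 \<le> t"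
  shows "alive (A \<union> B) t x = alive A t x"
proof -
  have "A \<noteq> UNIV" using AB by auto
  then show ?thesis
    using alive_eq(1)[of "A \<union> B" x t] alive_eq(1)[of A x t] survival_disjoint_Un[OF A B AB x] open_Un[OF A B] A AB x t
    by simp
qed

text \<open>Brownian scaling divides the clock by \<open>r\<^sup>2\<close>, and stable scaling turns
  this into a division of \<open>t\<close> by \<open>r powr (2 * \<beta>)\<close>.\<close>

lemma alive_similitude:
  fixes R :: "'a \<Rightarrow> 'a"
  assumes R: "similitude R r" and D: "open D" "D \<noteq> UNIV" and x: "x \<in> D" and t: "0 \<le> t"
  shows "alive (R ` D) t (R x) = alive D (t / r powr (2 * \<beta>)) x"
proof -
  have r: "0 < r" using R by (simp add: similitude_def)
  have inj: "R x = R y \<Longrightarrow> x = y" for x y using similitude_inverse[OF R] by metis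
  have RD: "open (R ` D)" "R ` D \<noteq> UNIV"
  proof -
    show "open (R ` D)" by (rule similitude_image_open[OF R D(1)])
    obtain y where "y \<notin> D" using D(2) by blast
    then have "R y \<notin> R ` D" using inj by auto
    then show "R ` D \<noteq> UNIV" by blast
  qed
  have [measurable]: "survival D x \<in> borel_measurable borel" by (rule survival_measurable[OF D])
  have [measurable]: "S t \<in> borel_measurable M" by (rule S_meas[OF t])
  define t' where "t' = t / (r\<^sup>2) powr \<beta>"
  have t': "0 \<le> t'" using t by (simp add: t'_def)
  have [measurable]: "S t' \<in> borel_measurable M" by (rule S_meas[OF t'])
  have "alive (R ` D) t (R x) = expectation (\<lambda>\<omega>. survival (R ` D) (R x) (S t \<omega>))"
    using x by (intro alive_eq(1)[OF RD _ t]) auto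
  also have "\<dots> = expectation (\<lambda>\<omega>. survival D x (S t \<omega> / r\<^sup>2))"
    using alive_eq(2)[OF RD _ t, of "R x"] x
  proof (intro integral_cong_AE)
    show "AE \<omega> in M. survival (R ` D) (R x) (S t \<omega>) = survival D x (S t \<omega> / r\<^sup>2)"
      using S_nonneg[OF t] by eventually_elim (rule survival_similitude[OF R D _ x])
  qed auto
  also have "\<dots> = (\<integral>s. survival D x s \<partial>distr M borel (\<lambda>\<omega>. S t \<omega> / r\<^sup>2))"
    by (subst integral_distr) auto
  also have "\<dots> = (\<integral>s. survival D x s \<partial>distr M borel (S t'))"
    unfolding t'_def using r t by (subst S_scaling) auto
  also have "\<dots> = alive D t' x"
    by (subst integral_distr) (auto simp: alive_eq(1)[OF D x t'])
  also have "t' = t / r powr (2 * \<beta>)"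
    using r by (simp add: t'_def powr_powr flip: powr_numeral)
  finally show ?thesis .
qed

text \<open>Averaging \<open>survival_lower\<close> over the clock bounds the exit probability by
  the expectation of a truncated multiple of \<open>S t\<close>, with multiplier of order
  \<open>\<delta>\<close> to the power -2. The Laplace bound raises that multiplier to the power
  \<open>\<beta>\<close>, which produces the exponent \<open>- 2 * \<beta>\<close>.\<close>

lemma alive_lower:
  assumes D: "open D" "D \<noteq> UNIV" and \<beta>: "0 < \<beta>"
  obtains C where "0 \<le> C" "\<And>t x. 0 \<le> t \<Longrightarrow> x \<in> D \<Longrightarrow> 1 - alive D t x \<le> C * min 1 (t * infdist x (- D) powr (- 2 * \<beta>))"
proof -
  define c where "c = 128 * 2 powr (real DIM('a) / 2)"
  have c: "0 < c" by (simp add: c_def)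
  show ?thesis
  proof (rule that[of "2 * max 1 (c powr \<beta>)"])
    fix t :: real and x assume t: "0 \<le> t" and x: "x \<in> D"
    define \<delta> where "\<delta> = infdist x (- D)"
    have ne: "- D \<noteq> {}" using D by auto
    have \<delta>: "0 < \<delta>" unfolding \<delta>_def using x D ne by (metis ComplD closed_Compl infdist_pos_not_in_closed)
    have [measurable]: "S t \<in> borel_measurable M" by (rule S_meas[OF t])
    have "1 - alive D t x = expectation (\<lambda>\<omega>. 1 - survival D x (S t \<omega>))"
      using alive_eq[OF D x t] by (simp add: prob_space)
    also have "\<dots> \<le> expectation (\<lambda>\<omega>. min 1 (c / \<delta>\<^sup>2 * S t \<omega>))"
    proof (rule integral_mono_AE)
      show "integrable M (\<lambda>\<omega>. 1 - survival D x (S t \<omega>))" using alive_eq(2)[OF D x t] by simp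
      show "integrable M (\<lambda>\<omega>. min 1 (c / \<delta>\<^sup>2 * S t \<omega>))"
        using S_nonneg[OF t] c by (intro integrable_const_bound[of _ 1]) (auto elim!: AE_mp)
      show "AE \<omega> in M. 1 - survival D x (S t \<omega>) \<le> min 1 (c / \<delta>\<^sup>2 * S t \<omega>)"
        using S_nonneg[OF t]
      proof eventually_elim
        case (elim \<omega>)
        show ?case using survival_lower[OF D x elim] survival_bounds(1)[of D x "S t \<omega>"]
          by (simp add: c_def \<delta>_def)
      qed
    qed
    also have "\<dots> \<le> 2 * min 1 (t * (c / \<delta>\<^sup>2) powr \<beta>)"
      using c \<delta> t by (intro S_min_expectation) auto
    also have "(c / \<delta>\<^sup>2) powr \<beta> = c powr \<beta> * \<delta> powr (- 2 * \<beta>)"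
    proof -
      have "(\<delta>\<^sup>2) powr \<beta> = \<delta> powr (2 * \<beta>)" using \<delta> by (simp add: powr_powr flip: powr_numeral)
      then show ?thesis using c \<delta> by (simp add: powr_divide powr_minus_divide)
    qed
    \<comment> \<open>A constant leaves the truncation at the cost of replacing it by its maximum
      with 1.\<close>
    also have "min 1 (t * (c powr \<beta> * \<delta> powr (- 2 * \<beta>))) \<le> max 1 (c powr \<beta>) * min 1 (t * \<delta> powr (- 2 * \<beta>))"
    proof -
      define q where "q = t * \<delta> powr (- 2 * \<beta>)"
      have q: "0 \<le> q" using t by (simp add: q_def)
      have "min 1 (c powr \<beta> * q) \<le> max 1 (c powr \<beta>) * min 1 q"
      proof (cases "q \<le> 1")
        case True
        then show ?thesis using q mult_right_mono[of "c powr \<beta>" "max 1 (c powr \<beta>)" q] by auto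
      qed auto
      then show ?thesis by (simp add: q_def mult.left_commute)
    qed
    finally show "1 - alive D t x \<le> 2 * max 1 (c powr \<beta>) * min 1 (t * infdist x (- D) powr (- 2 * \<beta>))"
      by (simp add: \<delta>_def)
  qed simp
qed

end

section \<open>Heat content of the self-similar set\<close>

context killed_bm
begin

text \<open>Kept as a nonnegative integral with extended values over \<open>lborel\<close>, so that
  additivity and changes of variables need no integrability; \<open>heat_content_eq\<close> returns
  to the real quantity.\<close>

definition heat_loss :: "'a set \<Rightarrow> real \<Rightarrow> ennreal" where
  "heat_loss D t = (\<integral>\<^sup>+x\<in>D. ennreal (1 - alive D t x) \<partial>lborel)"

lemma heat_loss_le: "heat_loss D t \<le> emeasure lborel D" if "open D"
proof -
  have "heat_loss D t \<le> (\<integral>\<^sup>+x. indicator D x \<partial>lborel)"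
    unfolding heat_loss_def using alive_bounds by (intro nn_integral_mono) (auto simp: indicator_def)
  then show ?thesis using that by simp
qed

lemma finite_volume_neq_UNIV: "emeasure lborel D < \<infinity> \<Longrightarrow> D \<noteq> (UNIV :: 'a set)"
  by auto

lemma heat_content_eq:
  assumes D: "open D" "emeasure lborel D < \<infinity>" and t: "0 \<le> t"
  shows "measure lebesgue D - spectral_heat_content M W S D t = enn2real (heat_loss D t)"
proof -
  have DU: "D \<noteq> UNIV" by (rule finite_volume_neq_UNIV[OF D(2)])
  have [measurable]: "alive D t \<in> borel_measurable borel" by (rule alive_measurable[OF D(1) DU t])
  have [measurable]: "D \<in> sets borel" using D by simp
  have one: "integrable lborel (\<lambda>x. indicat_real D x)" using D by simp
  have int: "integrable lborel (\<lambda>x. indicat_real D x * alive D t x)"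
    by (rule Bochner_Integration.integrable_bound[OF one]) (auto simp: indicator_def alive_bounds)
  have "spectral_heat_content M W S D t = (LINT x:D|lebesgue. alive D t x)"
    by (simp add: spectral_heat_content_def alive_def)
  also have "\<dots> = (\<integral>x. indicat_real D x * alive D t x \<partial>lborel)"
    unfolding set_lebesgue_integral_def by (subst integral_completion) auto
  finally have "measure lebesgue D - spectral_heat_content M W S D t =
      (\<integral>x. indicat_real D x \<partial>lborel) - (\<integral>x. indicat_real D x * alive D t x \<partial>lborel)"
    by (simp add: measure_completion)
  also have "\<dots> = (\<integral>x. indicat_real D x * (1 - alive D t x) \<partial>lborel)"
    using Bochner_Integration.integral_diff[OF one int] by (simp add: right_diff_distrib)
  also have "\<dots> = enn2real (\<integral>\<^sup>+x. ennreal (indicat_real D x * (1 - alive D t x)) \<partial>lborel)"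
    by (rule integral_eq_nn_integral) (auto simp: alive_bounds)
  also have "(\<integral>\<^sup>+x. ennreal (indicat_real D x * (1 - alive D t x)) \<partial>lborel) = heat_loss D t"
    unfolding heat_loss_def by (intro nn_integral_cong) (auto simp: indicator_def)
  finally show ?thesis .
qed

lemma heat_loss_mono:
  assumes D: "open D" "emeasure lborel D < \<infinity>" and st: "0 \<le> s" "s \<le> t"
  shows "heat_loss D s \<le> heat_loss D t"
  unfolding heat_loss_def using alive_antimono[OF D(1) finite_volume_neq_UNIV[OF D(2)] _ st]
  by (intro nn_integral_mono) (auto simp: indicator_def intro!: ennreal_leI)

text \<open>By continuity of paths, survival from a point of either piece does not notice the other,
  so the integrand splits. The finite volume of the union guarantees a nonempty complement.\<close>

lemma heat_loss_Un:
  assumes A: "open A" and B: "open B" and AB: "A \<inter> B = {}" and fin: "emeasure lborel (A \<union> B) < \<infinity>"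
    and t: "0 \<le> t"
  shows "heat_loss (A \<union> B) t = heat_loss A t + heat_loss B t"
proof -
  have ne: "A \<union> B \<noteq> UNIV" by (rule finite_volume_neq_UNIV[OF fin])
  have [measurable]: "alive A t \<in> borel_measurable borel" "alive B t \<in> borel_measurable borel"
    using A B ne t by (auto intro!: alive_measurable)
  have [measurable]: "A \<in> sets borel" "B \<in> sets borel" using A B by auto
  have a: "alive (A \<union> B) t x = alive A t x" if "x \<in> A" for x
    by (rule alive_disjoint_Un[OF A B AB ne that t])
  have b: "alive (A \<union> B) t x = alive B t x" if "x \<in> B" for x
    using alive_disjoint_Un[OF B A _ _ that t] AB ne by (simp add: Un_commute Int_commute)
  have "heat_loss (A \<union> B) t = (\<integral>\<^sup>+x. ennreal (1 - alive A t x) * indicator A x + ennreal (1 - alive B t x) * indicator B x \<partial>lborel)"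
    unfolding heat_loss_def
  proof (rule nn_integral_cong)
    fix x
    have "\<not> (x \<in> A \<and> x \<in> B)" using AB by blast
    then show "ennreal (1 - alive (A \<union> B) t x) * indicator (A \<union> B) x =
        ennreal (1 - alive A t x) * indicator A x + ennreal (1 - alive B t x) * indicator B x"
      using a[of x] b[of x] by (auto simp: indicator_def)
  qed
  also have "\<dots> = heat_loss A t + heat_loss B t"
    unfolding heat_loss_def by (rule nn_integral_add) auto
  finally show ?thesis .
qed

lemma heat_loss_UNION:
  assumes I: "finite I" and A: "\<And>i. i \<in> I \<Longrightarrow> open (A i)" and disj: "disjoint_family_on A I"
    and fin: "emeasure lborel (\<Union>i\<in>I. A i) < \<infinity>" and t: "0 \<le> t"
  shows "heat_loss (\<Union>i\<in>I. A i) t = (\<Sum>i\<in>I. heat_loss (A i) t)"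
  using I A disj fin
proof (induction I)
  case empty
  then show ?case by (simp add: heat_loss_def)
next
  case (insert i I)
  let ?U = "\<Union>i\<in>I. A i"
  have U: "open ?U" using insert.prems by auto
  have i: "A i \<inter> ?U = {}" using insert.prems(2) insert.hyps by (auto simp: disjoint_family_on_def)
  have "emeasure lborel ?U \<le> emeasure lborel (\<Union>i\<in>insert i I. A i)"
    using insert.prems by (intro emeasure_mono) (auto intro!: borel_open)
  then have "emeasure lborel ?U < \<infinity>" using insert.prems(3) by (rule le_less_trans)
  then have IH: "heat_loss ?U t = (\<Sum>i\<in>I. heat_loss (A i) t)"
    using insert.prems by (intro insert.IH) (auto simp: disjoint_family_on_def)
  have "heat_loss (A i \<union> ?U) t = heat_loss (A i) t + heat_loss ?U t"
    using insert.prems by (intro heat_loss_Un U i t) auto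
  then show ?case using insert.hyps IH by simp
qed

lemma heat_loss_similitude:
  assumes R: "similitude R r" and D: "open D" "emeasure lborel D < \<infinity>" and t: "0 \<le> t"
  shows "heat_loss (R ` D) t = ennreal (r ^ DIM('a)) * heat_loss D (t / r powr (2 * \<beta>))"
proof -
  have DU: "D \<noteq> UNIV" by (rule finite_volume_neq_UNIV[OF D(2)])
  have RDo: "open (R ` D)" by (rule similitude_image_open[OF R D(1)])
  have "emeasure lborel (R ` D) < \<infinity>"
    using D(2) by (simp add: emeasure_similitude_image[OF R D(1)] ennreal_mult_less_top)
  then have RDU: "R ` D \<noteq> UNIV" by (rule finite_volume_neq_UNIV)
  have inj: "R x = R y \<Longrightarrow> x = y" for x y using similitude_inverse[OF R] by metis
  have [measurable]: "alive (R ` D) t \<in> borel_measurable borel" by (rule alive_measurable[OF RDo RDU t])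
  have [measurable]: "R ` D \<in> sets borel" using RDo by simp
  have "heat_loss (R ` D) t = ennreal (r ^ DIM('a)) * (\<integral>\<^sup>+x. ennreal (1 - alive (R ` D) t (R x)) * indicator (R ` D) (R x) \<partial>lborel)"
    unfolding heat_loss_def by (rule nn_integral_similitude[OF R]) measurable
  also have "(\<integral>\<^sup>+x. ennreal (1 - alive (R ` D) t (R x)) * indicator (R ` D) (R x) \<partial>lborel) = heat_loss D (t / r powr (2 * \<beta>))"
    unfolding heat_loss_def
  proof (rule nn_integral_cong)
    fix x
    have "R x \<in> R ` D \<longleftrightarrow> x \<in> D" using inj by auto
    then show "ennreal (1 - alive (R ` D) t (R x)) * indicator (R ` D) (R x) =
        ennreal (1 - alive D (t / r powr (2 * \<beta>)) x) * indicator D x"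
      using alive_similitude[OF R D(1) DU _ t] by (auto simp: indicator_def)
  qed
  finally show ?thesis .
qed

text \<open>The exit estimate is integrated against the thin layers. The free parameter
  \<open>p\<close> trades the integrability of the distance, which wants \<open>p < 1\<close>,
  against the decay in \<open>t\<close>.\<close>

lemma heat_loss_bound:
  assumes D: "open D" "emeasure lborel D < \<infinity>" and layer: "\<And>e. 0 < e \<Longrightarrow> measure lborel (boundary_layer D e) \<le> C * e"
    and \<beta>: "0 < \<beta>" and p: "0 < p" "p < 1" "p \<le> 2 * \<beta>"
  obtains C' where "0 \<le> C'" "\<And>t. 0 < t \<Longrightarrow> heat_loss D t \<le> ennreal (C' * t powr (p / (2 * \<beta>)))"
proof -
  have DU: "D \<noteq> UNIV" by (rule finite_volume_neq_UNIV[OF D(2)])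
  obtain C1 where C1: "0 \<le> C1" "\<And>t x. 0 \<le> t \<Longrightarrow> x \<in> D \<Longrightarrow> 1 - alive D t x \<le> C1 * min 1 (t * infdist x (- D) powr (- 2 * \<beta>))"
    using alive_lower[OF D(1) DU \<beta>] by blast
  obtain C2 where C2: "0 \<le> C2" "\<And>t. 0 < t \<Longrightarrow> (\<integral>\<^sup>+x\<in>D. ennreal (min 1 (t * infdist x (- D) powr - (2 * \<beta>))) \<partial>lborel)
    \<le> ennreal (C2 * t powr (p / (2 * \<beta>)))"
    using boundary_layer_min_integral[OF D layer p] by blast
  have [measurable]: "D \<in> sets borel" using D by simp
  have [measurable]: "(\<lambda>x. infdist x (- D)) \<in> borel_measurable borel"
    by (intro borel_measurable_continuous_onI continuous_on_infdist continuous_on_id)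
  show ?thesis
  proof (rule that[of "C1 * C2"])
    fix t :: real assume t: "0 < t"
    have "heat_loss D t \<le> (\<integral>\<^sup>+x. ennreal C1 * (ennreal (min 1 (t * infdist x (- D) powr - (2 * \<beta>))) * indicator D x) \<partial>lborel)"
      unfolding heat_loss_def
    proof (rule nn_integral_mono)
      fix x
      show "ennreal (1 - alive D t x) * indicator D x \<le> ennreal C1 * (ennreal (min 1 (t * infdist x (- D) powr - (2 * \<beta>))) * indicator D x)"
        using C1(2)[of t x] t C1(1) by (auto simp: indicator_def ennreal_leI simp flip: ennreal_mult)
    qed
    also have "\<dots> = ennreal C1 * (\<integral>\<^sup>+x\<in>D. ennreal (min 1 (t * infdist x (- D) powr - (2 * \<beta>))) \<partial>lborel)"
      by (rule nn_integral_cmult) measurable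
    also have "\<dots> \<le> ennreal C1 * ennreal (C2 * t powr (p / (2 * \<beta>)))"
      by (intro mult_left_mono C2 t) simp
    also have "\<dots> = ennreal (C1 * C2 * t powr (p / (2 * \<beta>)))"
      using C1 C2 by (simp add: mult.assoc flip: ennreal_mult)
    finally show "heat_loss D t \<le> ennreal (C1 * C2 * t powr (p / (2 * \<beta>)))" .
  qed (use C1 C2 in auto)
qed

end

section \<open>Levels and volume of the self-similar set\<close>

lemma word_map_Nil [simp]: "word_map R [] = id"
  by (simp add: word_map_def)

lemma word_map_Cons [simp]: "word_map R (j # js) = R j \<circ> word_map R js"
  by (simp add: word_map_def)

definition level_set :: "(nat \<Rightarrow> 'a \<Rightarrow> 'a) \<Rightarrow> nat \<Rightarrow> 'a set \<Rightarrow> nat \<Rightarrow> 'a set" where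
  "level_set R N G0 n = (\<Union>js\<in>{js. length js = n \<and> set js \<subseteq> {1..N}}. word_map R js ` G0)"

lemma level_set_0: "level_set R N G0 0 = G0"
  by (simp add: level_set_def)

text \<open>The first letter of a word is the outermost map, so splitting it off leaves the images
  of the preceding level. This yields the fixed-point equation of the self-similar set.\<close>

lemma level_set_Suc: "level_set R N G0 (Suc n) = (\<Union>j\<in>{1..N}. R j ` level_set R N G0 n)"
proof (intro equalityI subsetI)
  fix x assume "x \<in> level_set R N G0 (Suc n)"
  then obtain js y where js: "length js = Suc n" "set js \<subseteq> {1..N}" "y \<in> G0" "x = word_map R js y"
    by (auto simp: level_set_def)
  then obtain j ks where "js = j # ks" by (cases js) auto
  then show "x \<in> (\<Union>j\<in>{1..N}. R j ` level_set R N G0 n)"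
    using js unfolding level_set_def by (auto intro!: bexI[of _ j] imageI)
next
  fix x assume "x \<in> (\<Union>j\<in>{1..N}. R j ` level_set R N G0 n)"
  then obtain j js y where "j \<in> {1..N}" "length js = n" "set js \<subseteq> {1..N}" "y \<in> G0" "x = R j (word_map R js y)"
    by (auto simp: level_set_def)
  then show "x \<in> level_set R N G0 (Suc n)"
    unfolding level_set_def by (intro UN_I[of "j # js"]) auto
qed

lemma self_similar_set_levels: "self_similar_set R N G0 = (\<Union>n. level_set R N G0 n)"
proof -
  have "self_similar_set R N G0 = (\<Union>n\<in>{1..}. level_set R N G0 n) \<union> level_set R N G0 0"
    by (simp add: self_similar_set_def level_set_def)
  also have "\<dots> = (\<Union>n\<in>{1..} \<union> {0}. level_set R N G0 n)" by blast
  also have "{1..} \<union> {0} = (UNIV :: nat set)" by auto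
  finally show ?thesis by simp
qed

lemma self_similar_set_fixpoint:
  "self_similar_set R N G0 = (\<Union>j\<in>{1..N}. R j ` self_similar_set R N G0) \<union> G0"
proof -
  have "(\<Union>n. level_set R N G0 n) = level_set R N G0 0 \<union> (\<Union>n. level_set R N G0 (Suc n))"
    by (subst UNIV_nat_eq) simp
  then show ?thesis unfolding self_similar_set_levels level_set_Suc level_set_0 by blast
qed

text \<open>By subadditivity each level has at most \<open>q\<close> times the volume of the
  preceding one, where \<open>q\<close> is the sum of the volume ratios; as \<open>q < 1\<close>,
  the levels sum like a geometric series.\<close>

lemma self_similar_set_volume:
  fixes R :: "nat \<Rightarrow> 'a::euclidean_space \<Rightarrow> 'a"
  assumes R: "\<And>j. j \<in> {1..N} \<Longrightarrow> similitude (R j) (r j)" and r: "(\<Sum>j=1..N. r j ^ DIM('a)) < 1"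
    and G0: "open G0" "emeasure lborel G0 < \<infinity>"
  shows "open (self_similar_set R N G0)" "emeasure lborel (self_similar_set R N G0) < \<infinity>"
proof -
  define q where "q = (\<Sum>j=1..N. r j ^ DIM('a))"
  have r0: "0 \<le> r j" if "j \<in> {1..N}" for j using R[OF that] by (simp add: similitude_def)
  have q: "0 \<le> q" "q < 1" using r r0 by (auto simp: q_def intro!: sum_nonneg)
  have lev_open: "open (level_set R N G0 n)" for n
    by (induction n) (auto simp: level_set_0 level_set_Suc G0 intro!: open_UN similitude_image_open[OF R])
  then show "open (self_similar_set R N G0)" unfolding self_similar_set_levels by auto
  have lev: "emeasure lborel (level_set R N G0 n) \<le> ennreal (q ^ n) * emeasure lborel G0" for n
  proof (induction n)
    case 0
    then show ?case by (simp add: level_set_0)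
  next
    case (Suc n)
    have "emeasure lborel (level_set R N G0 (Suc n)) \<le> (\<Sum>j=1..N. emeasure lborel (R j ` level_set R N G0 n))"
      unfolding level_set_Suc
      by (intro emeasure_subadditive_finite) (auto intro!: borel_open similitude_image_open[OF R] lev_open)
    also have "\<dots> = (\<Sum>j=1..N. ennreal (r j ^ DIM('a)) * emeasure lborel (level_set R N G0 n))"
      by (intro sum.cong refl emeasure_similitude_image[OF R lev_open])
    also have "\<dots> = ennreal q * emeasure lborel (level_set R N G0 n)"
    proof -
      have "(\<Sum>j=1..N. ennreal (r j ^ DIM('a))) = ennreal q"
        unfolding q_def by (rule sum_ennreal) (use r0 in auto)
      then show ?thesis by (simp only: sum_distrib_right[symmetric])
    qed
    also have "\<dots> \<le> ennreal q * (ennreal (q ^ n) * emeasure lborel G0)"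
      by (intro mult_left_mono Suc) simp
    also have "\<dots> = ennreal (q ^ Suc n) * emeasure lborel G0"
      using q by (simp add: ennreal_mult mult.assoc)
    finally show ?case .
  qed
  have "emeasure lborel (self_similar_set R N G0) \<le> (\<Sum>n. emeasure lborel (level_set R N G0 n))"
    unfolding self_similar_set_levels using lev_open by (intro emeasure_subadditive_countably) auto
  also have "\<dots> \<le> (\<Sum>n. ennreal (q ^ n) * emeasure lborel G0)"
    by (intro suminf_le lev) auto
  also have "\<dots> = ennreal (\<Sum>n. q ^ n) * emeasure lborel G0"
    using q by (subst ennreal_suminf_multc, subst suminf_ennreal2) (auto intro: summable_geometric)
  also have "\<dots> < \<infinity>" using G0 by (simp add: ennreal_mult_less_top)
  finally show "emeasure lborel (self_similar_set R N G0) < \<infinity>" .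
qed

section \<open>The span of an arithmetic set\<close>

text \<open>The operator \<open>GREATEST\<close> says something only if a maximum exists. Every
  positive admissible number is \<open>x0 / k\<close> for a positive integer \<open>k\<close>, so
  the maximum corresponds to the least such \<open>k\<close>.\<close>

lemma arithmetic_span_properties:
  assumes A: "finite A" "A \<noteq> {}" "\<And>x. x \<in> A \<Longrightarrow> 0 < x" "arithmetic A"
  shows "0 < arithmetic_span A" "\<And>x. x \<in> A \<Longrightarrow> x / arithmetic_span A \<in> \<int>"
    "\<And>\<gamma>. \<gamma> \<noteq> 0 \<Longrightarrow> (\<And>x. x \<in> A \<Longrightarrow> x / \<gamma> \<in> \<int>) \<Longrightarrow> \<gamma> \<le> arithmetic_span A"
proof -
  let ?P = "\<lambda>\<gamma>. \<gamma> \<noteq> 0 \<and> (\<forall>x\<in>A. x / \<gamma> \<in> \<int>)"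
  obtain x0 where x0: "x0 \<in> A" "0 < x0" using A by blast
  have "\<exists>q::nat. 0 < q \<and> real q * (x / x0) \<in> \<int>" if x: "x \<in> A" for x
  proof -
    have "x / x0 \<in> \<rat>" using A(4) x x0 by (simp add: arithmetic_def)
    then obtain m n where mn: "n > 0" "x / x0 = of_int m / of_int n" using Rats_cases' by metis
    then have "real (nat n) * (x / x0) = of_int m" by simp
    then show ?thesis using mn(1) by (metis Ints_of_int zero_less_nat_eq)
  qed
  then obtain q :: "real \<Rightarrow> nat" where q: "\<And>x. x \<in> A \<Longrightarrow> 0 < q x" "\<And>x. x \<in> A \<Longrightarrow> real (q x) * (x / x0) \<in> \<int>"
    by metis
  \<comment> \<open>The product of the denominators of all \<open>x / x0\<close> clears them
    simultaneously.\<close>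
  have ex: "0 < prod q A \<and> ?P (x0 / real (prod q A))"
  proof (intro conjI ballI)
    show pos: "0 < prod q A" using q by (simp add: prod_pos)
    then show "x0 / real (prod q A) \<noteq> 0" using x0 by (simp del: of_nat_prod)
    fix x assume x: "x \<in> A"
    have eq: "x / (x0 / real (prod q A)) = real (prod q (A - {x})) * (real (q x) * (x / x0))"
      unfolding prod.remove[OF A(1) x, of q] by (simp del: of_nat_prod)
    show "x / (x0 / real (prod q A)) \<in> \<int>" unfolding eq by (intro Ints_mult Ints_of_nat q(2) x)
  qed
  define k where "k = (LEAST k. 0 < k \<and> ?P (x0 / real k))"
  have k: "0 < k" "?P (x0 / real k)"
    using LeastI[of "\<lambda>k. 0 < k \<and> ?P (x0 / real k)", OF ex] unfolding k_def by auto
  have max: "\<gamma> \<le> x0 / real k" if \<gamma>: "?P \<gamma>" for \<gamma>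
  proof (cases "0 < \<gamma>")
    case True
    obtain m where m: "x0 / \<gamma> = of_int m" using \<gamma> x0 by (metis Ints_cases)
    have "0 < (of_int m :: real)" unfolding m[symmetric] using True x0 by simp
    then have m0: "0 < m" by simp
    have "\<gamma> = x0 / real (nat m)" using m m0 True by (simp add: field_simps)
    then have "k \<le> nat m" unfolding k_def using \<gamma> m0 by (intro Least_le) auto
    then have "x0 / real (nat m) \<le> x0 / real k" using k x0 by (intro divide_left_mono) auto
    then show ?thesis using \<open>\<gamma> = x0 / real (nat m)\<close> by simp
  next
    case False
    have "0 < x0 / real k" using k x0 by simp
    then show ?thesis using False by linarith
  qed
  have span: "arithmetic_span A = x0 / real k"
    unfolding arithmetic_span_def by (rule Greatest_equality[of ?P, OF k(2) max])
  show "0 < arithmetic_span A" unfolding span using k x0 by simp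
  show "x / arithmetic_span A \<in> \<int>" if "x \<in> A" for x unfolding span using k that by blast
  show "\<gamma> \<le> arithmetic_span A" if "\<gamma> \<noteq> 0" "\<And>x. x \<in> A \<Longrightarrow> x / \<gamma> \<in> \<int>" for \<gamma>
    unfolding span using that by (intro max) auto
qed

section \<open>The logarithmic time scale\<close>

text \<open>The substitution \<open>t = exp (- z)\<close> with Jacobian \<open>exp (- z)\<close>; it
  identifies the two integral formulas for the constant.\<close>

lemma exp_substitution:
  fixes f :: "real \<Rightarrow> real"
  assumes int: "integrable lebesgue (\<lambda>z. exp (- z) * f (exp (- z)))"
  shows "set_integrable lebesgue {0<..} f"
    "(LINT t:{0<..}|lebesgue. f t) = (LINT z|lebesgue. exp (- z) * f (exp (- z)))"
proof -
  have img: "(\<lambda>z::real. exp (- z)) ` UNIV = {0<..}"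
  proof (intro equalityI subsetI)
    fix t :: real assume "t \<in> {0<..}"
    then show "t \<in> range (\<lambda>z. exp (- z))" by (intro image_eqI[of _ _ "- ln t"]) auto
  qed auto
  have a: "(\<lambda>z. \<bar>- exp (- z)\<bar> * f (exp (- z))) absolutely_integrable_on UNIV"
    using int by (simp add: set_integrable_def)
  have "((\<lambda>z. exp (- z)) has_real_derivative - exp (- z)) (at z within UNIV)" for z :: real
    by (auto intro!: derivative_eq_intros)
  then have iff: "(\<lambda>z. \<bar>- exp (- z)\<bar> * f (exp (- z))) absolutely_integrable_on UNIV \<and>
      integral UNIV (\<lambda>z. \<bar>- exp (- z)\<bar> * f (exp (- z))) = c \<longleftrightarrow>
      f absolutely_integrable_on {0<..} \<and> integral {0<..} f = c" for c
    using has_absolute_integral_change_of_variables_real[of UNIV "\<lambda>z. exp (- z)" "\<lambda>z. - exp (- z)" f c]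
    by (auto simp: img inj_on_def)
  then have f: "f absolutely_integrable_on {0<..}"
    "integral {0<..} f = integral UNIV (\<lambda>z. \<bar>- exp (- z)\<bar> * f (exp (- z)))"
    using a by blast+
  show "set_integrable lebesgue {0<..} f" using f(1) .
  have "(LINT t:{0<..}|lebesgue. f t) = integral {0<..} f" by (rule set_lebesgue_integral_eq_integral(2)[OF f(1)])
  also have "\<dots> = (LINT z:UNIV|lebesgue. \<bar>- exp (- z)\<bar> * f (exp (- z)))"
    unfolding f(2) by (rule set_lebesgue_integral_eq_integral(2)[OF a, symmetric])
  finally show "(LINT t:{0<..}|lebesgue. f t) = (LINT z|lebesgue. exp (- z) * f (exp (- z)))"
    by (simp add: set_lebesgue_integral_def)
qed

lemma smallo_from_log_scale:
  fixes E :: "real \<Rightarrow> real"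
  assumes "((\<lambda>z. E (exp (- z)) * exp (c * z)) \<longlongrightarrow> 0) at_top"
  shows "E \<in> o[at_right 0](\<lambda>t. t powr c)"
proof (rule smalloI_tendsto)
  have "filterlim (\<lambda>t::real. - ln t) at_top (at_right 0)" by real_asymp
  from filterlim_compose[OF assms this]
  have "((\<lambda>t. E (exp (- (- ln t))) * exp (c * (- ln t))) \<longlongrightarrow> 0) (at_right 0)" .
  moreover have "eventually (\<lambda>t. E (exp (- (- ln t))) * exp (c * (- ln t)) = E t / t powr c) (at_right 0)"
    using eventually_at_right_less[of "0::real"]
    by eventually_elim (simp add: powr_def exp_minus field_simps)
  ultimately show "((\<lambda>t. E t / t powr c) \<longlongrightarrow> 0) (at_right 0)"
    by (rule Lim_transform_eventually)
  show "\<forall>\<^sub>F t in at_right 0. t powr c \<noteq> (0::real)"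
    using eventually_at_right_less[of "0::real"] by eventually_elim simp
qed

section \<open>Asymptotics of the spectral heat content\<close>

text \<open>Integrability and summability are part of the conclusion: the Bochner integral and the
  infinite sum are 0 by convention when they do not exist, so the formulas for \<open>C1\<close> and
  \<open>f\<close> would say little without them.\<close>

theorem theorem3p2:
  fixes G0 G :: "'a::euclidean_space set"
    and R :: "nat \<Rightarrow> 'a \<Rightarrow> 'a" and r :: "nat \<Rightarrow> real" and N :: nat
    and b \<alpha> d K :: real
    and M :: "'w measure" and W :: "real \<Rightarrow> 'w \<Rightarrow> 'a" and S :: "real \<Rightarrow> 'w \<Rightarrow> real"
    and Q :: "'a set \<Rightarrow> real \<Rightarrow> real"
  assumes d: "d = real DIM('a)"
    and G0: "(DIM('a) = 1 \<and> (\<exists>u v. G0 = box u v)) \<or> (DIM('a) \<ge> 2 \<and> bounded G0 \<and> C11_open G0)"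
    and R: "\<And>j. j \<in> {1..N} \<Longrightarrow> similitude (R j) (r j)"
    and r: "(\<Sum>j=1..N. r j ^ DIM('a)) < 1" "1 < (\<Sum>j=1..N. r j ^ (DIM('a) - 1))"
    and G: "G = self_similar_set R N G0"
    and disj: "disjoint_family_on (\<lambda>j. R j ` G) {1..N}"
              "\<And>j. j \<in> {1..N} \<Longrightarrow> R j ` G \<inter> G0 = {}"
    and b: "d - 1 < b" "b < d" "(\<Sum>j=1..N. r j powr b) = 1"
    and \<alpha>: "d - b < \<alpha>" "\<alpha> < 2"
    and W: "brownian_motion M W"
    and S: "stable_subordinator M (\<alpha> / 2) S"
    and indep: "indep_processes M W S"
    and Q: "Q = spectral_heat_content M W S"
    and K: "K = (\<Sum>j=1..N. r j powr b * ln (1 / r j powr \<alpha>))"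
  shows
    "(\<not> arithmetic ((\<lambda>j. ln (1 / r j)) ` {1..N}) \<longrightarrow>
       (let h1 = (\<lambda>z. (measure lebesgue G0 - Q G0 (exp (- z))) * exp ((d - b) * z / \<alpha>));
            h2 = (\<lambda>t. (measure lebesgue G0 - Q G0 t) * t powr (- 1 - (d - b) / \<alpha>));
            C1 = (LINT z|lebesgue. h1 z) / K
        in integrable lebesgue h1 \<and> set_integrable lebesgue {0<..} h2 \<and>
           C1 = (LINT t:{0<..}|lebesgue. h2 t) / K \<and>
           (\<lambda>t. Q G t - (measure lebesgue G - C1 * t powr ((d - b) / \<alpha>)))
             \<in> o[at_right 0](\<lambda>t. t powr ((d - b) / \<alpha>)))) \<and>
     (arithmetic ((\<lambda>j. ln (1 / r j)) ` {1..N}) \<longrightarrow>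
       (let \<rho> = arithmetic_span ((\<lambda>j. ln (1 / r j)) ` {1..N});
            h = (\<lambda>z (n::int). (measure lebesgue G0 - Q G0 (exp (- (z - \<alpha> * of_int n * \<rho>))))
                              * exp ((d - b) / \<alpha> * (z - \<alpha> * of_int n * \<rho>)));
            f = (\<lambda>z. \<alpha> * \<rho> / K * (\<Sum>\<^sub>\<infinity>n. h z n))
        in (\<forall>z. h z summable_on UNIV) \<and>
           (\<lambda>t. Q G t - (measure lebesgue G - f (- ln t) * t powr ((d - b) / \<alpha>)))
             \<in> o[at_right 0](\<lambda>t. t powr ((d - b) / \<alpha>))))"
proof -
  let ?A = "(\<lambda>j. ln (1 / r j)) ` {1..N}"
  interpret killed_bm M W S "\<alpha> / 2"
    using W S indep by unfold_locales
  have \<alpha>0: "0 < \<alpha>" using \<alpha> b by simp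
  have \<alpha>2: "2 * (\<alpha> / 2) = \<alpha>" by simp
  have r0: "0 < r j" if "j \<in> {1..N}" for j using R[OF that] by (simp add: similitude_def)
  \<comment> \<open>The contraction property follows from the volume condition and makes the renewal
    steps \<open>a j\<close> positive.\<close>
  have r1: "r j < 1" if j: "j \<in> {1..N}" for j
  proof (rule ccontr)
    assume "\<not> r j < 1"
    then have "1 \<le> r j ^ DIM('a)" by (intro one_le_power) simp
    also have "\<dots> \<le> (\<Sum>j=1..N. r j ^ DIM('a))"
      using j r0 by (intro member_le_sum) (auto intro: less_imp_le)
    finally show False using r(1) by simp
  qed
  have G0o: "open G0" and G0b: "bounded G0"
    using G0 by (auto simp: C11_open_def bounded_box)
  have layer_ex: "\<exists>C. \<forall>e>0. measure lborel (boundary_layer G0 e) \<le> C * e"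
    using G0
  proof
    assume "DIM('a) = 1 \<and> (\<exists>u v. G0 = box u v)"
    then show ?thesis using interval_boundary_layer by blast
  next
    assume "DIM('a) \<ge> 2 \<and> bounded G0 \<and> C11_open G0"
    then show ?thesis using C11_boundary_layer by blast
  qed
  then obtain CL where CL: "\<And>e. 0 < e \<Longrightarrow> measure lborel (boundary_layer G0 e) \<le> CL * e" by blast
  have G0fin: "emeasure lborel G0 < \<infinity>" using emeasure_bounded_finite[OF G0b] .
  have Go: "open G" and Gfin: "emeasure lborel G < \<infinity>"
    using self_similar_set_volume[OF R r(1) G0o G0fin] unfolding G by auto
  have Gfix: "G = (\<Union>j\<in>{1..N}. R j ` G) \<union> G0"
    unfolding G by (rule self_similar_set_fixpoint)
  define c where "c = (d - b) / \<alpha>"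
  have c: "0 < c" using b \<alpha>0 by (simp add: c_def)
  define loss where "loss D t = enn2real (heat_loss D t)" for D t
  have loss_Q: "measure lebesgue D - Q D t = loss D t" if "open D" "emeasure lborel D < \<infinity>" "0 \<le> t" for D t
    unfolding Q loss_def by (rule heat_content_eq[OF that])
  have loss_fin: "heat_loss D t < \<infinity>" if "open D" "emeasure lborel D < \<infinity>" for D t
    using heat_loss_le[OF that(1)] that(2) by (rule le_less_trans)
  have loss_functional: "loss G t = (\<Sum>j=1..N. r j ^ DIM('a) * loss G (t / r j powr \<alpha>)) + loss G0 t" if t: "0 \<le> t" for t
  proof -
    have RGo: "open (R j ` G)" if "j \<in> {1..N}" for j using similitude_image_open[OF R[OF that] Go] .
    have U: "emeasure lborel (\<Union>j\<in>{1..N}. R j ` G) < \<infinity>"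
    proof -
      have "emeasure lborel (\<Union>j\<in>{1..N}. R j ` G) \<le> emeasure lborel G"
        using Gfix Go by (intro emeasure_mono) auto
      then show ?thesis using Gfin by (rule le_less_trans)
    qed
    have "heat_loss G t = heat_loss ((\<Union>j\<in>{1..N}. R j ` G) \<union> G0) t" using Gfix by simp
    also have "\<dots> = heat_loss (\<Union>j\<in>{1..N}. R j ` G) t + heat_loss G0 t"
    proof (rule heat_loss_Un[OF _ G0o _ _ t])
      show "open (\<Union>j\<in>{1..N}. R j ` G)" using RGo by blast
      show "(\<Union>j\<in>{1..N}. R j ` G) \<inter> G0 = {}" using disj(2) by blast
      show "emeasure lborel ((\<Union>j\<in>{1..N}. R j ` G) \<union> G0) < \<infinity>" using Gfix Gfin by simp
    qed
    also have "heat_loss (\<Union>j\<in>{1..N}. R j ` G) t = (\<Sum>j=1..N. heat_loss (R j ` G) t)"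
      by (rule heat_loss_UNION[OF _ RGo disj(1) U t]) auto
    also have "\<dots> = (\<Sum>j=1..N. ennreal (r j ^ DIM('a)) * heat_loss G (t / r j powr \<alpha>))"
      using heat_loss_similitude[OF R Go Gfin t] unfolding \<alpha>2 by (intro sum.cong) auto
    also have "\<dots> = (\<Sum>j=1..N. ennreal (r j ^ DIM('a) * loss G (t / r j powr \<alpha>)))"
    proof (intro sum.cong refl)
      fix j assume "j \<in> {1..N}"
      then have "0 \<le> r j ^ DIM('a)" using r0 by (simp add: less_imp_le)
      then show "ennreal (r j ^ DIM('a)) * heat_loss G (t / r j powr \<alpha>) = ennreal (r j ^ DIM('a) * loss G (t / r j powr \<alpha>))"
        using loss_fin[OF Go Gfin, of "t / r j powr \<alpha>"] by (simp add: loss_def ennreal_mult)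
    qed
    also have "\<dots> = ennreal (\<Sum>j=1..N. r j ^ DIM('a) * loss G (t / r j powr \<alpha>))"
      using r0 by (intro sum_ennreal) (auto simp: loss_def less_imp_le)
    also have "heat_loss G0 t = ennreal (loss G0 t)"
      using loss_fin[OF G0o G0fin, of t] by (simp add: loss_def)
    also have "ennreal (\<Sum>j=1..N. r j ^ DIM('a) * loss G (t / r j powr \<alpha>)) + ennreal (loss G0 t) =
        ennreal ((\<Sum>j=1..N. r j ^ DIM('a) * loss G (t / r j powr \<alpha>)) + loss G0 t)"
      using r0 by (intro ennreal_plus[symmetric] sum_nonneg) (auto simp: loss_def less_imp_le)
    finally have "loss G t = enn2real (ennreal ((\<Sum>j=1..N. r j ^ DIM('a) * loss G (t / r j powr \<alpha>)) + loss G0 t))"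
      by (simp add: loss_def)
    moreover have "0 \<le> (\<Sum>j=1..N. r j ^ DIM('a) * loss G (t / r j powr \<alpha>)) + loss G0 t"
      using r0 by (intro add_nonneg_nonneg sum_nonneg) (auto simp: loss_def less_imp_le)
    ultimately show ?thesis by simp
  qed
  \<comment> \<open>The midpoint between \<open>d - b\<close> and \<open>min 1 \<alpha>\<close>.
    Both \<open>d - b < 1\<close> and \<open>d - b < \<alpha>\<close> are assumed, so
    \<open>q\<close> is admissible for the layer integral and still exceeds \<open>d - b\<close>,
    which makes \<open>\<epsilon>\<close> positive.\<close>
  define q where "q = (d - b + min 1 \<alpha>) / 2"
  have q: "d - b < q" "0 < q" "q < 1" "q \<le> \<alpha>" using b \<alpha> by (auto simp: q_def min_def)
  obtain C where C: "0 \<le> C" "\<And>t. 0 < t \<Longrightarrow> heat_loss G0 t \<le> ennreal (C * t powr (q / \<alpha>))"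
    using heat_loss_bound[OF G0o G0fin CL, of q] q \<alpha>0 unfolding \<alpha>2 by auto
  have loss_bound: "loss G0 t \<le> C * t powr (q / \<alpha>)" if "0 < t" for t
    unfolding loss_def using C(1) C(2)[OF that] by (intro enn2real_leI) auto
  \<comment> \<open>In \<open>r j powr d = r j powr b * r j powr (d - b)\<close> the first factor is
    the weight \<open>p j\<close>, and the second equals \<open>exp (- c * a j)\<close>, the change
    of the factor \<open>exp (c * z)\<close> under the shift by \<open>a j\<close>.\<close>
  define p a where "p j = r j powr b" and "a j = \<alpha> * ln (1 / r j)" for j
  define h where "h z = loss G (exp (- z)) * exp (c * z)" for z
  define \<psi> where "\<psi> z = loss G0 (exp (- z)) * exp (c * z)" for z
  define \<epsilon> where "\<epsilon> = (q - (d - b)) / \<alpha>"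
  have a_eq: "a j = - \<alpha> * ln (r j)" if "j \<in> {1..N}" for j using r0[OF that] by (simp add: a_def ln_div)
  interpret renewal_equation "{1..N}" p a h \<psi> c "measure lborel G" C \<epsilon>
  proof
    show "0 < p i" if "i \<in> {1..N}" for i using r0[OF that] by (simp add: p_def)
    show "0 < a i" if "i \<in> {1..N}" for i using r0[OF that] r1[OF that] \<alpha>0 by (simp add: a_def)
    show "sum p {1..N} = 1" using b(3) by (simp add: p_def)
    show "h z = (\<Sum>i = 1..N. p i * h (z - a i)) + \<psi> z" for z
    proof -
      have "r j ^ DIM('a) * loss G (exp (- z) / r j powr \<alpha>) * exp (c * z) = p j * h (z - a j)" if j: "j \<in> {1..N}" for j
      proof -
        have 1: "exp (- z) / r j powr \<alpha> = exp (- (z - a j))"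
          using r0[OF j] by (simp add: a_eq[OF j] powr_def exp_diff exp_minus exp_add field_simps)
        have "r j ^ DIM('a) = r j powr d" using r0[OF j] by (simp add: d powr_realpow)
        also have "\<dots> = r j powr b * r j powr (d - b)" by (simp flip: powr_add)
        also have "r j powr (d - b) = exp (- c * a j)"
          using r0[OF j] \<alpha>0 by (simp add: a_eq[OF j] powr_def c_def)
        finally show ?thesis unfolding 1 h_def p_def by (simp add: mult_exp_exp algebra_simps)
      qed
      then have "(\<Sum>j=1..N. r j ^ DIM('a) * loss G (exp (- z) / r j powr \<alpha>)) * exp (c * z) = (\<Sum>i = 1..N. p i * h (z - a i))"
        unfolding sum_distrib_right by (intro sum.cong) auto
      then show ?thesis using loss_functional[of "exp (- z)"] by (simp add: h_def \<psi>_def distrib_right)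
    qed
    show "0 \<le> h z" for z by (simp add: h_def loss_def)
    show "h z \<le> measure lborel G * exp (c * z)" for z
    proof -
      have "loss G (exp (- z)) \<le> measure lborel G" unfolding loss_def measure_def
        using heat_loss_le[OF Go] Gfin by (intro enn2real_mono) auto
      then show ?thesis unfolding h_def by (intro mult_right_mono) auto
    qed
    show "0 < c" by (rule c)
    show "h z * exp (- c * z) \<le> h y * exp (- c * y)" if "y \<le> z" for y z
    proof -
      have "loss G (exp (- z)) \<le> loss G (exp (- y))" unfolding loss_def
        using that loss_fin[OF Go Gfin] by (intro enn2real_mono heat_loss_mono[OF Go Gfin]) auto
      then show ?thesis by (simp add: h_def mult.assoc mult_exp_exp)
    qed
    show "0 \<le> \<psi> z" for z by (simp add: \<psi>_def loss_def)
    show "\<psi> z \<le> C * exp (- \<epsilon> * z)" for z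
    proof -
      have "\<psi> z \<le> C * exp (- z) powr (q / \<alpha>) * exp (c * z)"
        unfolding \<psi>_def by (intro mult_right_mono loss_bound) auto
      also have "\<dots> = C * exp (- \<epsilon> * z)"
        using \<alpha>0 by (simp add: powr_def \<epsilon>_def c_def mult.assoc mult_exp_exp field_simps)
      finally show ?thesis .
    qed
    show "0 < \<epsilon>" using q \<alpha>0 by (simp add: \<epsilon>_def)
  qed simp
  have mean: "semi_mean = K"
    unfolding semi_mean_def K p_def by (intro sum.cong) (auto simp: a_eq r0 ln_div ln_powr)
  have Q_h: "Q G t - (measure lebesgue G - F * t powr c) = - ((h (- ln t) - F) * t powr c)" if t: "0 < t" for t F
  proof -
    have "Q G t = measure lebesgue G - loss G t" using loss_Q[OF Go Gfin, of t] t by simp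
    moreover have "h (- ln t) * t powr c = loss G t" using t by (simp add: h_def powr_def mult.assoc mult_exp_exp)
    ultimately show ?thesis by (simp add: algebra_simps)
  qed
  \<comment> \<open>At \<open>t = exp (- z)\<close> the error divided by \<open>t powr c\<close> is
    \<open>- (h z - F z)\<close>, so each renewal limit translates directly into the
    expansion.\<close>
  have asymp: "(\<lambda>t. Q G t - (measure lebesgue G - F (- ln t) * t powr c)) \<in> o[at_right 0](\<lambda>t. t powr c)"
    if F: "((\<lambda>z. h z - F z) \<longlongrightarrow> 0) at_top" for F
  proof (rule smallo_from_log_scale)
    have "(Q G (exp (- z)) - (measure lebesgue G - F (- ln (exp (- z))) * exp (- z) powr c)) * exp (c * z) = - (h z - F z)" for z
      using Q_h[of "exp (- z)" "F z"] by (simp add: powr_def mult.assoc mult_exp_exp)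
    then show "((\<lambda>z. (Q G (exp (- z)) - (measure lebesgue G - F (- ln (exp (- z))) * exp (- z) powr c)) * exp (c * z)) \<longlongrightarrow> 0) at_top"
      using tendsto_minus[OF F] by simp
  qed
  have \<psi>_Q: "(measure lebesgue G0 - Q G0 (exp (- z))) * exp (c * z) = \<psi> z" for z
    unfolding \<psi>_def using loss_Q[OF G0o G0fin, of "exp (- z)"] by simp
  have ne: "{1..N} \<noteq> {}" by (rule nonempty)
  show ?thesis
  proof (intro conjI impI)
    assume nonarith: "\<not> arithmetic ?A"
    obtain i j where ij: "i \<in> {1..N}" "j \<in> {1..N}" "ln (1 / r i) / ln (1 / r j) \<notin> \<rat>"
      using nonarith unfolding arithmetic_def by blast
    have "a i / a j \<notin> \<rat>" using ij \<alpha>0 by (simp add: a_def)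
    then have lim: "(h \<longlongrightarrow> (LINT x|lborel. \<psi> x) / K) at_top"
      using renewal_nonlattice[OF add_semigroup_dense_irrational[OF a_pos ij(1,2)]] unfolding mean by blast
    let ?h1 = "\<lambda>z. (measure lebesgue G0 - Q G0 (exp (- z))) * exp ((d - b) * z / \<alpha>)"
    let ?h2 = "\<lambda>t. (measure lebesgue G0 - Q G0 t) * t powr (- 1 - (d - b) / \<alpha>)"
    have h1: "?h1 = \<psi>" using \<psi>_Q by (simp add: c_def)
    have h1_int: "integrable lebesgue ?h1" unfolding h1 using \<psi>_integrable by (subst integrable_completion) auto
    have h2: "exp (- z) * ?h2 (exp (- z)) = \<psi> z" for z
    proof -
      have "exp (- z) * exp (- z) powr (- 1 - (d - b) / \<alpha>) = exp (c * z)"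
        using \<alpha>0 by (simp add: powr_def c_def mult_exp_exp field_simps)
      then show ?thesis unfolding \<psi>_Q[symmetric] by (simp add: mult.left_commute)
    qed
    have h2_int: "set_integrable lebesgue {0<..} ?h2" "(LINT t:{0<..}|lebesgue. ?h2 t) = (LINT z|lebesgue. ?h1 z)"
      using exp_substitution[of ?h2] h1_int unfolding h2 h1 by auto
    have int_eq: "(LINT z|lebesgue. ?h1 z) = (LINT x|lborel. \<psi> x)"
      unfolding h1 by (rule integral_completion) simp
    have "(\<lambda>t. Q G t - (measure lebesgue G - (LINT z|lebesgue. ?h1 z) / K * t powr ((d - b) / \<alpha>)))
             \<in> o[at_right 0](\<lambda>t. t powr ((d - b) / \<alpha>))"
      unfolding int_eq c_def[symmetric] by (rule asymp[OF LIM_zero[OF lim]])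
    then show "let h1 = ?h1; h2 = ?h2; C1 = (LINT z|lebesgue. h1 z) / K
        in integrable lebesgue h1 \<and> set_integrable lebesgue {0<..} h2 \<and>
           C1 = (LINT t:{0<..}|lebesgue. h2 t) / K \<and>
           (\<lambda>t. Q G t - (measure lebesgue G - C1 * t powr ((d - b) / \<alpha>)))
             \<in> o[at_right 0](\<lambda>t. t powr ((d - b) / \<alpha>))"
      using h1_int h2_int unfolding Let_def by simp
  next
    assume arith: "arithmetic ?A"
    define \<rho> where "\<rho> = arithmetic_span ?A"
    have A: "finite ?A" "?A \<noteq> {}" "\<And>x. x \<in> ?A \<Longrightarrow> 0 < x" using ne r0 r1 by auto
    note span = arithmetic_span_properties[OF A arith, folded \<rho>_def]
    have "\<exists>n::nat. ln (1 / r j) = \<rho> * real n" if j: "j \<in> {1..N}" for j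
    proof -
      obtain m where m: "ln (1 / r j) / \<rho> = of_int m" using span(2)[of "ln (1 / r j)"] j by (auto elim: Ints_cases)
      have "0 < ln (1 / r j)" using A(3) j by blast
      then have "0 < ln (1 / r j) / \<rho>" using span(1) by simp
      then have "0 < m" unfolding m by simp
      then show ?thesis using m span(1) by (intro exI[of _ "nat m"]) (simp add: field_simps)
    qed
    then obtain n where n: "\<And>j. j \<in> {1..N} \<Longrightarrow> ln (1 / r j) = \<rho> * real (n j)" by metis
    \<comment> \<open>The renewal steps are \<open>\<alpha>\<close> times the logarithms, so their
      lattice constant is \<open>\<alpha> * \<rho>\<close>, the numerator of the prefactor in
      \<open>f\<close>.\<close>
    define l where "l = \<alpha> * \<rho>"
    have l: "0 < l" using \<alpha>0 span(1) by (simp add: l_def)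
    have an: "a j = l * real (n j)" if "j \<in> {1..N}" for j using n[OF that] by (simp add: a_def l_def)
    have n0: "0 < n j" if "j \<in> {1..N}" for j
    proof -
      have "0 < l * real (n j)" using a_pos[OF that] an[OF that] by simp
      then show ?thesis using l by (simp add: zero_less_mult_iff)
    qed
    \<comment> \<open>A common divisor \<open>k\<close> of the \<open>n j\<close> would make
      \<open>k * \<rho>\<close> admissible, so maximality of the span forces coprimality.\<close>
    have gcd: "k = 1" if k: "\<And>j. j \<in> {1..N} \<Longrightarrow> k dvd n j" for k
    proof -
      have k0: "0 < k" using ne k n0 by (metis all_not_in_conv dvd_pos_nat)
      have "real k * \<rho> \<le> \<rho>"
      proof (rule span(3))
        show "real k * \<rho> \<noteq> 0" using k0 span(1) by simp
        fix x assume "x \<in> ?A"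
        then obtain j where j: "j \<in> {1..N}" "x = \<rho> * real (n j)" using n by auto
        obtain m where "n j = k * m" using k[OF j(1)] by (auto elim: dvdE)
        then have "x / (real k * \<rho>) = real m" using j k0 span(1) by simp
        then show "x / (real k * \<rho>) \<in> \<int>" by simp
      qed
      then have "real k \<le> 1" using span(1) by simp
      then show ?thesis using k0 by simp
    qed
    obtain m where m: "\<And>k. m \<le> k \<Longrightarrow> l * real k \<in> add_semigroup {1..N} a"
      by (rule add_semigroup_eventually_lattice[where I = "{1..N}" and a = a and n = n, OF an l n0 ne gcd]) blast+
    have sm: "(\<lambda>k::int. \<psi> (z - l * of_int k)) summable_on UNIV" for z
      by (rule renewal_lattice(1)[where n = n and N = m]) (fact l m an)+
    have lim: "((\<lambda>z. h z - l / K * (\<Sum>\<^sub>\<infinity>k::int. \<psi> (z - l * of_int k))) \<longlongrightarrow> 0) at_top"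
      by (rule renewal_lattice(2)[where n = n and N = m, unfolded mean]) (fact l m an)+
    have hh: "(measure lebesgue G0 - Q G0 (exp (- (z - \<alpha> * of_int n * \<rho>))))
        * exp ((d - b) / \<alpha> * (z - \<alpha> * of_int n * \<rho>)) = \<psi> (z - l * of_int n)" for z and n :: int
      using \<psi>_Q[of "z - l * of_int n"] by (simp add: c_def l_def mult.assoc mult.left_commute mult.commute)
    have "(\<lambda>t. Q G t - (measure lebesgue G - l / K * (\<Sum>\<^sub>\<infinity>n::int. \<psi> (- ln t - l * of_int n)) * t powr c))
             \<in> o[at_right 0](\<lambda>t. t powr c)"
      using asymp[OF lim] .
    then show "let \<rho> = arithmetic_span ?A; h = (\<lambda>z (n::int). (measure lebesgue G0 - Q G0 (exp (- (z - \<alpha> * of_int n * \<rho>))))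
                              * exp ((d - b) / \<alpha> * (z - \<alpha> * of_int n * \<rho>)));
            f = (\<lambda>z. \<alpha> * \<rho> / K * (\<Sum>\<^sub>\<infinity>n. h z n))
        in (\<forall>z. h z summable_on UNIV) \<and>
           (\<lambda>t. Q G t - (measure lebesgue G - f (- ln t) * t powr ((d - b) / \<alpha>)))
             \<in> o[at_right 0](\<lambda>t. t powr ((d - b) / \<alpha>))"
      unfolding Let_def \<rho>_def[symmetric] unfolding hh unfolding c_def[symmetric] l_def[symmetric]
      using sm by blast
  qed
qed


end
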